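(* Let $p$ be a prime. Say that a finite group $X$ satisfies property $(\ast)_p$ if for every $\chi\in\operatorname{Irr}(X)$ with $a:=\nu_p(c(\chi))\ge1$, $[\mathbb{Q}_{p^a}(\chi):\mathbb{Q}_p(\chi)]$ divides $\chi(1)$. Let $G$ be a finite group and $N\trianglelefteq G$ with $p\nmid|G/N|$. (i) If $N$ satisfies $(\ast)_p$, then $G$ satisfies $(\ast)_p$. (ii) If $G/N$ is solvable and $G$ satisfies $(\ast)_p$, then $N$ satisfies $(\ast)_p$.
   Context: $\nu_p$ is the $p$-adic valuation. $\mathbb{Q}_n:=\mathbb{Q}(e^{2\pi i/n})$. $\mathbb{Q}(\chi)$ is the field of values of $\chi$, $c(\chi)$ is the smallest $n\ge1$ with $\mathbb{Q}(\chi)\subseteq\mathbb{Q}_n$, and $\mathbb{Q}_m(\chi)$ is the compositum of $\mathbb{Q}_m$ and $\mathbb{Q}(\chi)$. *)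

theory Defs
  imports "Jordan_Normal_Form.Matrix" "HOL-Algebra.Solvable_Groups"
    "HOL-Algebra.Embedded_Algebras" "HOL-Algebra.Generated_Fields"
    "HOL-Computational_Algebra.Primes" Complex_Main
begin

definition mat_trace :: "complex mat \<Rightarrow> complex" where
  "mat_trace A = (\<Sum>i<dim_row A. A $$ (i, i))"

definition is_rep :: "('a, 'b) monoid_scheme \<Rightarrow> nat \<Rightarrow> ('a \<Rightarrow> complex mat) \<Rightarrow> bool" where
  "is_rep X n \<rho> \<longleftrightarrow>
     (\<forall>g \<in> carrier X. \<rho> g \<in> carrier_mat n n) \<and>
     \<rho> \<one>\<^bsub>X\<^esub> = one_mat n \<and>
     (\<forall>g \<in> carrier X. \<forall>h \<in> carrier X. \<rho> (g \<otimes>\<^bsub>X\<^esub> h) = \<rho> g * \<rho> h)"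

definition is_subspace :: "nat \<Rightarrow> complex vec set \<Rightarrow> bool" where
  "is_subspace n W \<longleftrightarrow> W \<subseteq> carrier_vec n \<and> 0\<^sub>v n \<in> W \<and>
     (\<forall>v \<in> W. \<forall>w \<in> W. v + w \<in> W) \<and> (\<forall>c. \<forall>w \<in> W. c \<cdot>\<^sub>v w \<in> W)"

definition is_irr_rep :: "('a, 'b) monoid_scheme \<Rightarrow> nat \<Rightarrow> ('a \<Rightarrow> complex mat) \<Rightarrow> bool" where
  "is_irr_rep X n \<rho> \<longleftrightarrow> is_rep X n \<rho> \<and> n > 0 \<and>
     \<not> (\<exists>W. is_subspace n W \<and> W \<noteq> {0\<^sub>v n} \<and> W \<noteq> carrier_vec n \<and>
            (\<forall>g \<in> carrier X. \<forall>w \<in> W. \<rho> g *\<^sub>v w \<in> W))"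

definition Irr :: "('a, 'b) monoid_scheme \<Rightarrow> ('a \<Rightarrow> complex) set" where
  "Irr X = {\<chi>. \<exists>n \<rho>. is_irr_rep X n \<rho> \<and> (\<forall>g \<in> carrier X. \<chi> g = mat_trace (\<rho> g))}"

definition C_ring :: "complex ring" where
  "C_ring = \<lparr>carrier = UNIV, monoid.mult = (*), one = 1, zero = 0, add = (+)\<rparr>"

definition field_of_values :: "('a, 'b) monoid_scheme \<Rightarrow> ('a \<Rightarrow> complex) \<Rightarrow> complex set" where
  "field_of_values X \<chi> = generate_field C_ring (\<chi> ` carrier X)"

definition cyclo_field :: "nat \<Rightarrow> complex set" where
  "cyclo_field n = generate_field C_ring {exp (2 * pi * \<i> / of_nat n)}"

definition compositum :: "complex set \<Rightarrow> complex set \<Rightarrow> complex set" where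
  "compositum K L = generate_field C_ring (K \<union> L)"

definition conductor :: "('a, 'b) monoid_scheme \<Rightarrow> ('a \<Rightarrow> complex) \<Rightarrow> nat" where
  "conductor X \<chi> = (LEAST n. n \<ge> 1 \<and> field_of_values X \<chi> \<subseteq> cyclo_field n)"

definition degree_dvd :: "complex set \<Rightarrow> complex set \<Rightarrow> nat \<Rightarrow> bool" where
  "degree_dvd E K m \<longleftrightarrow> (\<exists>d. ring.dimension C_ring d K E \<and> d dvd m)"

definition star_p :: "nat \<Rightarrow> ('a, 'b) monoid_scheme \<Rightarrow> bool" where
  "star_p p X \<longleftrightarrow>
    (\<forall>\<chi> \<in> Irr X.
       let a = multiplicity p (conductor X \<chi>) in
       a \<ge> 1 \<longrightarrow>
       (\<exists>m::nat. \<chi> \<one>\<^bsub>X\<^esub> = of_nat m \<and>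
          degree_dvd (compositum (cyclo_field (p ^ a)) (field_of_values X \<chi>))
                     (compositum (cyclo_field p) (field_of_values X \<chi>)) m))"

end

theory Submission
  imports Defs "HOL-Number_Theory.Number_Theory" "Jordan_Normal_Form.Spectral_Radius"
begin

text \<open>
  Let \<open>M = |G| = p\<^sup>B m'\<close> with \<open>m'\<close> prime to \<open>p\<close>, and let the units \<open>u\<close> modulo \<open>M\<close> act on class
  functions by \<open>g \<mapsto> \<chi>(g\<^sup>u)\<close>; on irreducible characters this is the Galois action. Let \<open>P\<close> be the group of
  those units of \<open>p\<close>-power order that are 1 modulo \<open>p\<close> and fix \<open>\<chi>\<close>. It determines both invariants of
  the statement: for \<open>k \<ge> 1\<close> the \<open>p\<close>-part of the conductor of \<open>\<chi>\<close> divides \<open>p\<^sup>k\<close> iff every unit that is 1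
  modulo \<open>p\<^sup>k m'\<close> lies in \<open>P\<close>, and the field degree is the number of residues of \<open>P\<close> modulo \<open>p\<^sup>a\<close>,
  which is a power of \<open>p\<close>, equal to 1 if \<open>a = 1\<close>; so let \<open>a \<ge> 2\<close> below.

  Let \<open>\<theta>\<close> be a constituent of multiplicity \<open>e\<close> of the restriction of \<open>\<chi>\<close> to \<open>N\<close>, with \<open>t\<close> conjugates
  under \<open>G\<close>, so that \<open>\<chi>(1) = e t \<theta>(1)\<close>. Clifford theory gives \<open>t \<cdot> \<Sum>\<psi>. e\<^sub>\<psi>\<^sup>2 = |G : N|\<close>, the sum ranging over
  the characters \<open>\<psi>\<close> of \<open>G\<close> above \<open>\<theta>\<close>. As the index is prime to \<open>p\<close>, counting fixed points of \<open>p\<close>-groups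
  modulo \<open>p\<close> shows that the stabilizer \<open>P\<close> of \<open>\<chi>\<close> fixes \<open>\<theta>\<close>, and that \<open>\<theta>\<close> lies below some \<open>\<chi>\<close> that is
  fixed by the stabilizer of \<open>\<theta>\<close> and has \<open>e\<close> prime to \<open>p\<close>. In the second case both stabilizers agree and
  the divisibility passes from \<open>\<chi>(1)\<close> to \<open>\<theta>(1)\<close>. In the first case the conductors still have equal
  \<open>p\<close>-parts, because a unit that is 1 modulo \<open>m'\<close> and fixes all constituents of the restriction fixes
  \<open>\<chi>\<close>: on the subgroup generated by \<open>N\<close> and one element, two characters above the same \<open>\<theta>\<close> differ by a
  linear character of the cyclic quotient, whose values are roots of unity of order dividing \<open>m'\<close>.
\<close>

section \<open>Subfields of the complex numbers\<close>

text \<open>Counting fixed points modulo p needs a p-group, which the full stabilizer of a character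
  is not; hence units of p-power order. Nothing is lost: modulo p^a the units that are 1 modulo p
  form a p-group, so every residue of the stabilizer is attained by an element of p-power order. The
  sum of the squared multiplicities is prime to p, whereas the number of characters above \<theta>
  need not be. Characters are therefore counted with these weights, and the fixed \<chi> found in
  this way has a multiplicity that can be cancelled from its degree. The two directions are not
  symmetric. From N to G the character \<chi> is given, and units fixing \<theta> may permute the
  characters above \<theta>, so only one inclusion of stabilizers is available. It points the right
  way for the field degrees, both powers of p, but bounds the conductor from one side only. The
  other bound is checked on the values of \<chi>, one element g at a time, so that only cyclic
  quotients occur. Units that are 1 modulo m' but not modulo p escape this method; it cannot
  separate conductors with p-parts 1 and p, which is where a \<ge> 2 enters.\<close>

definition csubring :: "complex set \<Rightarrow> bool" where
  "csubring R \<longleftrightarrow> 1 \<in> R \<and> (\<forall>x\<in>R. \<forall>y\<in>R. x - y \<in> R \<and> x * y \<in> R)"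

text \<open>Closure is demanded at 0 as well, which is harmless because
  \<open>inverse 0 = 0\<close>. Plain predicates on sets keep the arithmetic of the type
  \<open>complex\<close>; \<open>subfield_C_ring\<close> links them to
  \<open>C_ring\<close>.\<close>

definition csubfield :: "complex set \<Rightarrow> bool" where
  "csubfield K \<longleftrightarrow> csubring K \<and> (\<forall>x\<in>K. inverse x \<in> K)"

lemma csubring_one: "csubring R \<Longrightarrow> 1 \<in> R"
  and csubring_diff: "csubring R \<Longrightarrow> x \<in> R \<Longrightarrow> y \<in> R \<Longrightarrow> x - y \<in> R"
  and csubring_mult: "csubring R \<Longrightarrow> x \<in> R \<Longrightarrow> y \<in> R \<Longrightarrow> x * y \<in> R"
  by (auto simp: csubring_def)

lemma csubring_zero: "csubring R \<Longrightarrow> 0 \<in> R"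
  using csubring_diff[of R 1 1] csubring_one[of R] by simp

lemma csubring_uminus: "csubring R \<Longrightarrow> x \<in> R \<Longrightarrow> - x \<in> R"
  using csubring_diff[of R 0 x] csubring_zero[of R] by simp

lemma csubring_add: "csubring R \<Longrightarrow> x \<in> R \<Longrightarrow> y \<in> R \<Longrightarrow> x + y \<in> R"
  using csubring_diff[of R x "- y"] csubring_uminus[of R y] by simp

lemma csubring_sum: "csubring R \<Longrightarrow> (\<And>i. i \<in> A \<Longrightarrow> f i \<in> R) \<Longrightarrow> sum f A \<in> R"
  by (induction A rule: infinite_finite_induct) (auto intro: csubring_add csubring_zero)

lemma csubring_power: "csubring R \<Longrightarrow> x \<in> R \<Longrightarrow> x ^ k \<in> R"
  by (induction k) (auto intro: csubring_mult csubring_one)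

lemma csubring_Ints: "csubring \<int>" by (auto simp: csubring_def)

lemma csubfield_Rats: "csubfield \<rat>" by (auto simp: csubfield_def csubring_def)

lemma csubfield_csubring: "csubfield K \<Longrightarrow> csubring K"
  by (simp add: csubfield_def)

lemma csubring_of_nat: "csubring R \<Longrightarrow> of_nat k \<in> R"
  by (induction k) (auto intro: csubring_add csubring_one csubring_zero)

lemma csubring_of_int: "csubring R \<Longrightarrow> of_int k \<in> R"
  by (cases k) (auto intro: csubring_uminus csubring_of_nat simp del: of_nat_Suc)

lemma csubfield_Rats_subset: "csubfield K \<Longrightarrow> \<rat> \<subseteq> K"
proof
  fix x :: complex assume K: "csubfield K" and "x \<in> \<rat>"
  then obtain a b where "x = of_int a / of_int b" by (auto elim!: Rats_cases')
  then show "x \<in> K" using K csubring_of_int[of K] csubring_mult[of K "of_int a" "inverse (of_int b)"]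
    by (auto simp: csubfield_def divide_inverse)
qed

section \<open>Polynomials over a subring and simple algebraic extensions\<close>

definition polys :: "complex set \<Rightarrow> complex poly set" where
  "polys R = {F. \<forall>i. coeff F i \<in> R}"

lemma polys_mono: "R \<subseteq> S \<Longrightarrow> polys R \<subseteq> polys S"
  by (auto simp: polys_def)

context
  fixes R assumes R: "csubring R"
begin

lemma polys_diff: "F \<in> polys R \<Longrightarrow> G \<in> polys R \<Longrightarrow> F - G \<in> polys R"
  using R by (auto simp: polys_def csubring_diff)

lemma polys_add: "F \<in> polys R \<Longrightarrow> G \<in> polys R \<Longrightarrow> F + G \<in> polys R"
  using R by (auto simp: polys_def csubring_add)

lemma polys_const: "c \<in> R \<Longrightarrow> [:c:] \<in> polys R"
  using R by (auto simp: polys_def coeff_pCons csubring_zero split: nat.splits)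

lemma polys_pCons: "c \<in> R \<Longrightarrow> F \<in> polys R \<Longrightarrow> pCons c F \<in> polys R"
  using R by (auto simp: polys_def coeff_pCons csubring_zero split: nat.splits)

lemma polys_pCons_iff: "pCons c F \<in> polys R \<longleftrightarrow> c \<in> R \<and> F \<in> polys R"
  using R by (auto simp: polys_def coeff_pCons csubring_zero split: nat.splits)

lemma polys_monom: "c \<in> R \<Longrightarrow> Polynomial.monom c k \<in> polys R"
  using R by (auto simp: polys_def csubring_zero)

lemma polys_mult: "F \<in> polys R \<Longrightarrow> G \<in> polys R \<Longrightarrow> F * G \<in> polys R"
  using R by (auto simp: polys_def coeff_mult intro!: csubring_sum csubring_mult)

lemma polys_smult: "c \<in> R \<Longrightarrow> G \<in> polys R \<Longrightarrow> Polynomial.smult c G \<in> polys R"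
  using R by (auto simp: polys_def intro!: csubring_mult)

text \<open>Used with a monomial for \<open>G\<close>: a value of \<open>F\<close> at a power of x
  becomes the value of another polynomial at x itself.\<close>

lemma polys_pcompose: "F \<in> polys R \<Longrightarrow> G \<in> polys R \<Longrightarrow> pcompose F G \<in> polys R"
proof (induction F)
  case 0 then show ?case by simp
next
  case (pCons a F)
  then show ?case by (auto simp: pcompose_pCons polys_pCons_iff intro!: polys_add polys_mult polys_const)
qed

lemma poly_in_csubring: "F \<in> polys R \<Longrightarrow> x \<in> R \<Longrightarrow> poly F x \<in> R"
  using R by (auto simp: poly_altdef polys_def intro!: csubring_sum csubring_mult csubring_power)

lemma csubring_poly_values: "csubring {poly F x | F. F \<in> polys R}"
  unfolding csubring_def
proof (safe)
  show "\<exists>F. 1 = poly F x \<and> F \<in> polys R" using polys_const[of 1] R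
    by (intro exI[of _ "[:1:]"]) (auto simp: csubring_one)
  fix F G assume "F \<in> polys R" "G \<in> polys R"
  then show "\<exists>H. poly F x - poly G x = poly H x \<and> H \<in> polys R"
    by (intro exI[of _ "F - G"]) (simp add: polys_diff)
next
  fix F G assume "F \<in> polys R" "G \<in> polys R"
  then show "\<exists>H. poly F x * poly G x = poly H x \<and> H \<in> polys R"
    by (intro exI[of _ "F * G"]) (simp add: polys_mult)
qed

end

text \<open>Long division carried out over \<open>K\<close> produces a quotient and a remainder; by
  uniqueness they are the ones that \<open>div\<close> and \<open>mod\<close> compute over the
  complex numbers.\<close>

lemma polys_div_mod:
  assumes K: "csubfield K" and g: "g \<in> polys K" "g \<noteq> 0" and F: "F \<in> polys K"
  shows "F div g \<in> polys K \<and> F mod g \<in> polys K"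
proof -
  note K' = csubfield_csubring[OF K]
  have "\<exists>q r. q \<in> polys K \<and> r \<in> polys K \<and> F = q * g + r \<and> (r = 0 \<or> Polynomial.degree r < Polynomial.degree g)"
    using F
  proof (induction F)
    case 0 then show ?case by (intro exI[of _ 0]) (auto simp: polys_def csubring_zero[OF K'])
  next
    case (pCons a F)
    from pCons.prems have a: "a \<in> K" and F: "F \<in> polys K" by (auto simp: polys_pCons_iff[OF K'])
    from pCons.IH[OF F] obtain q r where qr: "q \<in> polys K" "r \<in> polys K" "F = q * g + r"
       "r = 0 \<or> Polynomial.degree r < Polynomial.degree g" by blast
    \<comment> \<open>This \<open>c\<close>, possibly 0, cancels the coefficient of
      \<open>pCons a r\<close> at the degree of \<open>g\<close>, the highest one that can
      occur.\<close>
    define c where "c = coeff (pCons a r) (Polynomial.degree g) * inverse (lead_coeff g)"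
    have c: "c \<in> K" unfolding c_def using K a qr(2) g(1) polys_pCons[OF K' a qr(2)]
      by (auto simp: polys_def csubfield_def intro!: csubring_mult)
    define r' where "r' = pCons a r - Polynomial.smult c g"
    have "pCons a F = pCons c q * g + r'"
      unfolding r'_def qr(3) by (simp add: algebra_simps)
    moreover have "pCons c q \<in> polys K" using c qr(1) by (simp add: polys_pCons_iff[OF K'])
    moreover have "r' \<in> polys K" unfolding r'_def using a c qr(2) g(1)
      by (intro polys_diff polys_smult K') (auto simp: polys_pCons_iff[OF K'])
    moreover have "r' = 0 \<or> Polynomial.degree r' < Polynomial.degree g"
    proof -
      have 1: "Polynomial.degree (pCons a r) \<le> Polynomial.degree g" using qr(4) by auto
      have "coeff r' (Polynomial.degree g) = 0" using g(2) by (simp add: r'_def c_def)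
      moreover have "Polynomial.degree r' \<le> Polynomial.degree g" unfolding r'_def
        using 1 by (intro degree_diff_le) auto
      ultimately show ?thesis by (metis leading_coeff_0_iff le_neq_implies_less)
    qed
    ultimately show ?case by blast
  qed
  then obtain q r where qr: "q \<in> polys K" "r \<in> polys K" "F = q * g + r"
    "r = 0 \<or> Polynomial.degree r < Polynomial.degree g" by blast
  have "F div g = q" "F mod g = r"
    using qr(4) g(2) unfolding qr(3)
    by (auto simp: div_poly_less mod_poly_less)
  then show ?thesis using qr by simp
qed

text \<open>An annihilator of least degree works: the remainder of any other one modulo
  \<open>g\<close> also vanishes at x and would have smaller degree.\<close>

lemma minimal_poly_exists:
  assumes K: "csubfield K" and F0: "F0 \<in> polys K" "F0 \<noteq> 0" "poly F0 x = 0"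
  obtains g where "g \<in> polys K" "g \<noteq> 0" "poly g x = 0" "Polynomial.degree g > 0"
    "\<And>F. F \<in> polys K \<Longrightarrow> poly F x = 0 \<Longrightarrow> g dvd F"
proof -
  define P where "P g \<longleftrightarrow> g \<in> polys K \<and> g \<noteq> 0 \<and> poly g x = 0" for g
  obtain g where g: "P g" and min: "\<And>h. P h \<Longrightarrow> Polynomial.degree g \<le> Polynomial.degree h"
    using ex_has_least_nat[of P F0 Polynomial.degree] F0 by (auto simp: P_def)
  have dvd: "g dvd F" if F: "F \<in> polys K" "poly F x = 0" for F
  proof -
    have "F mod g \<in> polys K" using polys_div_mod[OF K _ _ F(1), of g] g by (auto simp: P_def)
    moreover have "poly (F mod g) x = 0" using F g
      by (metis (no_types) P_def add.left_neutral div_mult_mod_eq mult_zero_right poly_add poly_mult)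
    ultimately have "F mod g = 0" using min[of "F mod g"] degree_mod_less[of g F] g
      by (auto simp: P_def)
    then show ?thesis by auto
  qed
  have "Polynomial.degree g > 0"
  proof (rule ccontr)
    assume "\<not> ?thesis"
    then obtain c where "g = [:c:]" by (auto elim: degree_eq_zeroE)
    then show False using g by (auto simp: P_def)
  qed
  then show ?thesis using that[of g] g dvd by (auto simp: P_def)
qed

text \<open>Inverses come from a Euclidean descent on the degree of \<open>F\<close>: from g = F q +
  r one gets 1/F(x) = - q(x)/r(x) with r of smaller degree. Minimality of g stands in for
  irreducibility: it excludes r = 0 and r(x) = 0.\<close>

lemma csubfield_adjoin_algebraic:
  assumes K: "csubfield K" and F0: "F0 \<in> polys K" "F0 \<noteq> 0" "poly F0 x = 0"
  shows "csubfield {poly F x | F. F \<in> polys K}"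
proof -
  note K' = csubfield_csubring[OF K]
  let ?L = "{poly F x | F. F \<in> polys K}"
  have L: "csubring ?L" by (rule csubring_poly_values[OF K'])
  from minimal_poly_exists[OF K F0] obtain g where g: "g \<in> polys K" "g \<noteq> 0" "poly g x = 0"
    "Polynomial.degree g > 0" "\<And>F. F \<in> polys K \<Longrightarrow> poly F x = 0 \<Longrightarrow> g dvd F" by metis
  have main: "inverse (poly F x) \<in> ?L" if "F \<in> polys K" "poly F x \<noteq> 0" "Polynomial.degree F < Polynomial.degree g" for F
    using that
  proof (induction "Polynomial.degree F" arbitrary: F rule: less_induct)
    case less
    show ?case
    proof (cases "Polynomial.degree F = 0")
      case True
      then obtain c where c: "F = [:c:]" by (auto elim: degree_eq_zeroE)
      then have "c \<in> K" using less.prems by (simp add: polys_pCons_iff[OF K'])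
      then have "inverse c \<in> K" using K by (auto simp: csubfield_def)
      then show ?thesis using polys_const[OF K'] unfolding c by (auto intro!: exI[of _ "[:inverse c:]"])
    next
      case False
      define q where "q = g div F"
      define r where "r = g mod F"
      have F: "F \<noteq> 0" using less.prems by auto
      have q: "q \<in> polys K" and r: "r \<in> polys K" unfolding q_def r_def
        using polys_div_mod[OF K less.prems(1) F g(1)] by auto
      have eq: "g = F * q + r" by (simp add: q_def r_def)
      have r0: "r \<noteq> 0"
      proof
        assume "r = 0"
        then have "poly q x = 0" using eq g(3) less.prems(2) by auto
        then have "g dvd q" using g(5) q by blast
        moreover have "q \<noteq> 0" using \<open>r = 0\<close> eq g(2) by auto
        ultimately have "Polynomial.degree g \<le> Polynomial.degree q" by (simp add: dvd_imp_degree_le)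
        moreover have "Polynomial.degree g = Polynomial.degree F + Polynomial.degree q"
          using eq \<open>r = 0\<close> F \<open>q \<noteq> 0\<close> by (simp add: degree_mult_eq)
        ultimately show False using False by simp
      qed
      have deg: "Polynomial.degree r < Polynomial.degree F" unfolding r_def
        using degree_mod_less[OF F, of g] r0 False by (auto simp: r_def)
      have rx: "poly r x \<noteq> 0"
      proof
        assume "poly r x = 0"
        then have "g dvd r" using g(5) r by blast
        then have "Polynomial.degree g \<le> Polynomial.degree r" using r0 by (simp add: dvd_imp_degree_le)
        then show False using deg less.prems by simp
      qed
      have "inverse (poly r x) \<in> ?L" using less.hyps[OF deg r rx] deg less.prems by simp
      moreover have "- poly q x \<in> ?L" using csubring_uminus[OF L] q by blast
      ultimately have "- poly q x * inverse (poly r x) \<in> ?L" using csubring_mult[OF L] by blast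
      moreover have "- poly q x * inverse (poly r x) = inverse (poly F x)"
      proof -
        have "poly F x * poly q x + poly r x = 0" using eq g(3) by (metis poly_add poly_mult)
        then have "poly r x = - (poly F x * poly q x)" by (simp add: eq_neg_iff_add_eq_0 add.commute)
        then show ?thesis using rx by (auto simp: field_simps)
      qed
      ultimately show ?thesis by simp
    qed
  qed
  have "inverse (poly F x) \<in> ?L" if F: "F \<in> polys K" for F
  proof (cases "poly F x = 0")
    case True then show ?thesis using csubring_zero[OF L] by simp
  next
    case False
    have eq: "poly F x = poly (F mod g) x" using g(3)
      by (metis (no_types) add.left_neutral div_mult_mod_eq mult_zero_right poly_add poly_mult)
    have "F mod g \<noteq> 0" using eq False by auto
    then have "Polynomial.degree (F mod g) < Polynomial.degree g"
      using degree_mod_less[OF g(2), of F] by auto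
    then show ?thesis using main[of "F mod g"] eq False polys_div_mod[OF K g(1,2) F] by auto
  qed
  then show ?thesis using L unfolding csubfield_def by blast
qed

section \<open>Roots of unity and their Galois conjugates\<close>

text \<open>The inner binomial coefficients are multiples of the prime q, and the cofactors stay in
  \<open>R\<close>. This is additivity of the Frobenius map modulo q R.\<close>

lemma poly_values_int_freshman:
  assumes R: "csubring R" and q: "prime q" and x: "x \<in> R" and y: "y \<in> R"
  shows "\<exists>v\<in>R. (x + y) ^ q = x ^ q + y ^ q + of_nat q * v"
proof -
  have q0: "q > 0" using q prime_gt_0_nat by blast
  have "(x + y) ^ q = (\<Sum>k\<le>q. of_nat (q choose k) * x ^ k * y ^ (q - k))"
    by (rule binomial_ring)
  also have "{..q} = insert 0 (insert q {1..<q})" using q0 by auto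
  also have "(\<Sum>k\<in>\<dots>. of_nat (q choose k) * x ^ k * y ^ (q - k))
     = x ^ q + y ^ q + (\<Sum>k\<in>{1..<q}. of_nat (q choose k) * x ^ k * y ^ (q - k))"
    using q0 by (subst sum.insert) auto
  also have "(\<Sum>k\<in>{1..<q}. of_nat (q choose k) * x ^ k * y ^ (q - k))
     = of_nat q * (\<Sum>k\<in>{1..<q}. of_nat ((q choose k) div q) * (x ^ k * y ^ (q - k)))"
    unfolding sum_distrib_left
  proof (rule sum.cong[OF refl])
    fix k assume "k \<in> {1..<q}"
    then have "q dvd (q choose k)" using q by (intro dvd_choose_prime) auto
    then have "of_nat (q choose k) = (of_nat q * of_nat ((q choose k) div q) :: complex)"
      by (metis dvd_mult_div_cancel of_nat_mult)
    then show "of_nat (q choose k) * x ^ k * y ^ (q - k)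
      = of_nat q * (of_nat ((q choose k) div q) * (x ^ k * y ^ (q - k)))" by simp
  qed
  finally have eq: "(x + y) ^ q = x ^ q + y ^ q
    + of_nat q * (\<Sum>k\<in>{1..<q}. of_nat ((q choose k) div q) * (x ^ k * y ^ (q - k)))" .
  have "(\<Sum>k\<in>{1..<q}. of_nat ((q choose k) div q) * (x ^ k * y ^ (q - k))) \<in> R"
    using R x y by (intro csubring_sum csubring_mult csubring_power csubring_of_nat)
  with eq show ?thesis by blast
qed

lemma poly_power_prime_cong:
  assumes q: "prime q" and F: "F \<in> polys \<int>"
  shows "\<exists>V\<in>polys \<int>. poly F (x ^ q) = poly F x ^ q + of_nat q * poly V x"
proof -
  let ?Z = "{poly V x | V. V \<in> polys \<int>}"
  have Z: "csubring ?Z" by (rule csubring_poly_values[OF csubring_Ints])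
  \<comment> \<open>\<open>P a b\<close> is the congruence b = a^q modulo q inside Z[x]. It respects
    sums, negation and the passage from (a, b) to (x a, x^q b), so Horner's scheme carries it from
    the constants to \<open>F\<close>.\<close>
  define P where "P a b \<longleftrightarrow> a \<in> ?Z \<and> (\<exists>v\<in>?Z. b = a ^ q + of_nat q * v)" for a b
  have q0: "q > 0" using q prime_gt_0_nat by blast
  have P1: "P 1 1" unfolding P_def using csubring_one[OF Z] csubring_zero[OF Z]
    by (intro conjI bexI[of _ 0]) simp_all
  have P0: "P 0 0" unfolding P_def using csubring_zero[OF Z] q0
    by (intro conjI bexI[of _ 0]) simp_all
  have Padd: "P (a + a') (b + b')" if ab: "P a b" "P a' b'" for a b a' b'
  proof -
    from ab obtain v v' where v: "a \<in> ?Z" "v \<in> ?Z" "b = a ^ q + of_nat q * v"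
      "a' \<in> ?Z" "v' \<in> ?Z" "b' = a' ^ q + of_nat q * v'" unfolding P_def by blast
    from poly_values_int_freshman[OF Z q v(1,4)] obtain w where w: "w \<in> ?Z"
      "(a + a') ^ q = a ^ q + a' ^ q + of_nat q * w" by blast
    have "b + b' = (a + a') ^ q + of_nat q * (v + v' - w)" unfolding w v by (simp add: algebra_simps)
    moreover have "v + v' - w \<in> ?Z" using v w by (intro csubring_diff[OF Z] csubring_add[OF Z])
    ultimately show ?thesis unfolding P_def using csubring_add[OF Z v(1,4)] by blast
  qed
  \<comment> \<open>Expanding (a + (-a))^q = 0 settles the sign for odd q and for q = 2
    alike.\<close>
  have Pneg: "P (- a) (- b)" if ab: "P a b" for a b
  proof -
    from ab obtain v where v: "a \<in> ?Z" "v \<in> ?Z" "b = a ^ q + of_nat q * v" unfolding P_def by blast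
    from poly_values_int_freshman[OF Z q v(1) csubring_uminus[OF Z v(1)]] obtain w where w: "w \<in> ?Z"
      "(a + - a) ^ q = a ^ q + (- a) ^ q + of_nat q * w" by blast
    have "- b = (- a) ^ q + of_nat q * (w - v)" 
    proof -
      have "(- a) ^ q = - (a ^ q) - of_nat q * w" using w(2) zero_power[OF q0, where ?'a = complex]
        by (simp add: eq_diff_eq eq_neg_iff_add_eq_0 ac_simps)
      then show ?thesis unfolding v by (simp add: algebra_simps)
    qed
    moreover have "w - v \<in> ?Z" using v w by (intro csubring_diff[OF Z])
    ultimately show ?thesis unfolding P_def using csubring_uminus[OF Z v(1)] by blast
  qed
  \<comment> \<open>For integers the relation is Fermat's little theorem.\<close>
  have Pint: "P (of_int k) (of_int k)" for k
  proof (induction k rule: int_induct[of _ 0])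
    case base then show ?case using P0 by simp
  next
    case (step1 i) then show ?case using Padd[OF step1(2) P1] by simp
  next
    case (step2 i) then show ?case using Padd[OF step2(2) Pneg[OF P1]] by simp
  qed
  have xZ: "x \<in> ?Z"
    using polys_monom[OF csubring_Ints, of 1 1] by (auto simp: poly_monom intro!: exI[of _ "Polynomial.monom 1 1"])
  have Px: "P (x * a) (x ^ q * b)" if ab: "P a b" for a b
  proof -
    from ab obtain v where v: "a \<in> ?Z" "v \<in> ?Z" "b = a ^ q + of_nat q * v" unfolding P_def by blast
    have "x ^ q * b = (x * a) ^ q + of_nat q * (x ^ q * v)" unfolding v
      by (simp add: algebra_simps power_mult_distrib)
    moreover have "x ^ q * v \<in> ?Z" by (intro csubring_mult[OF Z] csubring_power[OF Z] xZ v)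
    ultimately show ?thesis unfolding P_def using csubring_mult[OF Z xZ v(1)] by blast
  qed
  have "P (poly F x) (poly F (x ^ q))" using F
  proof (induction F)
    case 0 then show ?case using P0 by simp
  next
    case (pCons a F)
    then have "a \<in> \<int>" "F \<in> polys \<int>" by (auto simp: polys_pCons_iff[OF csubring_Ints])
    then obtain k where "a = of_int k" by (auto elim: Ints_cases)
    then show ?case using Padd[OF Pint[of k] Px[OF pCons.IH[OF \<open>F \<in> polys \<int>\<close>]]] by simp
  qed
  then show ?thesis unfolding P_def by blast
qed

definition zeta :: "nat \<Rightarrow> complex" where
  "zeta n = exp (2 * pi * \<i> / of_nat n)"

lemma zeta_power_cis: "zeta n ^ k = cis (2 * pi * real k / real n)"
proof -
  have "zeta n = cis (2 * pi / real n)" unfolding zeta_def cis_conv_exp by (simp add: mult_ac)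
  then show ?thesis by (simp add: DeMoivre mult_ac)
qed

lemma zeta_power_self: "n > 0 \<Longrightarrow> zeta n ^ n = 1"
  by (simp add: zeta_power_cis)

lemma zeta_nonzero: "zeta n \<noteq> 0" by (simp add: zeta_def)

lemma power_mod_of_root: "z ^ n = 1 \<Longrightarrow> z ^ (k mod n) = (z :: complex) ^ k"
  by (metis mod_div_mult_eq mult_1_left mult.commute power_add power_mult power_one mult_1_right)

lemma zeta_power_eq_iff:
  assumes "n > 0" shows "zeta n ^ i = zeta n ^ j \<longleftrightarrow> [i = j] (mod n)"
proof -
  have inj: "inj_on (\<lambda>k. zeta n ^ k) {..<n}"
    using bij_betw_roots_unity[OF assms] by (simp add: bij_betw_def zeta_power_cis)
  have "zeta n ^ i = zeta n ^ j \<longleftrightarrow> zeta n ^ (i mod n) = zeta n ^ (j mod n)"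
    using power_mod_of_root[OF zeta_power_self[OF assms]] by simp
  also have "\<dots> \<longleftrightarrow> i mod n = j mod n"
    using inj_on_eq_iff[OF inj, of "i mod n" "j mod n"] assms by simp
  finally show ?thesis by (simp add: cong_def)
qed

lemma zeta_power_eq_1_iff: "n > 0 \<Longrightarrow> zeta n ^ k = 1 \<longleftrightarrow> n dvd k"
  using zeta_power_eq_iff[of n k 0] by (simp add: cong_0_iff)

lemma root_of_unity_zeta_power:
  assumes "n > 0" "z ^ n = 1" obtains k where "k < n" "z = zeta n ^ k"
proof -
  have "z \<in> (\<lambda>k. zeta n ^ k) ` {..<n}"
    using bij_betw_roots_unity[OF assms(1)] assms(2) by (simp add: bij_betw_def zeta_power_cis)
  then show ?thesis using that by auto
qed

lemma zeta_mult: "k > 0 \<Longrightarrow> zeta (k * m) ^ k = zeta m"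
proof -
  assume k: "k > 0"
  have "zeta (k * m) ^ k = exp (of_nat k * (2 * pi * \<i> / of_nat (k * m)))"
    unfolding zeta_def exp_of_nat_mult ..
  also have "of_nat k * (2 * pi * \<i> / of_nat (k * m)) = 2 * pi * \<i> / of_nat m"
    using k by simp
  finally show ?thesis by (simp only: zeta_def)
qed

abbreviation "Xn_minus_1 n \<equiv> Polynomial.monom 1 n - (1 :: complex poly)"

lemma Xn_minus_1_polys: "csubring R \<Longrightarrow> Xn_minus_1 n \<in> polys R"
  using polys_diff[of R "Polynomial.monom 1 n" "[:1:]"] polys_monom[of R 1 n] polys_const[of R 1]
    csubring_one[of R] by (simp add: one_pCons)

lemma Xn_minus_1_nonzero: "n > 0 \<Longrightarrow> Xn_minus_1 n \<noteq> 0"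
proof
  assume "n > 0" "Xn_minus_1 n = 0"
  then have "coeff (Xn_minus_1 n) 0 = 0" by simp
  then show False using \<open>n > 0\<close> by simp
qed

lemma poly_Xn_minus_1: "poly (Xn_minus_1 n) x = x ^ n - 1"
  by (simp add: poly_monom)

lemma finite_Rats_common_denominator:
  assumes "finite S" "S \<subseteq> (\<rat> :: complex set)"
  shows "\<exists>D::nat. D > 0 \<and> (\<forall>s\<in>S. of_nat D * s \<in> \<int>)"
  using assms
proof (induction S)
  case empty then show ?case by (intro exI[of _ 1]) auto
next
  case (insert x S)
  then obtain D where D: "D > 0" "\<forall>s\<in>S. of_nat D * s \<in> \<int>" by auto
  from insert.prems have "x \<in> \<rat>" by simp
  then obtain a b where ab: "x = of_int a / of_int b" "b > 0" by (auto elim!: Rats_cases')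
  define E where "E = D * nat b"
  have b: "of_nat (nat b) = (of_int b :: complex)" using ab by simp
  have "of_nat E * x = of_int (int D * a)" using ab unfolding E_def of_nat_mult b by simp
  moreover have "of_nat E * s \<in> \<int>" if "s \<in> S" for s
  proof -
    have "of_nat E * s = of_int b * (of_nat D * s)" unfolding E_def of_nat_mult b by simp
    then show ?thesis using D(2) that by (metis Ints_mult Ints_of_int)
  qed
  ultimately show ?case using D ab by (intro exI[of _ E]) (auto simp: E_def)
qed

text \<open>A nonzero element of the ring generated by a root of unity is divisible by only finitely
  many integers: reduce modulo the minimal polynomial and bound the denominators.\<close>

lemma root_of_unity_ring_divisors_bounded:
  assumes n: "n > 0" and z: "z ^ n = 1" and W: "W \<in> polys \<int>" and W0: "poly W z \<noteq> 0"
  shows "\<exists>A. \<forall>q::nat. \<forall>V\<in>polys \<int>. poly W z = of_nat q * poly V z \<longrightarrow> q \<le> A"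
proof -
  note Q = csubfield_Rats note Q' = csubfield_csubring[OF Q]
  have "poly (Xn_minus_1 n) z = 0" using z by (simp add: poly_monom)
  with minimal_poly_exists[OF Q Xn_minus_1_polys[OF Q'] Xn_minus_1_nonzero[OF n]]
  obtain g where g: "g \<in> polys \<rat>" "g \<noteq> 0" "poly g z = 0"
    "\<And>F. F \<in> polys \<rat> \<Longrightarrow> poly F z = 0 \<Longrightarrow> g dvd F" by metis
  have polysQ: "F \<in> polys \<rat>" if "F \<in> polys \<int>" for F
    using that polys_mono[OF csubfield_Rats_subset[OF Q]] polys_mono[of \<int> \<rat>] Ints_subset_Rats by blast
  \<comment> \<open>Because z^n = 1, the monomials with exponent below n already produce all
    remainders of monomials modulo \<open>g\<close>; so finitely many coefficients occur and one
    denominator \<open>D\<close> clears them all.\<close>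
  define S where "S = (\<Union>k<n. set (coeffs (Polynomial.monom 1 k mod g)))"
  have "finite S" by (auto simp: S_def)
  moreover have "S \<subseteq> \<rat>"
  proof -
    have "Polynomial.monom 1 k mod g \<in> polys \<rat>" for k
      using polys_div_mod[OF Q g(1,2), of "Polynomial.monom 1 k"] polys_monom[OF Q', of 1 k] by simp
    then have "coeff (Polynomial.monom 1 k mod g) i \<in> \<rat>" for k i by (simp add: polys_def)
    then show ?thesis by (auto simp: S_def coeffs_def split: if_splits)
  qed
  ultimately obtain D where D: "D > 0" "\<forall>s\<in>S. of_nat D * s \<in> \<int>"
    using finite_Rats_common_denominator by metis
  have Dmon: "of_nat D * coeff (Polynomial.monom 1 k mod g) i \<in> \<int>" for k i
  proof -
    have "poly (Polynomial.monom 1 k - Polynomial.monom 1 (k mod n)) z = 0"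
      using power_mod_of_root[OF z, of k] by (simp add: poly_monom)
    then have "g dvd Polynomial.monom 1 k - Polynomial.monom 1 (k mod n)"
      using polys_diff[OF Q' polys_monom[OF Q'] polys_monom[OF Q'], of 1 1] g(4) by auto
    then have eq: "Polynomial.monom 1 k mod g = Polynomial.monom 1 (k mod n) mod g"
      by (simp add: mod_eq_dvd_iff)
    show ?thesis
    proof (cases "coeff (Polynomial.monom 1 k mod g) i = 0")
      case False
      then have "coeff (Polynomial.monom 1 k mod g) i \<in> S"
        unfolding S_def using n coeff_in_coeffs[of "Polynomial.monom 1 k mod g" i] le_degree
        unfolding eq by (metis (no_types, lifting) UN_I coeff_0 lessThan_iff mod_less_divisor)
      then show ?thesis using D by blast
    qed simp
  qed
  have Dmod: "of_nat D * coeff (V mod g) i \<in> \<int>" if "V \<in> polys \<int>" for V i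
  proof -
    have "of_nat D * coeff (V * Polynomial.monom 1 k mod g) i \<in> \<int>" for k using that
    proof (induction V arbitrary: k)
      case 0 then show ?case by simp
    next
      case (pCons a V)
      then have aV: "a \<in> \<int>" "V \<in> polys \<int>" by (auto simp: polys_pCons_iff[OF csubring_Ints])
      have "pCons a V * Polynomial.monom 1 k = Polynomial.smult a (Polynomial.monom 1 k) + V * Polynomial.monom 1 (Suc k)"
        by (simp add: monom_Suc)
      then have "of_nat D * coeff (pCons a V * Polynomial.monom 1 k mod g) i
        = a * (of_nat D * coeff (Polynomial.monom 1 k mod g) i) + of_nat D * coeff (V * Polynomial.monom 1 (Suc k) mod g) i"
        by (simp add: poly_mod_add_left mod_smult_left algebra_simps)
      then show ?case using pCons.IH[OF aV(2), of "Suc k"] Dmon[of k i] aV(1)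
        by simp
    qed
    from this[of 0] show ?thesis by simp
  qed
  have "W mod g \<noteq> 0" using W0 g(3) by (metis add.right_neutral div_mult_mod_eq mult_zero_right poly_mult)
  then obtain i where i: "coeff (W mod g) i \<noteq> 0" by (metis leading_coeff_0_iff)
  \<comment> \<open>A nonzero coefficient of the remainder, cleared of denominators: this integer is
    what q has to divide.\<close>
  obtain w where w: "of_nat D * coeff (W mod g) i = of_int w" using Dmod[OF W, of i] by (auto elim: Ints_cases)
  have w0: "w \<noteq> 0" using w i D by auto
  show ?thesis
  proof (intro exI[of _ "nat \<bar>w\<bar>"] allI ballI impI)
    fix q :: nat and V assume V: "V \<in> polys \<int>" and eq: "poly W z = of_nat q * poly V z"
    have qV: "Polynomial.smult (of_nat q) V \<in> polys \<rat>"
      using polysQ[OF V] by (intro polys_smult Q') auto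
    have "g dvd W - Polynomial.smult (of_nat q) V"
      using eq polys_diff[OF Q' polysQ[OF W] qV] by (intro g(4)) auto
    then have "W mod g = Polynomial.smult (of_nat q) V mod g" by (simp add: mod_eq_dvd_iff)
    then have e: "coeff (W mod g) i = of_nat q * coeff (V mod g) i" by (simp add: mod_smult_left)
    obtain v where v: "of_nat D * coeff (V mod g) i = of_int v" using Dmod[OF V, of i] by (auto elim: Ints_cases)
    have "of_int w = of_nat q * (of_nat D * coeff (V mod g) i)" using w unfolding e by (simp only: mult.left_commute)
    also have "\<dots> = of_int (int q * v)" unfolding v by simp
    finally have "w = int q * v" by (simp only: of_int_eq_iff)
    then have "int q dvd w" by simp
    then have "\<bar>int q\<bar> \<le> \<bar>w\<bar>" using w0 by (rule dvd_imp_le_int[rotated])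
    then show "q \<le> nat \<bar>w\<bar>" by linarith
  qed
qed

text \<open>\<open>P\<close> collects the primes up to \<open>A\<close> that do not divide u. A
  prime q \<le> A divides exactly one of u and n P, because a prime divisor of u divides neither n
  nor \<open>P\<close>; so it cannot divide u + n P.\<close>

lemma coprime_exponent_large_prime_factors:
  assumes n: "n > 0" and cop: "coprime u n"
  shows "\<exists>u'::nat. [u' = u] (mod n) \<and> u' > 0 \<and> (\<forall>q. prime q \<longrightarrow> q dvd u' \<longrightarrow> A < q)"
proof -
  define P where "P = (\<Prod>q | prime q \<and> q \<le> A \<and> \<not> q dvd u. q)"
  have fin: "finite {q. prime q \<and> q \<le> A \<and> \<not> q dvd u}" by (rule finite_subset[of _ "{..A}"]) auto
  have P0: "P > 0" unfolding P_def using prime_gt_0_nat by (intro prod_pos) auto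
  have "A < q" if q: "prime q" "q dvd u + n * P" for q
  proof (rule ccontr)
    assume A: "\<not> A < q"
    show False
    proof (cases "q dvd u")
      case True
      then have "q dvd n * P" using q(2) by (simp add: dvd_add_right_iff)
      moreover have "\<not> q dvd n" using True cop q(1) by (metis coprime_common_divisor_nat not_prime_1 nat_dvd_1_iff_1 coprime_def not_prime_unit)
      ultimately have "q dvd P" using q(1) prime_dvd_mult_iff by blast
      then obtain r where r: "prime r" "\<not> r dvd u" "q dvd r"
        unfolding P_def using prime_dvd_prod_iff[OF fin q(1)] by auto
      then have "q = r" using q(1) primes_dvd_imp_eq by blast
      then show False using r True by simp
    next
      case False
      then have "q dvd P" unfolding P_def using A q(1) fin by (intro dvd_prodI[of _ _ "\<lambda>q. q"]) auto
      then have "q dvd u" using q(2) by (metis dvd_add_left_iff dvd_mult)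
      then show False using False by simp
    qed
  qed
  moreover have "[u + n * P = u] (mod n)" by (simp add: cong_def)
  ultimately show ?thesis using n P0 by (intro exI[of _ "u + n * P"]) auto
qed

text \<open>Landau's proof that the primitive roots of unity are conjugate over the rationals: for a
  prime $q$ that is large compared with the finitely many values $F(z^k)$, the relation $F(z) = 0$
  forces $q \mid F(z^q)$ and hence $F(z^q) = 0$; modulo $n$ every unit is a product of large
  primes.\<close>

theorem root_of_unity_conjugate_Ints:
  assumes n: "n > 0" and z: "z ^ n = 1" and F: "F \<in> polys \<int>" "poly F z = 0" and cop: "coprime u n"
  shows "poly F (z ^ u) = 0"
proof -
  note Z = csubring_Ints
  have Fk: "pcompose F (Polynomial.monom 1 k) \<in> polys \<int>" for k
    using F(1) by (intro polys_pcompose Z polys_monom) auto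
  have Fkz: "poly (pcompose F (Polynomial.monom 1 k)) x = poly F (x ^ k)" for k x
    by (simp add: poly_pcompose poly_monom)
  have "\<exists>A. \<forall>q::nat. \<forall>V\<in>polys \<int>. poly F (z ^ k) \<noteq> 0 \<longrightarrow> poly F (z ^ k) = of_nat q * poly V z \<longrightarrow> q \<le> A" for k
    using root_of_unity_ring_divisors_bounded[OF n z Fk[of k]] unfolding Fkz by blast
  then obtain B where B: "\<And>k q V. V \<in> polys \<int> \<Longrightarrow> poly F (z ^ k) \<noteq> 0 \<Longrightarrow> poly F (z ^ k) = of_nat q * poly V z \<Longrightarrow> q \<le> B k"
    by metis
  \<comment> \<open>Exponents of z matter only modulo n, so one bound serves all values
    F(z^k).\<close>
  define A where "A = Max (B ` {..<n})"
  have BA: "B k \<le> A" if "k < n" for k unfolding A_def using that by (intro Max_ge) auto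
  have step: "poly F (z ^ (q * k)) = 0" if q: "prime q" "A < q" and k: "poly F (z ^ k) = 0" for q k
  proof (rule ccontr)
    assume nz: "poly F (z ^ (q * k)) \<noteq> 0"
    from poly_power_prime_cong[OF q(1) Fk[of k], of z] obtain V where V: "V \<in> polys \<int>"
      "poly F ((z ^ q) ^ k) = poly F (z ^ k) ^ q + of_nat q * poly V z" unfolding Fkz by blast
    have red: "z ^ (q * k mod n) = z ^ (q * k)" by (rule power_mod_of_root[OF z])
    have "poly F (z ^ (q * k mod n)) = of_nat q * poly V z"
      unfolding red using V(2) k prime_gt_0_nat[OF q(1)] by (simp add: power_mult)
    then have "q \<le> B (q * k mod n)" using B[OF V(1), of "q * k mod n" q] nz unfolding red by simp
    then show False using BA[of "q * k mod n"] n q(2) by simp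
  qed
  have all: "poly F (z ^ v) = 0" if "v > 0" "\<forall>q. prime q \<longrightarrow> q dvd v \<longrightarrow> A < q" for v
    using that
  proof (induction v rule: less_induct)
    case (less v)
    show ?case
    proof (cases "v = 1")
      case True then show ?thesis using F(2) by simp
    next
      case False
      then obtain q where q: "prime q" "q dvd v" using prime_factor_nat by blast
      then obtain w where w: "v = q * w" by blast
      have "w < v" "w > 0" using w less.prems(1) prime_gt_1_nat[OF q(1)] by auto
      moreover have "\<forall>r. prime r \<longrightarrow> r dvd w \<longrightarrow> A < r" using less.prems(2) w by simp
      ultimately have "poly F (z ^ w) = 0" using less.IH by blast
      then show ?thesis unfolding w using step[OF q(1)] less.prems(2) q by blast
    qed
  qed
  obtain u' where u': "[u' = u] (mod n)" "u' > 0" "\<forall>q. prime q \<longrightarrow> q dvd u' \<longrightarrow> A < q"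
    using coprime_exponent_large_prime_factors[OF n cop, of A] by blast
  have "z ^ u = z ^ u'" using u'(1) power_mod_of_root[OF z, of u] power_mod_of_root[OF z, of u']
    by (simp add: cong_def)
  then show ?thesis using all[OF u'(2,3)] by simp
qed

theorem root_of_unity_conjugate:
  assumes n: "n > 0" and z: "z ^ n = 1" and F: "F \<in> polys \<rat>" "poly F z = 0" and cop: "coprime u n"
  shows "poly F (z ^ u) = 0"
proof -
  have "set (coeffs F) \<subseteq> \<rat>" using F(1) by (auto simp: coeffs_def polys_def split: if_splits)
  then obtain D where D: "D > 0" "\<forall>s\<in>set (coeffs F). of_nat D * s \<in> \<int>"
    using finite_Rats_common_denominator[of "set (coeffs F)"] by auto
  have "coeff (Polynomial.smult (of_nat D) F) i \<in> \<int>" for i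
  proof (cases "coeff F i = 0")
    case False
    then have "coeff F i \<in> set (coeffs F)" using coeff_in_coeffs[of F i] le_degree by force
    then show ?thesis using D by simp
  qed simp
  then have "Polynomial.smult (of_nat D) F \<in> polys \<int>" by (simp add: polys_def)
  from root_of_unity_conjugate_Ints[OF n z this _ cop] F(2) D show ?thesis by simp
qed

section \<open>The ring \<open>C_ring\<close> and its generated subfields\<close>

lemma field_C_ring: "field C_ring"
proof -
  interpret R: cring C_ring
    by (rule cringI, rule abelian_groupI)
      (auto simp: C_ring_def algebra_simps intro!: comm_monoid.intro comm_monoid_axioms.intro
        monoid.intro exI[of _ "- x" for x])
  show ?thesis
    by (rule R.cring_fieldI2) (auto simp: C_ring_def intro: right_inverse)
qed

lemma C_ring_ops:
  "carrier C_ring = UNIV" "x \<oplus>\<^bsub>C_ring\<^esub> y = x + y" "x \<otimes>\<^bsub>C_ring\<^esub> y = x * y"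
  "\<zero>\<^bsub>C_ring\<^esub> = 0" "\<one>\<^bsub>C_ring\<^esub> = 1" "\<ominus>\<^bsub>C_ring\<^esub> x = - x"
  "x \<noteq> 0 \<Longrightarrow> inv\<^bsub>C_ring\<^esub> x = inverse x"
proof -
  interpret R: field C_ring by (rule field_C_ring)
  show ops: "carrier C_ring = UNIV" "\<And>x y. x \<oplus>\<^bsub>C_ring\<^esub> y = x + y" "\<And>x y. x \<otimes>\<^bsub>C_ring\<^esub> y = x * y"
    "\<zero>\<^bsub>C_ring\<^esub> = 0" "\<one>\<^bsub>C_ring\<^esub> = 1" by (simp_all add: C_ring_def)
  show "\<ominus>\<^bsub>C_ring\<^esub> x = - x" using R.sum_zero_eq_neg[of "- x" x] by (simp add: ops)
  show "x \<noteq> 0 \<Longrightarrow> inv\<^bsub>C_ring\<^esub> x = inverse x" using R.comm_inv_char[of x "inverse x"] by (simp add: ops)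
qed

lemma subfield_C_ring:
  assumes "csubfield K" shows "subfield K C_ring"
proof -
  interpret R: field C_ring by (rule field_C_ring)
  have K: "csubring K" using assms by (rule csubfield_csubring)
  have "subring K C_ring"
    by (rule R.subringI) (auto simp: C_ring_ops intro: csubring_one csubring_uminus csubring_mult csubring_add K)
  then show ?thesis
    by (rule R.subfieldI') (use assms in \<open>auto simp: C_ring_ops csubfield_def\<close>)
qed

lemma csubfield_generate: "csubfield (generate_field C_ring S)"
proof -
  let ?K = "generate_field C_ring S"
  have add: "x + y \<in> ?K" and mult: "x * y \<in> ?K" if "x \<in> ?K" "y \<in> ?K" for x y
    using generate_field.eng_add[OF that] generate_field.eng_mult[OF that] by (simp_all add: C_ring_ops)
  have neg: "- x \<in> ?K" if "x \<in> ?K" for x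
    using generate_field.a_inv[OF that] by (simp add: C_ring_ops)
  have one: "1 \<in> ?K" using generate_field.one[of C_ring S] by (simp add: C_ring_ops)
  have "inverse x \<in> ?K" if "x \<in> ?K" for x
    using generate_field.m_inv[OF that] that by (cases "x = 0") (simp_all add: C_ring_ops)
  moreover have "x - y \<in> ?K" if "x \<in> ?K" "y \<in> ?K" for x y
    using add[OF that(1) neg[OF that(2)]] by simp
  ultimately show ?thesis using mult one unfolding csubfield_def csubring_def by blast
qed

lemma generate_field_minimal:
  assumes K: "csubfield K" and S: "S \<subseteq> K" shows "generate_field C_ring S \<subseteq> K"
proof
  note K' = csubfield_csubring[OF K]
  fix x assume "x \<in> generate_field C_ring S"
  then show "x \<in> K"
    by (induction rule: generate_field.induct)
      (use S K K' in \<open>auto simp: C_ring_ops csubfield_def intro: csubring_one csubring_uminus csubring_add csubring_mult\<close>)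
qed

lemma generate_field_superset: "S \<subseteq> generate_field C_ring S"
  by (auto intro: generate_field.incl)

section \<open>Cyclotomic fields and their automorphisms\<close>

text \<open>In this form every element comes with a rational polynomial, which is what the
  automorphisms act on; \<open>cyclo_field_eq_cyc\<close> identifies it with the generated
  field.\<close>

definition cyc :: "nat \<Rightarrow> complex set" where
  "cyc n = {poly F (zeta n) | F. F \<in> polys \<rat>}"

lemma csubfield_cyc: "n > 0 \<Longrightarrow> csubfield (cyc n)"
  unfolding cyc_def
  by (rule csubfield_adjoin_algebraic[OF csubfield_Rats Xn_minus_1_polys Xn_minus_1_nonzero])
     (auto simp: poly_monom zeta_power_self intro: csubfield_csubring csubfield_Rats)

lemma cyc_polyI: "F \<in> polys \<rat> \<Longrightarrow> poly F (zeta n) \<in> cyc n"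
  by (auto simp: cyc_def)

lemma zeta_power_in_cyc: "zeta n ^ k \<in> cyc n"
  using cyc_polyI[of "Polynomial.monom 1 k" n] polys_monom[OF csubfield_csubring[OF csubfield_Rats], of 1 k]
  by (simp add: poly_monom)

lemma cyclo_field_eq_cyc: "n > 0 \<Longrightarrow> cyclo_field n = cyc n"
proof
  assume n: "n > 0"
  have z: "cyclo_field n = generate_field C_ring {zeta n}"
    unfolding cyclo_field_def zeta_def by (simp add: mult_ac)
  show "cyclo_field n \<subseteq> cyc n" unfolding z
    using zeta_power_in_cyc[of n 1] by (intro generate_field_minimal csubfield_cyc n) auto
  let ?K = "generate_field C_ring {zeta n}"
  have K: "csubfield ?K" by (rule csubfield_generate)
  have "poly F (zeta n) \<in> ?K" if "F \<in> polys \<rat>" for F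
    using that polys_mono[OF csubfield_Rats_subset[OF K]] generate_field_superset[of "{zeta n}"]
    by (intro poly_in_csubring csubfield_csubring K) auto
  then show "cyc n \<subseteq> cyclo_field n" by (auto simp: z cyc_def)
qed

lemma cyc_mono: assumes "c dvd n" "n > 0" shows "cyc c \<subseteq> cyc n"
proof -
  obtain k where k: "n = k * c" using assms by (metis dvdE mult.commute)
  then have z: "zeta n ^ k = zeta c" using zeta_mult[of k c] assms by simp
  have "poly F (zeta c) \<in> cyc n" if "F \<in> polys \<rat>" for F
    using that polys_mono[OF csubfield_Rats_subset[OF csubfield_cyc[OF assms(2)]]]
      zeta_power_in_cyc[of n k] unfolding z
    by (intro poly_in_csubring csubfield_csubring csubfield_cyc assms) auto
  then show ?thesis by (auto simp: cyc_def[of c])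
qed

text \<open>The automorphism that sends \<open>zeta n\<close> to its u-th power. The polynomial is
  chosen arbitrarily; \<open>gal_poly\<close> shows independence of the choice for u prime to n and
  arguments in \<open>cyc n\<close>, the only case in which the function is meaningful.\<close>

definition gal :: "nat \<Rightarrow> nat \<Rightarrow> complex \<Rightarrow> complex" where
  "gal n u x = poly (SOME F. F \<in> polys \<rat> \<and> poly F (zeta n) = x) (zeta n ^ u)"

text \<open>Two representing polynomials differ by one that vanishes at \<open>zeta n\<close>, hence
  also at the conjugate root \<open>zeta n ^ u\<close>.\<close>

lemma gal_poly:
  assumes n: "n > 0" and u: "coprime u n" and F: "F \<in> polys \<rat>"
  shows "gal n u (poly F (zeta n)) = poly F (zeta n ^ u)"
proof -
  define G where "G = (SOME G. G \<in> polys \<rat> \<and> poly G (zeta n) = poly F (zeta n))"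
  have G: "G \<in> polys \<rat> \<and> poly G (zeta n) = poly F (zeta n)"
    unfolding G_def by (rule someI[of _ F]) (use F in simp)
  have "poly (G - F) (zeta n ^ u) = 0"
    by (rule root_of_unity_conjugate[OF n zeta_power_self[OF n] _ _ u])
      (use F G in \<open>auto intro!: polys_diff csubfield_csubring csubfield_Rats\<close>)
  then show ?thesis unfolding gal_def G_def by simp
qed

context
  fixes n u :: nat assumes n: "n > 0" and u: "coprime u n"
begin

lemma gal_in_cyc: "x \<in> cyc n \<Longrightarrow> gal n u x \<in> cyc n"
proof -
  assume "x \<in> cyc n"
  then obtain F where F: "F \<in> polys \<rat>" "x = poly F (zeta n)" by (auto simp: cyc_def)
  have "poly F (zeta n ^ u) \<in> cyc n"
    using F(1) polys_mono[OF csubfield_Rats_subset[OF csubfield_cyc[OF n]]] zeta_power_in_cyc[of n u]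
    by (intro poly_in_csubring csubfield_csubring csubfield_cyc n) auto
  then show ?thesis using gal_poly[OF n u F(1)] F(2) by simp
qed

lemma gal_diff: "x \<in> cyc n \<Longrightarrow> y \<in> cyc n \<Longrightarrow> gal n u (x - y) = gal n u x - gal n u y"
  and gal_add: "x \<in> cyc n \<Longrightarrow> y \<in> cyc n \<Longrightarrow> gal n u (x + y) = gal n u x + gal n u y"
  and gal_mult: "x \<in> cyc n \<Longrightarrow> y \<in> cyc n \<Longrightarrow> gal n u (x * y) = gal n u x * gal n u y"
proof -
  assume "x \<in> cyc n" "y \<in> cyc n"
  then obtain F G where F: "F \<in> polys \<rat>" "x = poly F (zeta n)" and G: "G \<in> polys \<rat>" "y = poly G (zeta n)"
    by (auto simp: cyc_def)
  note Q = csubfield_csubring[OF csubfield_Rats]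
  show "gal n u (x - y) = gal n u x - gal n u y"
    using gal_poly[OF n u polys_diff[OF Q F(1) G(1)]] gal_poly[OF n u F(1)] gal_poly[OF n u G(1)]
    by (simp add: F(2) G(2))
  show "gal n u (x + y) = gal n u x + gal n u y"
    using gal_poly[OF n u polys_add[OF Q F(1) G(1)]] gal_poly[OF n u F(1)] gal_poly[OF n u G(1)]
    by (simp add: F(2) G(2))
  show "gal n u (x * y) = gal n u x * gal n u y"
    using gal_poly[OF n u polys_mult[OF Q F(1) G(1)]] gal_poly[OF n u F(1)] gal_poly[OF n u G(1)]
    by (simp add: F(2) G(2))
qed

lemma gal_Rats: "x \<in> \<rat> \<Longrightarrow> gal n u x = x"
  using gal_poly[OF n u, of "[:x:]"] polys_const[OF csubfield_csubring[OF csubfield_Rats], of x] by simp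

lemma gal_zeta_power: "gal n u (zeta n ^ k) = zeta n ^ (u * k)"
  using gal_poly[OF n u, of "Polynomial.monom 1 k"] polys_monom[OF csubfield_csubring[OF csubfield_Rats], of 1 k]
  by (simp add: poly_monom power_mult)

lemma gal_inverse: "x \<in> cyc n \<Longrightarrow> gal n u (inverse x) = inverse (gal n u x)"
proof (cases "x = 0")
  case True then show ?thesis using gal_Rats[of 0] by simp
next
  case False
  assume x: "x \<in> cyc n"
  then have "inverse x \<in> cyc n" using csubfield_cyc[OF n] by (auto simp: csubfield_def)
  then have "gal n u x * gal n u (inverse x) = 1"
    using gal_mult[OF x, of "inverse x"] gal_Rats[of 1] False by simp
  then show ?thesis by (metis inverse_unique)
qed

lemma gal_sum: "(\<And>i. i \<in> A \<Longrightarrow> f i \<in> cyc n) \<Longrightarrow> gal n u (sum f A) = (\<Sum>i\<in>A. gal n u (f i))"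
proof (induction A rule: infinite_finite_induct)
  case (insert x A)
  then have "sum f A \<in> cyc n" by (intro csubring_sum csubfield_csubring csubfield_cyc n) auto
  then show ?case using insert by (simp add: gal_add)
qed (use gal_Rats[of 0] in auto)

lemma gal_eq_iff: "x \<in> cyc n \<Longrightarrow> y \<in> cyc n \<Longrightarrow> gal n u x = gal n u y \<longleftrightarrow> x = y"
proof
  assume x: "x \<in> cyc n" and y: "y \<in> cyc n" and eq: "gal n u x = gal n u y"
  show "x = y"
  proof (rule ccontr)
    assume "x \<noteq> y"
    define z where "z = x - y"
    have z: "z \<in> cyc n" "z \<noteq> 0" using x y \<open>x \<noteq> y\<close> csubring_diff[OF csubfield_csubring[OF csubfield_cyc[OF n]]]
      by (auto simp: z_def)
    have "inverse z \<in> cyc n" using z csubfield_cyc[OF n] by (auto simp: csubfield_def)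
    then have "gal n u (inverse z) * gal n u z = gal n u (inverse z * z)" using gal_mult[of "inverse z" z] z by simp
    also have "\<dots> = 1" using z gal_Rats[of 1] by simp
    finally show False using gal_diff[OF x y] eq by (simp add: z_def)
  qed
qed simp

lemma csubfield_fixed: "csubfield {x \<in> cyc n. gal n u x = x}"
  using csubfield_cyc[OF n] gal_Rats[of 1]
  by (auto simp: csubfield_def csubring_def gal_diff gal_mult gal_inverse)

text \<open>Compatibility of levels: on the subfield of level c the automorphism u of the large
  field is again the one that raises \<open>zeta c\<close> to the power u, since
  \<open>zeta c\<close> is a power of \<open>zeta n\<close>.\<close>

lemma gal_cyc_dvd:
  assumes "c dvd n" "F \<in> polys \<rat>" shows "gal n u (poly F (zeta c)) = poly F (zeta c ^ u)"
proof -
  obtain k where k: "n = k * c" using assms by (metis dvdE mult.commute)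
  then have z: "zeta n ^ k = zeta c" using zeta_mult[of k c] n by simp
  have "pcompose F (Polynomial.monom 1 k) \<in> polys \<rat>"
    using assms(2) by (intro polys_pcompose polys_monom csubfield_csubring csubfield_Rats) auto
  from gal_poly[OF n u this] show ?thesis
    by (simp add: poly_pcompose poly_monom z flip: power_mult) (simp add: mult.commute power_mult z)
qed

end

lemma gal_cong:
  assumes n: "n > 0" and c: "c dvd n" and x: "x \<in> cyc c" and uv: "[u = v] (mod c)" "coprime u n" "coprime v n"
  shows "gal n u x = gal n v x"
proof -
  obtain F where F: "F \<in> polys \<rat>" "x = poly F (zeta c)" using x by (auto simp: cyc_def)
  have "zeta c ^ u = zeta c ^ v" using zeta_power_eq_iff[of c u v] uv c n by auto
  then show ?thesis using gal_cyc_dvd[OF n _ c F(1)] uv F(2) by simp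
qed

lemma gal_one: "n > 0 \<Longrightarrow> x \<in> cyc n \<Longrightarrow> gal n 1 x = x"
  by (auto simp: cyc_def gal_poly)

lemma gal_gal:
  assumes n: "n > 0" and uv: "coprime u n" "coprime v n" and x: "x \<in> cyc n"
  shows "gal n u (gal n v x) = gal n (u * v) x"
proof -
  obtain F where F: "F \<in> polys \<rat>" "x = poly F (zeta n)" using x by (auto simp: cyc_def)
  have "pcompose F (Polynomial.monom 1 v) \<in> polys \<rat>"
    using F by (intro polys_pcompose polys_monom csubfield_csubring csubfield_Rats) auto
  from gal_poly[OF n uv(1) this] gal_poly[OF n uv(2) F(1)] gal_poly[OF n _ F(1), of "u * v"] uv F(2)
  show ?thesis by (simp add: poly_pcompose poly_monom power_mult)
qed

section \<open>Galois correspondence and intersections of cyclotomic fields\<close>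

definition fixes_pointwise :: "nat \<Rightarrow> complex set \<Rightarrow> nat \<Rightarrow> bool" where
  "fixes_pointwise n S u \<longleftrightarrow> coprime u n \<and> (\<forall>x\<in>S. gal n u x = x)"

text \<open>The roots of the minimal polynomial of a primitive root of unity over a field \<open>K\<close> are its images
  under the automorphisms that fix \<open>K\<close>; a polynomial expression over \<open>K\<close> of smaller degree that
  takes the same value at all of them is constant.\<close>

theorem fixed_field:
  assumes n: "n > 0" and K: "csubfield K" "K \<subseteq> cyc n" and x: "x \<in> cyc n"
    and fix_x: "\<And>u. fixes_pointwise n K u \<Longrightarrow> gal n u x = x"
  shows "x \<in> K"
proof -
  note K' = csubfield_csubring[OF K(1)]
  have QK: "polys \<rat> \<subseteq> polys K" by (rule polys_mono[OF csubfield_Rats_subset[OF K(1)]])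
  let ?z = "zeta n"
  have z: "?z ^ n = 1" using n by (rule zeta_power_self)
  have "poly (Xn_minus_1 n) ?z = 0" using z by (simp add: poly_monom)
  with minimal_poly_exists[OF K(1) Xn_minus_1_polys[OF K'] Xn_minus_1_nonzero[OF n]]
  obtain g where g: "g \<in> polys K" "g \<noteq> 0" "poly g ?z = 0" "Polynomial.degree g > 0"
    "\<And>F. F \<in> polys K \<Longrightarrow> poly F ?z = 0 \<Longrightarrow> g dvd F" by metis
  have root: "\<exists>u. y = ?z ^ u \<and> fixes_pointwise n K u" if y: "poly g y = 0" for y
  proof -
    have van: "poly F y = 0" if "F \<in> polys K" "poly F ?z = 0" for F
      using g(5)[OF that] y by (auto elim!: dvdE)
    have "poly (Xn_minus_1 n) y = 0"
      by (rule van[OF Xn_minus_1_polys[OF K']]) (simp add: poly_monom z)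
    then have "y ^ n = 1" by (simp add: poly_monom)
    then obtain u where u: "y = ?z ^ u" using root_of_unity_zeta_power[OF n] by metis
    have cop: "coprime u n"
    proof (rule ccontr)
      assume nc: "\<not> coprime u n"
      define d where "d = gcd u n"
      define m where "m = n div d"
      have d: "d > 1" using nc n unfolding d_def
        by (metis coprime_iff_gcd_eq_1 gcd_eq_0_iff less_one linorder_neqE_nat neq0_conv)
      have nm: "n = m * d" by (simp add: m_def d_def)
      have mn: "m < n" "m > 0" using nm d n by auto
      \<comment> \<open>This is (X^n - 1)/(X^m - 1). It vanishes at \<open>zeta n\<close>, where the
        m-th power is not 1, but equals d at y, where it is 1; so y must be a primitive root of
        unity.\<close>
      define S :: "complex poly" where "S = (\<Sum>j<d. Polynomial.monom 1 (m * j))"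
      have "coeff S i \<in> K" for i unfolding S_def coeff_sum coeff_monom
        by (intro csubring_sum K') (auto intro: csubring_zero[OF K'] csubring_one[OF K'])
      then have S: "S \<in> polys K" by (simp add: polys_def)
      have Sv: "poly S w = (\<Sum>j<d. (w ^ m) ^ j)" for w
        unfolding S_def by (simp add: poly_sum poly_monom power_mult)
      have "?z ^ m \<noteq> 1" using zeta_power_eq_1_iff[OF n, of m] mn by (auto dest: dvd_imp_le)
      moreover have "(?z ^ m) ^ d = 1" using z nm by (simp add: power_mult)
      ultimately have "poly S ?z = 0" unfolding Sv by (subst geometric_sum) auto
      then have "poly S y = 0" by (rule van[OF S])
      moreover have "y ^ m = 1"
      proof -
        obtain e where e: "u = d * e" unfolding d_def by (metis dvdE gcd_dvd1)
        have "y ^ m = (?z ^ n) ^ e" unfolding u e nm by (simp add: mult_ac flip: power_mult)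
        then show ?thesis using z by simp
      qed
      ultimately show False unfolding Sv using d by simp
    qed
    have "gal n u k = k" if k: "k \<in> K" for k
    proof -
      obtain F where F: "F \<in> polys \<rat>" "k = poly F ?z" using K(2) k by (auto simp: cyc_def)
      have "poly (F - [:k:]) y = 0"
        by (rule van) (use F QK k in \<open>auto intro!: polys_diff[OF K'] polys_const[OF K']\<close>)
      then show ?thesis using gal_poly[OF n cop F(1)] F(2) u by simp
    qed
    then show ?thesis using u cop by (auto simp: fixes_pointwise_def)
  qed
  \<comment> \<open>\<open>g\<close> divides X^n - 1, whose n roots are distinct; at most deg h of
    them belong to the cofactor, so at least deg g belong to \<open>g\<close>.\<close>
  have card_roots: "card {y. poly g y = 0} \<ge> Polynomial.degree g"
  proof -
    have "g dvd Xn_minus_1 n" by (rule g(5)[OF Xn_minus_1_polys[OF K']]) (simp add: poly_monom z)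
    then obtain h where h: "Xn_minus_1 n = g * h" by (elim dvdE)
    have h0: "h \<noteq> 0" using h Xn_minus_1_nonzero[OF n] by auto
    have deg: "Polynomial.degree (Xn_minus_1 n) = n"
    proof (rule antisym)
      show "Polynomial.degree (Xn_minus_1 n) \<le> n" by (rule degree_diff_le) (auto simp: degree_monom_le)
      show "n \<le> Polynomial.degree (Xn_minus_1 n)" using n by (intro le_degree) simp
    qed
    have "{y. y ^ n = 1} = {y. poly g y = 0} \<union> {y. poly h y = 0}"
    proof -
      have "y ^ n = 1 \<longleftrightarrow> poly g y * poly h y = 0" for y
        using poly_Xn_minus_1[of n y] unfolding h by simp
      then show ?thesis by auto
    qed
    then have "n = card ({y. poly g y = 0} \<union> {y. poly h y = 0})"
      using card_roots_unity_eq[OF n] by simp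
    also have "\<dots> \<le> card {y. poly g y = 0} + card {y. poly h y = 0}" by (rule card_Un_le)
    also have "card {y. poly h y = 0} \<le> Polynomial.degree h" by (rule card_poly_roots_bound[OF h0])
    finally show ?thesis using deg h g(2) h0 by (simp add: degree_mult_eq)
  qed
  obtain F where F: "F \<in> polys \<rat>" "x = poly F ?z" using x by (auto simp: cyc_def)
  define R where "R = F mod g"
  have R: "R \<in> polys K" unfolding R_def using polys_div_mod[OF K(1) g(1,2)] F(1) QK by blast
  have degR: "Polynomial.degree (R - [:x:]) < Polynomial.degree g"
    using degree_mod_less[OF g(2), of F] g(4) by (intro degree_diff_less) (auto simp: R_def)
  have "R - [:x:] = 0"
  proof (rule ccontr)
    assume nz: "R - [:x:] \<noteq> 0"
    have "{y. poly g y = 0} \<subseteq> {y. poly (R - [:x:]) y = 0}"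
    proof safe
      fix y assume y: "poly g y = 0"
      then obtain u where u: "y = ?z ^ u" "fixes_pointwise n K u" using root by blast
      have "F = F div g * g + R" by (simp add: R_def)
      then have "poly F y = poly R y" using y by (metis add.left_neutral mult_zero_right poly_add poly_mult)
      moreover have "poly F y = x"
        using fix_x[OF u(2)] gal_poly[OF n _ F(1), of u] u F(2) by (simp add: fixes_pointwise_def)
      ultimately show "poly (R - [:x:]) y = 0" by simp
    qed
    then have "Polynomial.degree g \<le> card {y. poly (R - [:x:]) y = 0}"
      using card_roots card_mono[OF poly_roots_finite[OF nz]] by (meson order_trans)
    also have "\<dots> \<le> Polynomial.degree (R - [:x:])" by (rule card_poly_roots_bound[OF nz])
    finally show False using degR by simp
  qed
  then have "x = coeff R 0" by simp
  then show ?thesis using R by (simp add: polys_def)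
qed

text \<open>An automorphism is trivial on the field of level c iff it fixes \<open>zeta c\<close>,
  that is, iff u is 1 modulo c; the rest is \<open>fixed_field\<close> for this subfield.\<close>

lemma subset_cyc_iff:
  assumes n: "n > 0" and c: "c dvd n" and S: "S \<subseteq> cyc n"
  shows "S \<subseteq> cyc c \<longleftrightarrow> (\<forall>u. coprime u n \<longrightarrow> [u = 1] (mod c) \<longrightarrow> fixes_pointwise n S u)"
proof
  assume Sc: "S \<subseteq> cyc c"
  show "\<forall>u. coprime u n \<longrightarrow> [u = 1] (mod c) \<longrightarrow> fixes_pointwise n S u"
  proof (intro allI impI)
    fix u assume u: "coprime u n" "[u = 1] (mod c)"
    have "gal n u x = x" if x: "x \<in> S" for x
    proof -
      have "gal n u x = gal n 1 x" using x Sc u by (intro gal_cong[OF n c]) auto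
      then show ?thesis using gal_one[OF n] x S by auto
    qed
    then show "fixes_pointwise n S u" using u by (simp add: fixes_pointwise_def)
  qed
next
  assume H: "\<forall>u. coprime u n \<longrightarrow> [u = 1] (mod c) \<longrightarrow> fixes_pointwise n S u"
  have c0: "c > 0" using c n by (metis dvd_0_left_iff gr0I)
  show "S \<subseteq> cyc c"
  proof
    fix x assume x: "x \<in> S"
    show "x \<in> cyc c"
    proof (rule fixed_field[OF n csubfield_cyc[OF c0] cyc_mono[OF c n]])
      show "x \<in> cyc n" using x S by blast
      fix u assume u: "fixes_pointwise n (cyc c) u"
      then have cop: "coprime u n" by (simp add: fixes_pointwise_def)
      have "gal n u (zeta c) = zeta c ^ u"
        using gal_cyc_dvd[OF n cop c, of "[:0,1:]"] polys_monom[OF csubfield_csubring[OF csubfield_Rats], of 1 1]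
        by (simp add: monom_Suc monom_0)
      moreover have "gal n u (zeta c) = zeta c"
        using u zeta_power_in_cyc[of c 1] by (simp add: fixes_pointwise_def)
      ultimately have "[u = 1] (mod c)" using zeta_power_eq_iff[OF c0, of u 1] by simp
      then show "gal n u x = x" using H cop x by (auto simp: fixes_pointwise_def)
    qed
  qed
qed

lemma chinese_remainder_gcd:
  fixes x y u :: nat
  assumes xy: "x > 0" "y > 0" and u: "[u = 1] (mod gcd x y)"
  shows "\<exists>v. [v = 1] (mod x) \<and> [v = u] (mod y)"
proof -
  obtain a b where ab: "a * int x + b * int y = int (gcd x y)" using bezout_int[of "int x" "int y"] by auto
  have "int (gcd x y) dvd int u - 1" using u by (metis cong_iff_dvd_diff cong_int_iff of_nat_1)
  then obtain k where k: "int u - 1 = int (gcd x y) * k" by (elim dvdE)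
  \<comment> \<open>u - 1 = (a x + b y) k splits into a multiple of x and a multiple of y;
    \<open>V\<close> keeps only the first one, so it is 1 modulo x and u modulo y.\<close>
  define V where "V = 1 + int x * a * k"
  have V2: "V = int u - int y * (b * k)" 
  proof -
    have "V + int y * (b * k) = 1 + (a * int x + b * int y) * k" unfolding V_def by (simp add: algebra_simps)
    then show ?thesis unfolding ab using k by simp
  qed
  define v where "v = nat (V mod int (x * y))"
  have v: "int v = V mod int (x * y)" unfolding v_def using xy by simp
  have "[int v = V] (mod int x)" "[int v = V] (mod int y)" unfolding v
    by (auto simp: cong_def mod_mod_cancel)
  moreover have "[V = 1] (mod int x)" "[V = int u] (mod int y)"
    by (simp add: V_def cong_iff_dvd_diff mult.assoc) (simp add: V2 cong_iff_dvd_diff)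
  ultimately have "[int v = int 1] (mod int x)" "[int v = int u] (mod int y)"
    by (auto intro: cong_trans)
  then show ?thesis unfolding cong_int_iff by blast
qed

text \<open>A unit u that is 1 modulo the gcd can be replaced by some v that agrees with u modulo y
  and with 1 modulo x. On the intersection u acts as v through level y, and v acts trivially through
  level x.\<close>

lemma cyc_Int_subset:
  assumes xy: "x > 0" "y > 0" shows "cyc x \<inter> cyc y \<subseteq> cyc (gcd x y)"
proof -
  define n where "n = lcm x y"
  have n: "n > 0" unfolding n_def using xy by (simp add: lcm_pos_nat)
  have dvd: "x dvd n" "y dvd n" "gcd x y dvd n" unfolding n_def by (auto intro: dvd_trans[OF gcd_dvd1])
  have S: "cyc x \<inter> cyc y \<subseteq> cyc n" using cyc_mono[OF dvd(1) n] by blast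
  show ?thesis unfolding subset_cyc_iff[OF n dvd(3) S]
  proof (intro allI impI)
    fix u assume u: "coprime u n" "[u = 1] (mod gcd x y)"
    obtain v where v: "[v = 1] (mod x)" "[v = u] (mod y)" using chinese_remainder_gcd[OF xy u(2)] by blast
    have "coprime v x" using v(1) by (metis coprime_1_left cong_imp_coprime cong_sym)
    moreover have "coprime u y" using u(1) dvd(2) by (metis coprime_commute coprime_divisors dvd_refl)
    then have "coprime v y" using v(2) by (metis cong_imp_coprime cong_sym)
    ultimately have "coprime v (x * y)" by simp
    moreover have "n dvd x * y" unfolding n_def by (simp add: lcm_least)
    ultimately have cv: "coprime v n" by (metis coprime_commute coprime_divisors dvd_refl)
    have "gal n u k = k" if k: "k \<in> cyc x \<inter> cyc y" for k
      using gal_cong[OF n dvd(2), of k v u] gal_cong[OF n dvd(1), of k v 1] gal_one[OF n, of k] k v cv u S by auto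
    then show "fixes_pointwise n (cyc x \<inter> cyc y) u" using u by (simp add: fixes_pointwise_def)
  qed
qed

text \<open>The conductor is least for \<le>. It is least for divisibility too, because the
  intersection of the fields of levels c and x has level gcd(c, x), which cannot be smaller than c.
  The assumption on \<open>N\<close> makes sure that the \<open>LEAST\<close> is attained.\<close>

lemma conductor_dvd_iff:
  assumes c: "x > 0" and K: "field_of_values X \<chi> \<subseteq> cyc N" and N: "N > 0"
  shows "field_of_values X \<chi> \<subseteq> cyc x \<longleftrightarrow> conductor X \<chi> dvd x"
proof -
  let ?P = "\<lambda>n. n \<ge> 1 \<and> field_of_values X \<chi> \<subseteq> cyclo_field n"
  have "?P N" using K N cyclo_field_eq_cyc[OF N] by simp
  then have c1: "conductor X \<chi> > 0" "field_of_values X \<chi> \<subseteq> cyc (conductor X \<chi>)"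
    using LeastI[of ?P N] cyclo_field_eq_cyc[of "conductor X \<chi>"] unfolding conductor_def by auto
  have least: "conductor X \<chi> \<le> y" if "field_of_values X \<chi> \<subseteq> cyc y" "y > 0" for y
    unfolding conductor_def using that cyclo_field_eq_cyc[of y] by (intro Least_le) auto
  show ?thesis
  proof
    assume H: "field_of_values X \<chi> \<subseteq> cyc x"
    have "field_of_values X \<chi> \<subseteq> cyc (gcd (conductor X \<chi>) x)"
      using cyc_Int_subset[OF c1(1) c] c1(2) H by blast
    then have "conductor X \<chi> \<le> gcd (conductor X \<chi>) x" using c by (intro least) auto
    then have "gcd (conductor X \<chi>) x = conductor X \<chi>" using c1 by (simp add: gcd_le1_nat le_antisym)
    then show "conductor X \<chi> dvd x" by (metis gcd_dvd2)
  next
    assume "conductor X \<chi> dvd x"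
    then show "field_of_values X \<chi> \<subseteq> cyc x" using cyc_mono[OF _ c] c1(2) by blast
  qed
qed

section \<open>Degrees of extensions by roots of unity\<close>

lemma dimension_adjoin:
  assumes K: "csubfield K" and g: "g \<in> polys K" "g \<noteq> 0" "poly g x = 0"
    and min: "\<And>F. F \<in> polys K \<Longrightarrow> poly F x = 0 \<Longrightarrow> g dvd F"
  shows "ring.dimension C_ring (Polynomial.degree g) K {poly F x | F. F \<in> polys K}"
proof -
  interpret R: field C_ring by (rule field_C_ring)
  note K' = csubfield_csubring[OF K]
  \<comment> \<open>Span of the powers of x below i. Dimension is generated by line extensions, so
    the power basis is built one power at a time; x^i is new as long as i is below the degree of the
    minimal polynomial.\<close>
  define E where "E i = {poly F x | F. F \<in> polys K \<and> (\<forall>j\<ge>i. coeff F j = 0)}" for i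
  have ext: "R.line_extension K a A = {k * a + e | k e. k \<in> K \<and> e \<in> A}" for a A
    unfolding R.line_extension_def set_add_def' r_coset_def by (auto simp: C_ring_ops)
  have "R.dimension i K (E i)" if "i \<le> Polynomial.degree g" for i
    using that
  proof (induction i)
    case 0
    have "E 0 = {0}" unfolding E_def
      by (auto simp: poly_eq_iff[symmetric] poly_altdef polys_def csubring_zero[OF K'] intro!: exI[of _ 0])
    then show ?case using R.zero_dim[of K] by (simp add: C_ring_ops)
  next
    case (Suc i)
    have "x ^ i \<notin> E i"
    proof
      assume "x ^ i \<in> E i"
      then obtain F where F: "F \<in> polys K" "\<forall>j\<ge>i. coeff F j = 0" "x ^ i = poly F x" by (auto simp: E_def)
      define H where "H = Polynomial.monom 1 i - F"
      have "H \<in> polys K" unfolding H_def by (intro polys_diff K' polys_monom F csubring_one)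
      moreover have "poly H x = 0" using F(3) by (simp add: H_def poly_monom)
      ultimately have "g dvd H" by (rule min)
      moreover have "coeff H i = 1" using F(2) by (simp add: H_def)
      then have "H \<noteq> 0" by auto
      ultimately have "Polynomial.degree g \<le> Polynomial.degree H" by (simp add: dvd_imp_degree_le)
      also have "Polynomial.degree H \<le> i" using F(2) by (intro degree_le) (auto simp: H_def)
      finally show False using Suc.prems by simp
    qed
    then have "R.dimension (Suc i) K (R.line_extension K (x ^ i) (E i))"
      using Suc by (intro R.Suc_dim) (auto simp: C_ring_ops)
    also have "R.line_extension K (x ^ i) (E i) = E (Suc i)"
    proof (intro equalityI subsetI)
      fix y assume "y \<in> R.line_extension K (x ^ i) (E i)"
      then obtain k F where y: "k \<in> K" "F \<in> polys K" "\<forall>j\<ge>i. coeff F j = 0" "y = k * x ^ i + poly F x"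
        by (auto simp: ext E_def)
      have "Polynomial.monom k i + F \<in> polys K" by (intro polys_add K' polys_monom y)
      then show "y \<in> E (Suc i)" unfolding E_def
        using y by (intro CollectI exI[of _ "Polynomial.monom k i + F"]) (auto simp: poly_monom)
    next
      fix y assume "y \<in> E (Suc i)"
      then obtain F where y: "F \<in> polys K" "\<forall>j\<ge>Suc i. coeff F j = 0" "y = poly F x" by (auto simp: E_def)
      define k where "k = coeff F i"
      define H where "H = F - Polynomial.monom k i"
      have k: "k \<in> K" using y by (simp add: k_def polys_def)
      have "H \<in> polys K" unfolding H_def by (intro polys_diff K' polys_monom y k)
      moreover have "coeff H j = 0" if "j \<ge> i" for j
        using y(2) that by (cases "j = i") (auto simp: H_def k_def)
      moreover have "y = k * x ^ i + poly H x" by (simp add: H_def y poly_monom)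
      ultimately show "y \<in> R.line_extension K (x ^ i) (E i)" unfolding ext E_def using k by blast
    qed
    finally show ?case .
  qed
  moreover have "E (Polynomial.degree g) = {poly F x | F. F \<in> polys K}"
  proof (intro equalityI subsetI)
    fix y assume "y \<in> {poly F x | F. F \<in> polys K}"
    then obtain F where F: "F \<in> polys K" "y = poly F x" by blast
    have "poly F x = poly (F mod g) x" using g(3)
      by (metis (no_types) add.left_neutral div_mult_mod_eq mult_zero_right poly_add poly_mult)
    moreover have "coeff (F mod g) j = 0" if "j \<ge> Polynomial.degree g" for j
    proof (cases "F mod g = 0")
      case False
      then have "Polynomial.degree (F mod g) < j" using degree_mod_less[OF g(2), of F] that by linarith
      then show ?thesis by (rule coeff_eq_0)
    qed simp
    ultimately show "y \<in> E (Polynomial.degree g)" unfolding E_def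
      using F polys_div_mod[OF K g(1,2) F(1)] by blast
  qed (auto simp: E_def)
  ultimately show ?thesis by (metis order_refl)
qed

lemma gal_power: "n > 0 \<Longrightarrow> coprime u n \<Longrightarrow> x \<in> cyc n \<Longrightarrow> gal n u (x ^ k) = gal n u x ^ k"
  by (induction k) (auto simp: gal_Rats gal_mult csubring_power[OF csubfield_csubring[OF csubfield_cyc]])

lemma gal_poly_fixed:
  assumes n: "n > 0" and K: "K \<subseteq> cyc n" and u: "fixes_pointwise n K u" and F: "F \<in> polys K" and x: "x \<in> cyc n"
  shows "gal n u (poly F x) = poly F (gal n u x)"
proof -
  have c: "coprime u n" and fx: "\<And>k. k \<in> K \<Longrightarrow> gal n u k = k" using u by (auto simp: fixes_pointwise_def)
  note C = csubfield_csubring[OF csubfield_cyc[OF n]]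
  have FK: "coeff F i \<in> K" "coeff F i \<in> cyc n" for i using F K by (auto simp: polys_def)
  have "gal n u (poly F x) = (\<Sum>i\<le>Polynomial.degree F. gal n u (coeff F i * x ^ i))"
    unfolding poly_altdef using FK x by (intro gal_sum n c csubring_mult C csubring_power)
  also have "\<dots> = (\<Sum>i\<le>Polynomial.degree F. coeff F i * gal n u x ^ i)"
    using FK x by (intro sum.cong refl) (simp add: gal_mult n c gal_power fx csubring_power[OF C])
  finally show ?thesis by (simp add: poly_altdef)
qed

text \<open>Serves to show that a product over a set of conjugates, which the automorphisms permute,
  has coefficients in the fixed field.\<close>

lemma gal_coeff_prod_linear:
  assumes n: "n > 0" and u: "coprime u n" and A: "finite A" "A \<subseteq> cyc n"
  shows "coeff (\<Prod>z\<in>A. [:- z, 1:]) i \<in> cyc n \<and>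
    gal n u (coeff (\<Prod>z\<in>A. [:- z, 1:]) i) = coeff (\<Prod>z\<in>A. [:- gal n u z, 1:]) i"
  using A
proof (induction A arbitrary: i)
  case empty
  then show ?case using csubring_zero csubring_one csubfield_csubring[OF csubfield_cyc[OF n]] gal_Rats[OF n u]
    by (cases "i = 0") (auto simp: coeff_1)
next
  case (insert z A)
  note C = csubfield_csubring[OF csubfield_cyc[OF n]]
  define P where "P = (\<Prod>z\<in>A. [:- z, 1:])"
  define Q where "Q = (\<Prod>z\<in>A. [:- gal n u z, 1:])"
  have IH: "coeff P i \<in> cyc n" "gal n u (coeff P i) = coeff Q i" for i
    using insert.IH[of i] insert.prems by (auto simp: P_def Q_def)
  have co: "coeff ([:- w, 1:] * R) i = (case i of 0 \<Rightarrow> 0 | Suc j \<Rightarrow> coeff R j) - w * coeff R i" for w :: complex and R i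
    by (simp add: coeff_pCons algebra_simps split: nat.splits)
  have z: "z \<in> cyc n" using insert.prems by simp
  define a where "a = (case i of 0 \<Rightarrow> 0 | Suc j \<Rightarrow> coeff P j)"
  define b where "b = (case i of 0 \<Rightarrow> 0 | Suc j \<Rightarrow> coeff Q j)"
  have a: "a \<in> cyc n" "gal n u a = b"
    by (cases i; simp add: a_def b_def IH csubring_zero[OF C] gal_Rats[OF n u])+
  have zP: "z * coeff P i \<in> cyc n" by (intro csubring_mult[OF C] z IH)
  show ?case
    unfolding prod.insert[OF insert.hyps] P_def[symmetric] Q_def[symmetric] co a_def[symmetric] b_def[symmetric]
    using csubring_diff[OF C a(1) zP] gal_diff[OF n u a(1) zP] gal_mult[OF n u z IH(1)] a(2) IH(2) by simp
qed

text \<open>All conjugates of x are roots of \<open>g\<close>, which bounds their number by the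
  degree. Conversely, the product of the linear factors over the conjugates has coefficients in
  \<open>K\<close> by \<open>fixed_field\<close> and kills x, so \<open>g\<close> divides
  it.\<close>

theorem degree_minimal_poly:
  assumes n: "n > 0" and K: "csubfield K" "K \<subseteq> cyc n" and x: "x \<in> cyc n"
    and g: "g \<in> polys K" "g \<noteq> 0" "poly g x = 0"
    and min: "\<And>F. F \<in> polys K \<Longrightarrow> poly F x = 0 \<Longrightarrow> g dvd F"
  shows "Polynomial.degree g = card ((\<lambda>u. gal n u x) ` {u. fixes_pointwise n K u})"
proof -
  define S where "S = (\<lambda>u. gal n u x) ` {u. fixes_pointwise n K u}"
  have Sroots: "S \<subseteq> {y. poly g y = 0}"
    using gal_poly_fixed[OF n K(2) _ g(1) x] g(3) gal_Rats[OF n, of _ 0] by (auto simp: S_def fixes_pointwise_def)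
  have fin: "finite S" by (rule finite_subset[OF Sroots poly_roots_finite[OF g(2)]])
  have Scyc: "S \<subseteq> cyc n" using gal_in_cyc[OF n _ x] by (auto simp: S_def fixes_pointwise_def)
  have Sperm: "gal n u ` S = S" "inj_on (gal n u) S" if u: "fixes_pointwise n K u" for u
  proof -
    have cu: "coprime u n" using u by (simp add: fixes_pointwise_def)
    show inj: "inj_on (gal n u) S" using gal_eq_iff[OF n cu] Scyc by (auto simp: inj_on_def)
    have "fixes_pointwise n K (u * v)" if v: "fixes_pointwise n K v" for v
      using u v K(2) by (auto simp: fixes_pointwise_def subset_iff gal_gal[OF n, symmetric])
    then have "gal n u ` S \<subseteq> S"
      using gal_gal[OF n cu _ x] by (auto simp: S_def fixes_pointwise_def)
    then show "gal n u ` S = S" using fin inj by (intro endo_inj_surj)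
  qed
  define f where "f = (\<Prod>z\<in>S. [:- z, 1:])"
  have "f \<in> polys K"
    unfolding polys_def
  proof (intro CollectI allI)
    fix i show "coeff f i \<in> K"
    proof (rule fixed_field[OF n K])
      show "coeff f i \<in> cyc n" using gal_coeff_prod_linear[OF n _ fin Scyc, of 1 i] by (simp add: f_def)
      fix u assume u: "fixes_pointwise n K u"
      then have "gal n u (coeff f i) = coeff (\<Prod>z\<in>S. [:- gal n u z, 1:]) i"
        using gal_coeff_prod_linear[OF n _ fin Scyc, of u i] by (simp add: f_def fixes_pointwise_def)
      also have "(\<Prod>z\<in>S. [:- gal n u z, 1:]) = (\<Prod>z\<in>gal n u ` S. [:- z, 1:])"
        by (subst prod.reindex[OF Sperm(2)[OF u]]) (simp add: o_def)
      finally show "gal n u (coeff f i) = coeff f i" unfolding Sperm(1)[OF u] f_def .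
    qed
  qed
  moreover have "x \<in> S"
    using gal_one[OF n x] gal_one[OF n] K(2) unfolding S_def fixes_pointwise_def
    by (intro image_eqI[of _ _ 1]) auto
  then have "poly f x = 0" using fin by (auto simp: f_def poly_prod)
  ultimately have "g dvd f" by (rule min)
  moreover have "f \<noteq> 0" using fin by (simp add: f_def)
  ultimately have "Polynomial.degree g \<le> Polynomial.degree f" by (simp add: dvd_imp_degree_le)
  also have "Polynomial.degree f = card S" unfolding f_def by (subst degree_prod_eq_sum_degree) auto
  finally have "Polynomial.degree g \<le> card S" .
  moreover have "card S \<le> Polynomial.degree g"
    using card_mono[OF poly_roots_finite[OF g(2)] Sroots] card_poly_roots_bound[OF g(2)] by simp
  ultimately show ?thesis by (simp add: S_def)
qed

text \<open>The larger compositum is K[\<open>zeta q\<close>] for the smaller one K, so the degree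
  is the number of conjugates of \<open>zeta q\<close> over K. These are the powers with exponents u
  that fix \<open>S\<close> and are 1 modulo p, and such a power depends only on u modulo q.\<close>

theorem degree_dvd_compositum_iff:
  assumes n: "n > 0" and q: "q dvd n" "p dvd q" and S: "S \<subseteq> cyc n"
  shows "degree_dvd (compositum (cyclo_field q) (generate_field C_ring S))
      (compositum (cyclo_field p) (generate_field C_ring S)) m \<longleftrightarrow>
    card ((\<lambda>u. u mod q) ` {u. fixes_pointwise n S u \<and> [u = 1] (mod p)}) dvd m"
proof -
  interpret R: field C_ring by (rule field_C_ring)
  have q0: "q > 0" and p0: "p > 0" using q n by (auto intro!: Nat.gr0I)
  have pn: "p dvd n" using q dvd_trans by blast
  define V where "V = generate_field C_ring S"
  define K where "K = compositum (cyclo_field p) V"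
  define L where "L = compositum (cyclo_field q) V"
  let ?x = "zeta q"
  have K: "csubfield K" and L: "csubfield L" unfolding K_def L_def compositum_def by (rule csubfield_generate)+
  note K' = csubfield_csubring[OF K]
  have V: "V \<subseteq> cyc n" unfolding V_def by (rule generate_field_minimal[OF csubfield_cyc[OF n] S])
  have SV: "S \<subseteq> V" unfolding V_def by (rule generate_field_superset)
  have Kn: "K \<subseteq> cyc n" unfolding K_def compositum_def cyclo_field_eq_cyc[OF p0]
    using V cyc_mono[OF pn n] by (intro generate_field_minimal[OF csubfield_cyc[OF n]]) auto
  have KS: "cyc p \<subseteq> K" "V \<subseteq> K" unfolding K_def compositum_def cyclo_field_eq_cyc[OF p0]
    using generate_field_superset by blast+
  have LS: "cyc q \<subseteq> L" "V \<subseteq> L" unfolding L_def compositum_def cyclo_field_eq_cyc[OF q0]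
    using generate_field_superset by blast+
  have KL: "K \<subseteq> L" unfolding K_def compositum_def cyclo_field_eq_cyc[OF p0]
    using LS cyc_mono[OF q(2) q0] by (intro generate_field_minimal[OF L]) auto
  have xn: "?x \<in> cyc n" using zeta_power_in_cyc[of q 1] cyc_mono[OF q(1) n] by auto
  have "poly (Xn_minus_1 q) ?x = 0" using zeta_power_self[OF q0] by (simp add: poly_monom)
  note X = Xn_minus_1_polys[OF K'] Xn_minus_1_nonzero[OF q0] this
  obtain g where g: "g \<in> polys K" "g \<noteq> 0" "poly g ?x = 0"
    "\<And>F. F \<in> polys K \<Longrightarrow> poly F ?x = 0 \<Longrightarrow> g dvd F" using minimal_poly_exists[OF K X] by metis
  have Leq: "L = {poly F ?x | F. F \<in> polys K}"
  proof
    let ?M = "{poly F ?x | F. F \<in> polys K}"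
    have M: "csubfield ?M" by (rule csubfield_adjoin_algebraic[OF K X])
    have "K \<subseteq> ?M"
    proof
      fix k assume "k \<in> K"
      then show "k \<in> ?M" using polys_const[OF K'] by (auto intro!: exI[of _ "[:k:]"])
    qed
    moreover have "cyc q \<subseteq> ?M"
    proof -
      have "poly F ?x \<in> ?M" if "F \<in> polys \<rat>" for F
        using that polys_mono[OF csubfield_Rats_subset[OF K]] by blast
      then show ?thesis by (auto simp: cyc_def)
    qed
    ultimately show "L \<subseteq> ?M" unfolding L_def compositum_def cyclo_field_eq_cyc[OF q0]
      using KS by (intro generate_field_minimal[OF M]) auto
    have "?x \<in> L" using LS zeta_power_in_cyc[of q 1] by auto
    then show "?M \<subseteq> L" using polys_mono[OF KL] by (auto intro!: poly_in_csubring[OF csubfield_csubring[OF L]])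
  qed
  have dim: "R.dimension (Polynomial.degree g) K L" unfolding Leq by (rule dimension_adjoin[OF K g])
  have fix_iff: "fixes_pointwise n K u \<longleftrightarrow> fixes_pointwise n S u \<and> [u = 1] (mod p)" for u
  proof (cases "coprime u n")
    case True
    let ?F = "{x \<in> cyc n. gal n u x = x}"
    have F: "csubfield ?F" by (rule csubfield_fixed[OF n True])
    have "[u = 1] (mod p)" if "fixes_pointwise n K u"
    proof -
      have "gal n u (zeta p) = zeta p ^ u"
        using gal_cyc_dvd[OF n True pn, of "[:0,1:]"] polys_monom[OF csubfield_csubring[OF csubfield_Rats], of 1 1]
        by (simp add: monom_Suc monom_0)
      moreover have "zeta p \<in> K" using KS zeta_power_in_cyc[of p 1] by auto
      ultimately show ?thesis using that zeta_power_eq_iff[OF p0, of u 1] by (simp add: fixes_pointwise_def)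
    qed
    moreover have "K \<subseteq> ?F" if "fixes_pointwise n S u" "[u = 1] (mod p)"
    proof -
      have "cyc p \<subseteq> ?F"
      proof
        fix k assume k: "k \<in> cyc p"
        have "gal n u k = gal n 1 k" by (rule gal_cong[OF n pn k that(2) True]) simp
        then show "k \<in> ?F" using k cyc_mono[OF pn n] gal_one[OF n] by auto
      qed
      moreover have "V \<subseteq> ?F" unfolding V_def using that S
        by (intro generate_field_minimal[OF F]) (auto simp: fixes_pointwise_def)
      ultimately show ?thesis unfolding K_def compositum_def cyclo_field_eq_cyc[OF p0]
        by (intro generate_field_minimal[OF F]) auto
    qed
    ultimately show ?thesis using SV KS True by (auto simp: fixes_pointwise_def)
  qed (simp add: fixes_pointwise_def)
  let ?U = "{u. fixes_pointwise n S u \<and> [u = 1] (mod p)}"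
  have "Polynomial.degree g = card ((\<lambda>u. gal n u ?x) ` {u. fixes_pointwise n K u})"
    by (rule degree_minimal_poly[OF n K Kn xn g])
  also have "(\<lambda>u. gal n u ?x) ` {u. fixes_pointwise n K u} = (\<lambda>u. ?x ^ u) ` ?U"
    unfolding fix_iff using gal_cyc_dvd[OF n _ q(1), of _ "Polynomial.monom 1 1"] polys_monom[OF csubfield_csubring[OF csubfield_Rats], of 1 1]
    by (intro image_cong refl) (auto simp: fixes_pointwise_def poly_monom)
  also have "\<dots> = (\<lambda>r. ?x ^ r) ` (\<lambda>u. u mod q) ` ?U"
    by (simp add: image_image power_mod_of_root[OF zeta_power_self[OF q0]])
  also have "card \<dots> = card ((\<lambda>u. u mod q) ` ?U)"
    by (rule card_image) (auto simp: inj_on_def zeta_power_eq_iff[OF q0] cong_def)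
  finally have deg: "Polynomial.degree g = card ((\<lambda>u. u mod q) ` ?U)" .
  have "degree_dvd L K m \<longleftrightarrow> Polynomial.degree g dvd m"
    unfolding degree_dvd_def using dim R.dimension_is_inj[OF subfield_C_ring[OF K] dim] by blast
  then show ?thesis unfolding deg K_def L_def V_def .
qed

section \<open>Invariant subspaces and block triangular form\<close>

definition injective_mat :: "complex mat \<Rightarrow> bool" where
  "injective_mat B \<longleftrightarrow> (\<forall>v\<in>carrier_vec (dim_col B). B *\<^sub>v v = 0\<^sub>v (dim_row B) \<longrightarrow> v = 0\<^sub>v (dim_col B))"

lemma mult_mat_vec_index:
  assumes "A \<in> carrier_mat n m" "v \<in> carrier_vec m" "i < n"
  shows "(A *\<^sub>v v) $ i = (\<Sum>k<m. A $$ (i, k) * v $ k)"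
proof -
  have dims: "dim_row A = n" "dim_col A = m" "dim_vec v = m" using assms by auto
  have "(A *\<^sub>v v) $ i = (\<Sum>k\<in>{0..<m}. row A i $ k * v $ k)"
    using dims assms(3) by (simp add: scalar_prod_def)
  also have "\<dots> = (\<Sum>k\<in>{0..<m}. A $$ (i, k) * v $ k)"
    by (rule sum.cong) (use dims assms(3) in auto)
  finally show ?thesis by (simp add: atLeast0LessThan)
qed

lemma mult_mat_index:
  assumes "A \<in> carrier_mat n m" "B \<in> carrier_mat m k" "i < n" "j < k"
  shows "(A * B) $$ (i, j) = (\<Sum>l<m. A $$ (i, l) * B $$ (l, j))"
proof -
  have dims: "dim_row A = n" "dim_col A = m" "dim_row B = m" "dim_col B = k" using assms by auto
  have "(A * B) $$ (i, j) = (\<Sum>l\<in>{0..<m}. row A i $ l * col B j $ l)"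
    using dims assms(3,4) by (simp add: scalar_prod_def)
  also have "\<dots> = (\<Sum>l\<in>{0..<m}. A $$ (i, l) * B $$ (l, j))"
    by (rule sum.cong) (use dims assms(3,4) in auto)
  finally show ?thesis by (simp add: atLeast0LessThan)
qed

lemma mult_mat_vec_0:
  assumes "A \<in> carrier_mat n m" shows "A *\<^sub>v 0\<^sub>v m = (0\<^sub>v n :: complex vec)"
proof (rule eq_vecI)
  fix i assume "i < dim_vec (0\<^sub>v n :: complex vec)"
  then show "(A *\<^sub>v 0\<^sub>v m) $ i = 0\<^sub>v n $ i" using assms by (simp add: mult_mat_vec_index[OF assms] del: index_mult_mat_vec)
qed (use assms in simp)

text \<open>With more columns than rows, zero rows pad \<open>B\<close> to a square matrix whose
  last row is zero. It is singular, and a vector in its kernel is killed by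
  \<open>B\<close>.\<close>

lemma injective_mat_dim:
  assumes B: "B \<in> carrier_mat n l" and inj: "injective_mat B" shows "l \<le> n"
proof (rule ccontr)
  assume ln: "\<not> l \<le> n"
  define P where "P = mat l l (\<lambda>(i, j). if i < n then B $$ (i, j) else 0)"
  have P: "P \<in> carrier_mat l l" by (simp add: P_def)
  have "transpose_mat P *\<^sub>v unit_vec l (l - 1) = 0\<^sub>v l"
  proof (rule eq_vecI)
    fix i assume "i < dim_vec (0\<^sub>v l :: complex vec)"
    then have i: "i < l" by simp
    have "(transpose_mat P *\<^sub>v unit_vec l (l - 1)) $ i = (\<Sum>k<l. transpose_mat P $$ (i, k) * unit_vec l (l - 1) $ k)"
      using P i by (intro mult_mat_vec_index) auto
    also have "\<dots> = 0" using ln i by (intro sum.neutral) (auto simp: P_def unit_vec_def)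
    finally show "(transpose_mat P *\<^sub>v unit_vec l (l - 1)) $ i = 0\<^sub>v l $ i" using i by simp
  qed (use P in auto)
  moreover have "unit_vec l (l - 1) \<noteq> (0\<^sub>v l :: complex vec)" using ln by (intro unit_vec_nonzero) auto
  ultimately have "det (transpose_mat P) = 0"
    using P by (subst det_0_iff_vec_prod_zero_field[of _ l]) (auto intro!: exI[of _ "unit_vec l (l - 1)"])
  then have "det P = 0" using det_transpose[OF P] by simp
  then obtain v where v: "v \<in> carrier_vec l" "v \<noteq> 0\<^sub>v l" "P *\<^sub>v v = 0\<^sub>v l"
    using det_0_iff_vec_prod_zero_field[OF P] by blast
  have "(B *\<^sub>v v) $ i = 0" if "i < n" for i
  proof -
    have "(B *\<^sub>v v) $ i = (P *\<^sub>v v) $ i"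
      using that ln by (simp add: mult_mat_vec_index[OF B v(1)] mult_mat_vec_index[OF P v(1)]) (simp add: P_def)
    then show ?thesis using v(3) that ln by simp
  qed
  then have "B *\<^sub>v v = 0\<^sub>v n" using B by (intro eq_vecI) auto
  then show False using inj v B by (auto simp: injective_mat_def)
qed

lemma injective_mat_extend:
  assumes B: "B \<in> carrier_mat n l" "injective_mat B" and w: "w \<in> carrier_vec n"
    and nw: "\<And>v. v \<in> carrier_vec l \<Longrightarrow> w \<noteq> B *\<^sub>v v"
  obtains B' where "B' \<in> carrier_mat n (Suc l)" "injective_mat B'"
    "\<And>i j. i < n \<Longrightarrow> j < l \<Longrightarrow> B' $$ (i, j) = B $$ (i, j)"
    "\<And>v. v \<in> carrier_vec (Suc l) \<Longrightarrow> B' *\<^sub>v v = B *\<^sub>v vec l (\<lambda>i. v $ i) + v $ l \<cdot>\<^sub>v w"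
proof -
  define B' where "B' = mat n (Suc l) (\<lambda>(i, j). if j < l then B $$ (i, j) else w $ i)"
  have B': "B' \<in> carrier_mat n (Suc l)" by (simp add: B'_def)
  have eq: "B' *\<^sub>v v = B *\<^sub>v vec l (\<lambda>i. v $ i) + v $ l \<cdot>\<^sub>v w" if v: "v \<in> carrier_vec (Suc l)" for v
  proof (rule eq_vecI)
    fix i assume "i < dim_vec (B *\<^sub>v vec l (\<lambda>i. v $ i) + v $ l \<cdot>\<^sub>v w)"
    then have i: "i < n" using B w by simp
    show "(B' *\<^sub>v v) $ i = (B *\<^sub>v vec l (\<lambda>i. v $ i) + v $ l \<cdot>\<^sub>v w) $ i"
      using i w B(1) by (simp add: mult_mat_vec_index[OF B' v] mult_mat_vec_index[OF B(1), of "vec l _"] del: index_mult_mat_vec) (simp add: B'_def)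
  qed (use B B' w in auto)
  have "v = 0\<^sub>v (Suc l)" if v: "v \<in> carrier_vec (Suc l)" "B' *\<^sub>v v = 0\<^sub>v n" for v
  proof -
    let ?v = "vec l (\<lambda>i. v $ i)"
    have 0: "B *\<^sub>v ?v + v $ l \<cdot>\<^sub>v w = 0\<^sub>v n" using eq[OF v(1)] v(2) by simp
    have idx: "(B *\<^sub>v ?v) $ i = - (v $ l * w $ i)" if "i < n" for i
      using arg_cong[OF 0, of "\<lambda>x. x $ i"] that B w by (simp add: eq_neg_iff_add_eq_0)
    have "v $ l = 0"
    proof (rule ccontr)
      assume c: "v $ l \<noteq> 0"
      have "w = B *\<^sub>v (- inverse (v $ l) \<cdot>\<^sub>v ?v)"
        using idx c B w by (intro eq_vecI) (auto simp: mult_mat_vec[OF B(1), of ?v] simp del: index_mult_mat_vec)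
      then show False using nw by simp
    qed
    then have "B *\<^sub>v ?v = 0\<^sub>v n" using idx B by (intro eq_vecI) (auto simp del: index_mult_mat_vec)
    then have "?v = 0\<^sub>v l" using B by (auto simp: injective_mat_def)
    then have "v $ i = 0" if "i < l" for i using that by (metis index_vec index_zero_vec(1))
    then show ?thesis using v \<open>v $ l = 0\<close> by (intro eq_vecI) (auto simp: less_Suc_eq)
  qed
  then have "injective_mat B'" using B' by (auto simp: injective_mat_def)
  then show ?thesis using that[OF B' _ _ eq] by (simp add: B'_def)
qed

lemma ex_maximal_nat:
  fixes P :: "nat \<Rightarrow> bool"
  assumes "P k" "\<And>i. P i \<Longrightarrow> i \<le> b"
  obtains l where "P l" "\<And>i. P i \<Longrightarrow> i \<le> l"
proof (rule that)
  show "P (Greatest P)" using assms by (rule GreatestI_nat)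
  show "i \<le> Greatest P" if "P i" for i using that assms(2) by (rule Greatest_le_nat)
qed

lemma subspace_range_closed:
  assumes W: "is_subspace n W" and B: "B \<in> carrier_mat n l" and cols: "\<And>v. v \<in> carrier_vec l \<Longrightarrow> B *\<^sub>v v \<in> W"
    and w: "w \<in> W" "v \<in> carrier_vec l"
  shows "B *\<^sub>v v + c \<cdot>\<^sub>v w \<in> W"
proof -
  have "c \<cdot>\<^sub>v w \<in> W" using W w(1) by (simp add: is_subspace_def)
  with cols[OF w(2)] W show ?thesis unfolding is_subspace_def by blast
qed

text \<open>Take an injective matrix with range in \<open>W\<close> and as many columns as possible;
  a vector of \<open>W\<close> outside its range could be appended as a further column.\<close>

lemma subspace_basis:
  assumes W: "is_subspace n W"
  obtains l B where "B \<in> carrier_mat n l" "injective_mat B" "W = {B *\<^sub>v v | v. v \<in> carrier_vec l}"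
proof -
  define P where "P l \<longleftrightarrow> (\<exists>B. B \<in> carrier_mat n l \<and> injective_mat B \<and> (\<forall>v\<in>carrier_vec l. B *\<^sub>v v \<in> W))" for l
  have "P 0"
    unfolding P_def
  proof (intro exI[of _ "0\<^sub>m n 0"] conjI ballI)
    fix v :: "complex vec" assume "v \<in> carrier_vec 0"
    then have "0\<^sub>m n 0 *\<^sub>v v = 0\<^sub>v n" by (intro eq_vecI) (auto simp: scalar_prod_def)
    then show "0\<^sub>m n 0 *\<^sub>v v \<in> W" using W by (simp add: is_subspace_def)
  qed (auto simp: injective_mat_def)
  then obtain l where l: "P l" "\<And>i. P i \<Longrightarrow> i \<le> l"
    by (rule ex_maximal_nat[of P _ n]) (auto simp: P_def intro: injective_mat_dim)
  then obtain B where B: "B \<in> carrier_mat n l" "injective_mat B" "\<forall>v\<in>carrier_vec l. B *\<^sub>v v \<in> W"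
    by (auto simp: P_def)
  have "w \<in> {B *\<^sub>v v | v. v \<in> carrier_vec l}" if w: "w \<in> W" for w
  proof (rule ccontr)
    assume nw: "w \<notin> {B *\<^sub>v v | v. v \<in> carrier_vec l}"
    have wc: "w \<in> carrier_vec n" using w W by (auto simp: is_subspace_def)
    have nw': "w \<noteq> B *\<^sub>v v" if "v \<in> carrier_vec l" for v using nw that by blast
    obtain B' where B': "B' \<in> carrier_mat n (Suc l)" "injective_mat B'"
      "\<And>i j. i < n \<Longrightarrow> j < l \<Longrightarrow> B' $$ (i, j) = B $$ (i, j)"
      "\<And>v. v \<in> carrier_vec (Suc l) \<Longrightarrow> B' *\<^sub>v v = B *\<^sub>v vec l (\<lambda>i. v $ i) + v $ l \<cdot>\<^sub>v w"
      using injective_mat_extend[OF B(1,2) wc nw'] by metis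
    have "B' *\<^sub>v v \<in> W" if v: "v \<in> carrier_vec (Suc l)" for v
      unfolding B'(4)[OF v] by (rule subspace_range_closed[OF W B(1)]) (use B(3) w in auto)
    then have "P (Suc l)" unfolding P_def using B'(1,2) by blast
    then show False using l(2) by fastforce
  qed
  then have "W = {B *\<^sub>v v | v. v \<in> carrier_vec l}" using B by blast
  then show ?thesis using that B by blast
qed

lemma mat_right_inverse:
  assumes C: "(C :: complex mat) \<in> carrier_mat n m" and surj: "\<And>w. w \<in> carrier_vec n \<Longrightarrow> \<exists>v\<in>carrier_vec m. w = C *\<^sub>v v"
  obtains D where "D \<in> carrier_mat m n" "C * D = 1\<^sub>m n"
proof -
  have "\<forall>j. \<exists>v. j < n \<longrightarrow> v \<in> carrier_vec m \<and> unit_vec n j = C *\<^sub>v v" using surj by force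
  then obtain f where f: "\<And>j. j < n \<Longrightarrow> f j \<in> carrier_vec m \<and> unit_vec n j = C *\<^sub>v f j" by metis
  define D where "D = mat m n (\<lambda>(i, j). f j $ i)"
  have D: "D \<in> carrier_mat m n" by (simp add: D_def)
  have "C * D = 1\<^sub>m n"
  proof (rule eq_matI)
    fix i j assume "i < dim_row (1\<^sub>m n :: complex mat)" "j < dim_col (1\<^sub>m n :: complex mat)"
    then have ij: "i < n" "j < n" by auto
    have "(C * D) $$ (i, j) = (C *\<^sub>v f j) $ i"
      using ij f[OF ij(2)] by (simp add: mult_mat_index[OF C D] mult_mat_vec_index[OF C] del: index_mult_mat index_mult_mat_vec) (simp add: D_def)
    also have "\<dots> = unit_vec n j $ i" using f[OF ij(2)] by metis
    finally show "(C * D) $$ (i, j) = 1\<^sub>m n $$ (i, j)" using ij by (simp add: unit_vec_def)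
  qed (use C D in auto)
  then show ?thesis using that D by blast
qed

lemma injective_mat_left_inverse:
  assumes C: "C \<in> carrier_mat n m" "injective_mat C" and D: "D \<in> carrier_mat m n" "C * D = 1\<^sub>m n"
  shows "D * C = 1\<^sub>m m"
proof (rule eq_matI)
  fix i j assume "i < dim_row (1\<^sub>m m :: complex mat)" "j < dim_col (1\<^sub>m m :: complex mat)"
  then have ij: "i < m" "j < m" by auto
  let ?v = "(D * C) *\<^sub>v unit_vec m j - unit_vec m j"
  have c: "(D * C) *\<^sub>v unit_vec m j \<in> carrier_vec m" using C D by auto
  define y where "y = C *\<^sub>v unit_vec m j"
  have y: "y \<in> carrier_vec n" using C by (simp add: y_def)
  have "(D * C) *\<^sub>v unit_vec m j = D *\<^sub>v y" unfolding y_def using C D by (intro assoc_mult_mat_vec) auto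
  moreover have "C *\<^sub>v (D *\<^sub>v y) = (C * D) *\<^sub>v y" using C D y by (intro assoc_mult_mat_vec[symmetric]) auto
  ultimately have "C *\<^sub>v ((D * C) *\<^sub>v unit_vec m j) = C *\<^sub>v unit_vec m j" using y by (simp add: D(2) y_def)
  then have "C *\<^sub>v ?v = 0\<^sub>v n"
    using mult_minus_distrib_mat_vec[OF C(1) c, of "unit_vec m j"] C by simp
  then have "?v = 0\<^sub>v m" using C c by (auto simp: injective_mat_def)
  then have "((D * C) *\<^sub>v unit_vec m j) $ i = unit_vec m j $ i"
  proof -
    have "?v $ i = 0\<^sub>v m $ i" using \<open>?v = 0\<^sub>v m\<close> by (rule arg_cong)
    then show ?thesis using ij c by (simp del: index_mult_mat_vec)
  qed
  moreover have "((D * C) *\<^sub>v unit_vec m j) $ i = (D * C) $$ (i, j)"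
  proof -
    have "((D * C) *\<^sub>v unit_vec m j) $ i = (\<Sum>k<m. (D * C) $$ (i, k) * unit_vec m j $ k)"
      using ij C D by (intro mult_mat_vec_index[of _ m]) auto
    also have "\<dots> = (\<Sum>k<m. if k = j then (D * C) $$ (i, k) else 0)"
      using ij by (intro sum.cong) (auto simp: unit_vec_def)
    finally show ?thesis using ij by simp
  qed
  ultimately show "(D * C) $$ (i, j) = 1\<^sub>m m $$ (i, j)" using ij by (simp add: unit_vec_def)
qed (use C D in auto)

text \<open>A basis of \<open>W\<close> is extended to the whole space. Describing \<open>W\<close>
  by the vanishing of the coordinates from l on is what later produces the zero block of an
  invariant subspace.\<close>

lemma subspace_adapted_basis:
  assumes W: "is_subspace n W"
  obtains l C D where "C \<in> carrier_mat n n" "D \<in> carrier_mat n n" "C * D = 1\<^sub>m n" "D * C = 1\<^sub>m n" "l \<le> n"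
    "W = {C *\<^sub>v v | v. v \<in> carrier_vec n \<and> (\<forall>i<n. l \<le> i \<longrightarrow> v $ i = 0)}"
proof -
  obtain l B where B: "B \<in> carrier_mat n l" "injective_mat B" "W = {B *\<^sub>v v | v. v \<in> carrier_vec l}"
    by (rule subspace_basis[OF W])
  define P where "P m \<longleftrightarrow> l \<le> m \<and> (\<exists>C. C \<in> carrier_mat n m \<and> injective_mat C \<and> (\<forall>i<n. \<forall>j<l. C $$ (i, j) = B $$ (i, j)))" for m
  have "P l" using B by (auto simp: P_def)
  then obtain m where m: "P m" "\<And>i. P i \<Longrightarrow> i \<le> m"
    by (rule ex_maximal_nat[of P _ n]) (auto simp: P_def intro: injective_mat_dim)
  then obtain C where C: "l \<le> m" "C \<in> carrier_mat n m" "injective_mat C" "\<And>i j. i < n \<Longrightarrow> j < l \<Longrightarrow> C $$ (i, j) = B $$ (i, j)"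
    by (auto simp: P_def)
  have surj: "\<exists>v\<in>carrier_vec m. w = C *\<^sub>v v" if w: "w \<in> carrier_vec n" for w
  proof (rule ccontr)
    assume "\<not> ?thesis"
    then have nw': "w \<noteq> C *\<^sub>v v" if "v \<in> carrier_vec m" for v using that by blast
    obtain C' where C': "C' \<in> carrier_mat n (Suc m)" "injective_mat C'"
      "\<And>i j. i < n \<Longrightarrow> j < m \<Longrightarrow> C' $$ (i, j) = C $$ (i, j)"
      "\<And>v. v \<in> carrier_vec (Suc m) \<Longrightarrow> C' *\<^sub>v v = C *\<^sub>v vec m (\<lambda>i. v $ i) + v $ m \<cdot>\<^sub>v w"
      using injective_mat_extend[OF C(2,3) w nw'] by metis
    have "P (Suc m)" unfolding P_def using C C' by (auto intro!: exI[of _ C'])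
    then show False using m(2) by fastforce
  qed
  obtain D where D: "D \<in> carrier_mat m n" "C * D = 1\<^sub>m n" by (rule mat_right_inverse[OF C(2) surj])
  have DC: "D * C = 1\<^sub>m m" by (rule injective_mat_left_inverse[OF C(2,3) D])
  have "injective_mat D"
    unfolding injective_mat_def
  proof (intro ballI impI)
    fix v assume v: "v \<in> carrier_vec (dim_col D)" "D *\<^sub>v v = 0\<^sub>v (dim_row D)"
    then have "v = (C * D) *\<^sub>v v" using D by simp
    also have "\<dots> = C *\<^sub>v (D *\<^sub>v v)" using C D v by (intro assoc_mult_mat_vec) auto
    also have "\<dots> = 0\<^sub>v n" using v D mult_mat_vec_0[OF C(2)] by simp
    finally show "v = 0\<^sub>v (dim_col D)" using D by simp
  qed
  \<comment> \<open>\<open>C\<close> and its inverse \<open>D\<close> are both injective, so the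
    dimension bound applies in both directions.\<close>
  then have mn: "m = n" using injective_mat_dim[OF D(1)] injective_mat_dim[OF C(2,3)] by simp
  have key: "C *\<^sub>v v = B *\<^sub>v vec l (\<lambda>i. v $ i)" if v: "v \<in> carrier_vec n" "\<forall>i<n. l \<le> i \<longrightarrow> v $ i = 0" for v
  proof (rule eq_vecI)
    fix i assume "i < dim_vec (B *\<^sub>v vec l (\<lambda>i. v $ i))"
    then have i: "i < n" using B by simp
    have "(C *\<^sub>v v) $ i = (\<Sum>k<n. C $$ (i, k) * v $ k)" using C v i mn by (intro mult_mat_vec_index) auto
    also have "\<dots> = (\<Sum>k<l. C $$ (i, k) * v $ k)" using v C(1) mn by (intro sum.mono_neutral_right) auto
    also have "\<dots> = (\<Sum>k<l. B $$ (i, k) * vec l (\<lambda>i. v $ i) $ k)" using C(4) i by (intro sum.cong) auto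
    also have "\<dots> = (B *\<^sub>v vec l (\<lambda>i. v $ i)) $ i" using i by (intro mult_mat_vec_index[OF B(1), symmetric]) auto
    finally show "(C *\<^sub>v v) $ i = (B *\<^sub>v vec l (\<lambda>i. v $ i)) $ i" .
  qed (use C B in auto)
  have "W = {C *\<^sub>v v | v. v \<in> carrier_vec n \<and> (\<forall>i<n. l \<le> i \<longrightarrow> v $ i = 0)}"
  proof (intro equalityI subsetI)
    fix w assume "w \<in> W"
    then obtain v where v: "v \<in> carrier_vec l" "w = B *\<^sub>v v" using B by blast
    let ?v = "vec n (\<lambda>i. if i < l then v $ i else 0)"
    have "vec l (\<lambda>i. ?v $ i) = v" using v C(1) mn by (intro eq_vecI) auto
    then show "w \<in> {C *\<^sub>v v | v. v \<in> carrier_vec n \<and> (\<forall>i<n. l \<le> i \<longrightarrow> v $ i = 0)}"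
      using v key[of ?v] by (intro CollectI exI[of _ ?v]) auto
  next
    fix w assume "w \<in> {C *\<^sub>v v | v. v \<in> carrier_vec n \<and> (\<forall>i<n. l \<le> i \<longrightarrow> v $ i = 0)}"
    then show "w \<in> W" using key B(3) by auto
  qed
  then show ?thesis using that C D DC mn by simp
qed

section \<open>Schur's lemma and orthogonality\<close>

lemma mat_trace_comm:
  assumes "A \<in> carrier_mat n m" "B \<in> carrier_mat m n"
  shows "mat_trace (A * B) = mat_trace (B * A)"
proof -
  have "mat_trace (A * B) = (\<Sum>i<n. \<Sum>k<m. A $$ (i, k) * B $$ (k, i))"
    using assms by (simp add: mat_trace_def mult_mat_index[OF assms] del: index_mult_mat(1))
  also have "\<dots> = (\<Sum>k<m. \<Sum>i<n. B $$ (k, i) * A $$ (i, k))"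
    by (subst sum.swap) (simp add: mult.commute)
  also have "\<dots> = mat_trace (B * A)"
    using assms by (simp add: mat_trace_def mult_mat_index[OF assms(2,1)] del: index_mult_mat(1))
  finally show ?thesis .
qed

lemma mat_trace_index: "A \<in> carrier_mat n n \<Longrightarrow> mat_trace A = (\<Sum>i<n. A $$ (i, i))"
  by (simp add: mat_trace_def)

lemma schur_bijective:
  assumes \<rho>: "is_irr_rep X n \<rho>" and \<sigma>: "is_irr_rep X m \<sigma>" and T: "T \<in> carrier_mat n m" "T \<noteq> 0\<^sub>m n m"
    and comm: "\<And>g. g \<in> carrier X \<Longrightarrow> \<rho> g * T = T * \<sigma> g"
  shows "injective_mat T" "\<And>w. w \<in> carrier_vec n \<Longrightarrow> \<exists>v\<in>carrier_vec m. w = T *\<^sub>v v"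
proof -
  have \<rho>c: "\<rho> g \<in> carrier_mat n n" and \<sigma>c: "\<sigma> g \<in> carrier_mat m m" if "g \<in> carrier X" for g
    using \<rho> \<sigma> that by (auto simp: is_irr_rep_def is_rep_def)
  have act: "T *\<^sub>v (\<sigma> g *\<^sub>v v) = \<rho> g *\<^sub>v (T *\<^sub>v v)" if "g \<in> carrier X" "v \<in> carrier_vec m" for g v
    using assoc_mult_mat_vec[OF T(1) \<sigma>c that(2)] assoc_mult_mat_vec[OF \<rho>c T(1) that(2)] comm that(1) by metis
  obtain i j where ij: "i < n" "j < m" "T $$ (i, j) \<noteq> 0"
  proof (rule ccontr)
    assume "\<not> thesis"
    then have "T = 0\<^sub>m n m" using that T(1) by (intro eq_matI) auto
    then show False using T(2) by simp
  qed
  have Tj: "(T *\<^sub>v unit_vec m j) $ i \<noteq> 0"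
  proof -
    have "(T *\<^sub>v unit_vec m j) $ i = (\<Sum>k<m. T $$ (i, k) * unit_vec m j $ k)"
      by (rule mult_mat_vec_index[OF T(1) _ ij(1)]) simp
    also have "\<dots> = (\<Sum>k<m. if k = j then T $$ (i, k) else 0)"
      using ij by (intro sum.cong) (auto simp: unit_vec_def)
    finally show ?thesis using ij by simp
  qed
  define W where "W = {v \<in> carrier_vec m. T *\<^sub>v v = 0\<^sub>v n}"
  have W: "is_subspace m W"
    unfolding is_subspace_def W_def using T
    by (auto simp: mult_add_distrib_mat_vec[OF T(1)] mult_mat_vec[OF T(1)] mult_mat_vec_0[OF T(1)])
  have "\<forall>g\<in>carrier X. \<forall>w\<in>W. \<sigma> g *\<^sub>v w \<in> W"
  proof (intro ballI)
    fix g w assume gw: "g \<in> carrier X" "w \<in> W"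
    then have w: "w \<in> carrier_vec m" "T *\<^sub>v w = 0\<^sub>v n" by (auto simp: W_def)
    have "T *\<^sub>v (\<sigma> g *\<^sub>v w) = 0\<^sub>v n" using act[OF gw(1) w(1)] w(2) mult_mat_vec_0[OF \<rho>c[OF gw(1)]] by simp
    then show "\<sigma> g *\<^sub>v w \<in> W" using \<sigma>c[OF gw(1)] w by (auto simp: W_def)
  qed
  moreover have "unit_vec m j \<notin> W" using Tj ij by (auto simp: W_def)
  then have "W \<noteq> carrier_vec m" by auto
  ultimately have "W = {0\<^sub>v m}" using \<sigma> W unfolding is_irr_rep_def by blast
  then have "\<And>v. v \<in> carrier_vec m \<Longrightarrow> T *\<^sub>v v = 0\<^sub>v n \<Longrightarrow> v = 0\<^sub>v m" by (auto simp: W_def)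
  then show "injective_mat T" using T(1) by (auto simp: injective_mat_def)
  define V where "V = {T *\<^sub>v v | v. v \<in> carrier_vec m}"
  have V: "is_subspace n V"
    unfolding is_subspace_def
  proof (intro conjI ballI allI)
    show "V \<subseteq> carrier_vec n" using T by (auto simp: V_def)
    show "0\<^sub>v n \<in> V" unfolding V_def using mult_mat_vec_0[OF T(1)] by (metis (mono_tags, lifting) mem_Collect_eq zero_carrier_vec)
    fix x y c assume "x \<in> V"
    then obtain v where v: "v \<in> carrier_vec m" "x = T *\<^sub>v v" by (auto simp: V_def)
    then have "c \<cdot>\<^sub>v x = T *\<^sub>v (c \<cdot>\<^sub>v v)" using mult_mat_vec[OF T(1)] by simp
    then show "c \<cdot>\<^sub>v x \<in> V" unfolding V_def using v by (metis (mono_tags, lifting) mem_Collect_eq smult_carrier_vec)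
    assume "y \<in> V"
    then obtain w where w: "w \<in> carrier_vec m" "y = T *\<^sub>v w" by (auto simp: V_def)
    have "x + y = T *\<^sub>v (v + w)" using v w mult_add_distrib_mat_vec[OF T(1)] by simp
    then show "x + y \<in> V" unfolding V_def using v w by (metis (mono_tags, lifting) mem_Collect_eq add_carrier_vec)
  qed
  have "\<forall>g\<in>carrier X. \<forall>w\<in>V. \<rho> g *\<^sub>v w \<in> V"
  proof (intro ballI)
    fix g w assume g: "g \<in> carrier X" and "w \<in> V"
    then obtain v where v: "v \<in> carrier_vec m" "w = T *\<^sub>v v" by (auto simp: V_def)
    then have "\<rho> g *\<^sub>v w = T *\<^sub>v (\<sigma> g *\<^sub>v v)" using act[OF g v(1)] by simp
    moreover have "\<sigma> g *\<^sub>v v \<in> carrier_vec m" using \<sigma>c[OF g] v by auto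
    ultimately show "\<rho> g *\<^sub>v w \<in> V" unfolding V_def by blast
  qed
  moreover have "T *\<^sub>v unit_vec m j \<noteq> 0\<^sub>v n" using Tj ij by auto
  then have "V \<noteq> {0\<^sub>v n}" unfolding V_def by (metis (mono_tags, lifting) mem_Collect_eq singletonD unit_vec_carrier)
  ultimately have "V = carrier_vec n" using \<rho> V unfolding is_irr_rep_def by blast
  then show "\<exists>v\<in>carrier_vec m. w = T *\<^sub>v v" if "w \<in> carrier_vec n" for w
    using that by (auto simp: V_def)
qed

text \<open>Used in contrapositive form: characters that differ at one element leave only the zero
  intertwiner.\<close>

lemma schur_trace_eq:
  assumes \<rho>: "is_irr_rep X n \<rho>" and \<sigma>: "is_irr_rep X m \<sigma>" and T: "T \<in> carrier_mat n m" "T \<noteq> 0\<^sub>m n m"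
    and comm: "\<And>g. g \<in> carrier X \<Longrightarrow> \<rho> g * T = T * \<sigma> g" and g: "g \<in> carrier X"
  shows "mat_trace (\<rho> g) = mat_trace (\<sigma> g)"
proof -
  note bij = schur_bijective[OF \<rho> \<sigma> T comm]
  obtain S where S: "S \<in> carrier_mat m n" "T * S = 1\<^sub>m n" by (rule mat_right_inverse[OF T(1) bij(2)])
  have ST: "S * T = 1\<^sub>m m" by (rule injective_mat_left_inverse[OF T(1) bij(1) S])
  have \<rho>c: "\<rho> g \<in> carrier_mat n n" and \<sigma>c: "\<sigma> g \<in> carrier_mat m m"
    using \<rho> \<sigma> g by (auto simp: is_irr_rep_def is_rep_def)
  have "\<rho> g = \<rho> g * (T * S)" using \<rho>c S(2) by simp
  also have "\<dots> = T * \<sigma> g * S" using assoc_mult_mat[OF \<rho>c T(1) S(1)] comm[OF g] by simp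
  finally have "mat_trace (\<rho> g) = mat_trace (T * \<sigma> g * S)" by simp
  also have "\<dots> = mat_trace (S * (T * \<sigma> g))" using T S \<sigma>c by (intro mat_trace_comm[of _ n m]) auto
  also have "S * (T * \<sigma> g) = S * T * \<sigma> g" using assoc_mult_mat[OF S(1) T(1) \<sigma>c] by simp
  finally show ?thesis using ST \<sigma>c by simp
qed

text \<open>Subtracting an eigenvalue of \<open>T\<close> leaves an intertwiner with nontrivial
  kernel, hence the zero matrix.\<close>

lemma schur_scalar:
  assumes \<rho>: "is_irr_rep X n \<rho>" and T: "T \<in> carrier_mat n n"
    and comm: "\<And>g. g \<in> carrier X \<Longrightarrow> \<rho> g * T = T * \<rho> g"
  shows "\<exists>c. \<forall>i<n. \<forall>j<n. T $$ (i, j) = (if i = j then c else 0)"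
proof -
  have n: "n > 0" using \<rho> by (simp add: is_irr_rep_def)
  obtain c where "eigenvalue T c" using spectrum_non_empty[OF T n] by (auto simp: spectrum_def)
  then obtain v where v: "v \<in> carrier_vec n" "v \<noteq> 0\<^sub>v n" "T *\<^sub>v v = c \<cdot>\<^sub>v v"
    using T by (auto simp: eigenvalue_def eigenvector_def)
  define D where "D = mat n n (\<lambda>(i, j). if i = j then c else (0 :: complex))"
  define S where "S = T - D"
  have D: "D \<in> carrier_mat n n" by (simp add: D_def)
  have S: "S \<in> carrier_mat n n" using T D by (auto simp: S_def)
  have \<rho>c: "\<rho> g \<in> carrier_mat n n" if "g \<in> carrier X" for g
    using \<rho> that by (auto simp: is_irr_rep_def is_rep_def)
  have DA: "D * A = A * D" if A: "A \<in> carrier_mat n n" for A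
  proof (rule eq_matI)
    fix i j assume "i < dim_row (A * D)" "j < dim_col (A * D)"
    then have ij: "i < n" "j < n" using A D by auto
    have "(D * A) $$ (i, j) = (\<Sum>k<n. if k = i then c * A $$ (k, j) else 0)"
      unfolding mult_mat_index[OF D A ij] using ij by (intro sum.cong) (auto simp: D_def)
    moreover have "(A * D) $$ (i, j) = (\<Sum>k<n. if k = j then A $$ (i, k) * c else 0)"
      unfolding mult_mat_index[OF A D ij] using ij by (intro sum.cong) (auto simp: D_def)
    ultimately show "(D * A) $$ (i, j) = (A * D) $$ (i, j)" using ij by simp
  qed (use A D in auto)
  have comm': "\<rho> g * S = S * \<rho> g" if g: "g \<in> carrier X" for g
    using mult_minus_distrib_mat[OF \<rho>c[OF g] T D] minus_mult_distrib_mat[OF T D \<rho>c[OF g]] comm[OF g] DA[OF \<rho>c[OF g]]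
    by (simp add: S_def)
  have "S *\<^sub>v v = 0\<^sub>v n"
  proof -
    have "D *\<^sub>v v = c \<cdot>\<^sub>v v"
    proof (rule eq_vecI)
      fix i assume "i < dim_vec (c \<cdot>\<^sub>v v)"
      then have i: "i < n" using v by simp
      have "(D *\<^sub>v v) $ i = (\<Sum>k<n. if k = i then c * v $ k else 0)"
        unfolding mult_mat_vec_index[OF D v(1) i] using i by (intro sum.cong) (auto simp: D_def)
      then show "(D *\<^sub>v v) $ i = (c \<cdot>\<^sub>v v) $ i" using i v by simp
    qed (use D v in auto)
    then have "S *\<^sub>v v = c \<cdot>\<^sub>v v - c \<cdot>\<^sub>v v"
      using minus_mult_distrib_mat_vec[OF T D v(1)] v(3) by (simp add: S_def)
    then show ?thesis using v(1) by simp
  qed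
  then have "\<not> injective_mat S" using v S by (auto simp: injective_mat_def)
  then have "S = 0\<^sub>m n n" using schur_bijective(1)[OF \<rho> \<rho> S _ comm'] by blast
  then have "S $$ (i, j) = 0\<^sub>m n n $$ (i, j)" for i j by simp
  then have "T $$ (i, j) = D $$ (i, j)" if "i < n" "j < n" for i j
    using that T D unfolding S_def by (metis carrier_matD index_minus_mat(1) index_zero_mat(1) eq_iff_diff_eq_0)
  then show ?thesis by (intro exI[of _ c]) (auto simp: D_def)
qed

section \<open>Averaging over a finite group and matrix coefficients\<close>

locale fin_group = group X for X (structure) +
  assumes fin: "finite (carrier X)"
begin

lemma sum_left_translate:
  assumes "h \<in> carrier X" shows "(\<Sum>g\<in>carrier X. f (h \<otimes> g)) = (\<Sum>g\<in>carrier X. f g)"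
  by (rule sum.reindex_bij_witness[of _ "\<lambda>g. inv h \<otimes> g" "\<lambda>g. h \<otimes> g"])
     (use assms in \<open>auto simp: m_assoc[symmetric]\<close>)

lemma sum_right_translate:
  assumes "h \<in> carrier X" shows "(\<Sum>g\<in>carrier X. f (g \<otimes> h)) = (\<Sum>g\<in>carrier X. f g)"
  by (rule sum.reindex_bij_witness[of _ "\<lambda>g. g \<otimes> inv h" "\<lambda>g. g \<otimes> h"])
     (use assms in \<open>auto simp: m_assoc\<close>)

lemma sum_inverse: "(\<Sum>g\<in>carrier X. f (inv g)) = (\<Sum>g\<in>carrier X. f g)"
  by (rule sum.reindex_bij_witness[of _ "\<lambda>g. inv g" "\<lambda>g. inv g"]) auto

lemma card_pos: "card (carrier X) > 0"
  using fin by (auto simp: card_gt_0_iff)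

lemma rep_carrier: "is_rep X n \<rho> \<Longrightarrow> g \<in> carrier X \<Longrightarrow> \<rho> g \<in> carrier_mat n n"
  by (simp add: is_rep_def)

lemma rep_mult_index:
  assumes "is_rep X n \<rho>" "g \<in> carrier X" "h \<in> carrier X" "i < n" "j < n"
  shows "\<rho> (g \<otimes> h) $$ (i, j) = (\<Sum>k<n. \<rho> g $$ (i, k) * \<rho> h $$ (k, j))"
  using mult_mat_index[OF rep_carrier rep_carrier, OF assms(1,2) assms(1,3) assms(4,5)] assms by (simp add: is_rep_def)

text \<open>\<open>T\<close> is, written entrywise, the group average of the elementary matrix with
  its 1 in position (i, j): the sum of the products of \<rho>(g), this matrix and
  \<sigma>(g^-1).\<close>

lemma average_intertwines:
  assumes \<rho>: "is_rep X n \<rho>" and \<sigma>: "is_rep X m \<sigma>" and ij: "i < n" "j < m" and h: "h \<in> carrier X"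
  defines "T \<equiv> mat n m (\<lambda>(k, l). \<Sum>g\<in>carrier X. \<rho> g $$ (k, i) * \<sigma> (inv g) $$ (j, l))"
  shows "\<rho> h * T = T * \<sigma> h"
proof (rule eq_matI)
  note hc = rep_carrier[OF \<rho> h] rep_carrier[OF \<sigma> h]
  have T: "T \<in> carrier_mat n m" by (simp add: T_def)
  fix k l assume "k < dim_row (T * \<sigma> h)" "l < dim_col (T * \<sigma> h)"
  then have kl: "k < n" "l < m" using T hc by auto
  have "(\<rho> h * T) $$ (k, l) = (\<Sum>a<n. \<rho> h $$ (k, a) * (\<Sum>g\<in>carrier X. \<rho> g $$ (a, i) * \<sigma> (inv g) $$ (j, l)))"
    unfolding mult_mat_index[OF hc(1) T kl] using kl by (intro sum.cong) (auto simp: T_def)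
  also have "\<dots> = (\<Sum>g\<in>carrier X. (\<Sum>a<n. \<rho> h $$ (k, a) * \<rho> g $$ (a, i)) * \<sigma> (inv g) $$ (j, l))"
    unfolding sum_distrib_left sum_distrib_right by (subst sum.swap) (simp add: mult.assoc)
  also have "\<dots> = (\<Sum>g\<in>carrier X. \<rho> (h \<otimes> g) $$ (k, i) * \<sigma> (inv (h \<otimes> g) \<otimes> h) $$ (j, l))"
    using h ij kl by (intro sum.cong refl) (simp add: rep_mult_index[OF \<rho>] inv_mult_group m_assoc)
  also have "\<dots> = (\<Sum>g\<in>carrier X. \<rho> g $$ (k, i) * \<sigma> (inv g \<otimes> h) $$ (j, l))"
    by (rule sum_left_translate[OF h])
  also have "\<dots> = (\<Sum>g\<in>carrier X. \<rho> g $$ (k, i) * (\<Sum>b<m. \<sigma> (inv g) $$ (j, b) * \<sigma> h $$ (b, l)))"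
    using h ij kl by (intro sum.cong refl) (simp add: rep_mult_index[OF \<sigma>])
  also have "\<dots> = (\<Sum>b<m. (\<Sum>g\<in>carrier X. \<rho> g $$ (k, i) * \<sigma> (inv g) $$ (j, b)) * \<sigma> h $$ (b, l))"
    unfolding sum_distrib_left sum_distrib_right by (subst sum.swap) (simp add: mult.assoc)
  also have "\<dots> = (T * \<sigma> h) $$ (k, l)"
    unfolding mult_mat_index[OF T hc(2) kl] using kl by (intro sum.cong) (auto simp: T_def)
  finally show "(\<rho> h * T) $$ (k, l) = (T * \<sigma> h) $$ (k, l)" .
qed (use rep_carrier[OF \<rho> h] rep_carrier[OF \<sigma> h] in \<open>auto simp: T_def\<close>)

lemma matrix_coeff_orthogonal_diff:
  assumes \<rho>: "is_irr_rep X n \<rho>" and \<sigma>: "is_irr_rep X m \<sigma>"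
    and diff: "h \<in> carrier X" "mat_trace (\<rho> h) \<noteq> mat_trace (\<sigma> h)"
    and idx: "k < n" "i < n" "j < m" "l < m"
  shows "(\<Sum>g\<in>carrier X. \<rho> g $$ (k, i) * \<sigma> (inv g) $$ (j, l)) = 0"
proof -
  define T where "T = mat n m (\<lambda>(k, l). \<Sum>g\<in>carrier X. \<rho> g $$ (k, i) * \<sigma> (inv g) $$ (j, l))"
  have "\<rho> g * T = T * \<sigma> g" if "g \<in> carrier X" for g
    unfolding T_def using \<rho> \<sigma> that idx by (intro average_intertwines) (auto simp: is_irr_rep_def)
  then have "T = 0\<^sub>m n m" using schur_trace_eq[OF \<rho> \<sigma>, of T h] diff by (auto simp: T_def)
  then have "T $$ (k, l) = 0" using idx by simp
  then show ?thesis using idx by (simp add: T_def)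
qed

text \<open>The average is a scalar matrix c by Schur; taking its trace, where \<rho>(g^-1)
  \<rho>(g) collapses to the identity, gives n c = |X| if i = j and 0 otherwise.\<close>

lemma matrix_coeff_orthogonal_same:
  assumes \<rho>: "is_irr_rep X n \<rho>" and idx: "k < n" "i < n" "j < n" "l < n"
  shows "(\<Sum>g\<in>carrier X. \<rho> g $$ (k, i) * \<rho> (inv g) $$ (j, l)) =
    (if k = l \<and> i = j then of_nat (card (carrier X)) / of_nat n else 0)"
proof -
  have rep: "is_rep X n \<rho>" and n: "n > 0" using \<rho> by (auto simp: is_irr_rep_def)
  define T where "T = mat n n (\<lambda>(k, l). \<Sum>g\<in>carrier X. \<rho> g $$ (k, i) * \<rho> (inv g) $$ (j, l))"
  have T: "T \<in> carrier_mat n n" by (simp add: T_def)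
  have "\<rho> g * T = T * \<rho> g" if "g \<in> carrier X" for g
    unfolding T_def using rep that idx by (intro average_intertwines) auto
  from schur_scalar[OF \<rho> T this] obtain c where c: "\<And>a b. a < n \<Longrightarrow> b < n \<Longrightarrow> T $$ (a, b) = (if a = b then c else 0)"
    by metis
  have "of_nat n * c = (\<Sum>a<n. T $$ (a, a))" using c by simp
  also have "\<dots> = (\<Sum>g\<in>carrier X. \<Sum>a<n. \<rho> (inv g) $$ (j, a) * \<rho> g $$ (a, i))"
    by (subst sum.swap) (simp add: T_def mult.commute)
  also have "\<dots> = (\<Sum>g\<in>carrier X. \<rho> \<one> $$ (j, i))"
    using idx by (intro sum.cong refl) (simp flip: rep_mult_index[OF rep])
  also have "\<dots> = (if i = j then of_nat (card (carrier X)) else 0)"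
    using rep idx by (auto simp: is_rep_def)
  finally have "c = (if i = j then of_nat (card (carrier X)) / of_nat n else 0)"
    using n by (auto simp: field_simps split: if_splits)
  then show ?thesis using c[of k l] idx by (auto simp: T_def)
qed

section \<open>Convolution of characters\<close>

text \<open>The product of the group algebra. It is polynomial in the values, without complex
  conjugation, and thus compatible with field automorphisms.\<close>

definition conv :: "('a \<Rightarrow> complex) \<Rightarrow> ('a \<Rightarrow> complex) \<Rightarrow> 'a \<Rightarrow> complex" where
  "conv f h x = (\<Sum>g\<in>carrier X. f g * h (inv g \<otimes> x))"

lemma conv_trace:
  assumes \<rho>: "is_rep X n \<rho>" and \<sigma>: "is_rep X m \<sigma>" and x: "x \<in> carrier X"
  shows "conv (\<lambda>g. mat_trace (\<rho> g)) (\<lambda>g. mat_trace (\<sigma> g)) x =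
    (\<Sum>k<n. \<Sum>j<m. \<Sum>l<m. (\<Sum>g\<in>carrier X. \<rho> g $$ (k, k) * \<sigma> (inv g) $$ (j, l)) * \<sigma> x $$ (l, j))"
proof -
  have "conv (\<lambda>g. mat_trace (\<rho> g)) (\<lambda>g. mat_trace (\<sigma> g)) x =
    (\<Sum>g\<in>carrier X. (\<Sum>k<n. \<rho> g $$ (k, k)) * (\<Sum>j<m. \<Sum>l<m. \<sigma> (inv g) $$ (j, l) * \<sigma> x $$ (l, j)))"
    unfolding conv_def using x
    by (intro sum.cong refl) (simp add: mat_trace_index[OF rep_carrier[OF \<rho>]] mat_trace_index[OF rep_carrier[OF \<sigma>]] rep_mult_index[OF \<sigma>])
  also have "\<dots> = (\<Sum>g\<in>carrier X. \<Sum>k<n. \<Sum>j<m. \<Sum>l<m. \<rho> g $$ (k, k) * \<sigma> (inv g) $$ (j, l) * \<sigma> x $$ (l, j))"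
    unfolding sum_distrib_right by (simp only: sum_distrib_left mult.assoc)
  also have "\<dots> = (\<Sum>k<n. \<Sum>g\<in>carrier X. \<Sum>j<m. \<Sum>l<m. \<rho> g $$ (k, k) * \<sigma> (inv g) $$ (j, l) * \<sigma> x $$ (l, j))"
    by (rule sum.swap)
  also have "\<dots> = (\<Sum>k<n. \<Sum>j<m. \<Sum>g\<in>carrier X. \<Sum>l<m. \<rho> g $$ (k, k) * \<sigma> (inv g) $$ (j, l) * \<sigma> x $$ (l, j))"
    by (intro sum.cong refl) (rule sum.swap)
  also have "\<dots> = (\<Sum>k<n. \<Sum>j<m. \<Sum>l<m. \<Sum>g\<in>carrier X. \<rho> g $$ (k, k) * \<sigma> (inv g) $$ (j, l) * \<sigma> x $$ (l, j))"
    by (intro sum.cong refl) (rule sum.swap)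
  finally show ?thesis by (simp add: sum_distrib_right)
qed

lemma conv_irr_diff:
  assumes \<rho>: "is_irr_rep X n \<rho>" and \<sigma>: "is_irr_rep X m \<sigma>"
    and diff: "h \<in> carrier X" "mat_trace (\<rho> h) \<noteq> mat_trace (\<sigma> h)" and x: "x \<in> carrier X"
  shows "conv (\<lambda>g. mat_trace (\<rho> g)) (\<lambda>g. mat_trace (\<sigma> g)) x = 0"
  using conv_trace[of n \<rho> m \<sigma> x] \<rho> \<sigma> x matrix_coeff_orthogonal_diff[OF \<rho> \<sigma> diff]
  by (simp add: is_irr_rep_def)

lemma conv_irr_same:
  assumes \<rho>: "is_irr_rep X n \<rho>" and x: "x \<in> carrier X"
  shows "conv (\<lambda>g. mat_trace (\<rho> g)) (\<lambda>g. mat_trace (\<rho> g)) x = of_nat (card (carrier X)) / of_nat n * mat_trace (\<rho> x)"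
proof -
  have rep: "is_rep X n \<rho>" using \<rho> by (simp add: is_irr_rep_def)
  let ?c = "of_nat (card (carrier X)) / of_nat n :: complex"
  have "conv (\<lambda>g. mat_trace (\<rho> g)) (\<lambda>g. mat_trace (\<rho> g)) x =
    (\<Sum>k<n. \<Sum>j<n. \<Sum>l<n. (if k = l \<and> k = j then ?c else 0) * \<rho> x $$ (l, j))"
    unfolding conv_trace[OF rep rep x]
    by (intro sum.cong refl) (simp add: matrix_coeff_orthogonal_same[OF \<rho>])
  also have "\<dots> = (\<Sum>k<n. \<Sum>j<n. \<Sum>l<n. if l = k then (if j = k then ?c * \<rho> x $$ (k, k) else 0) else 0)"
    by (intro sum.cong refl) auto
  also have "\<dots> = (\<Sum>k<n. ?c * \<rho> x $$ (k, k))" by simp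
  finally show ?thesis by (simp add: mat_trace_index[OF rep_carrier[OF rep x]] sum_distrib_left)
qed

text \<open>The matrix of the sum of f(g) \<rho>(g^-1) over all g commutes with the representation
  when f is a class function, so it is scalar; convolution with the character is the trace of this
  matrix times \<rho>(x).\<close>

lemma class_function_central:
  assumes \<rho>: "is_irr_rep X n \<rho>" and f: "\<And>g h. g \<in> carrier X \<Longrightarrow> h \<in> carrier X \<Longrightarrow> f (g \<otimes> h) = f (h \<otimes> g)"
  shows "\<exists>c. \<forall>x\<in>carrier X. conv f (\<lambda>g. mat_trace (\<rho> g)) x = c * mat_trace (\<rho> x)"
proof -
  have rep: "is_rep X n \<rho>" using \<rho> by (simp add: is_irr_rep_def)
  define M where "M = mat n n (\<lambda>(i, j). \<Sum>g\<in>carrier X. f g * \<rho> (inv g) $$ (i, j))"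
  have M: "M \<in> carrier_mat n n" by (simp add: M_def)
  have Mr: "(M * \<rho> h) $$ (i, j) = (\<Sum>g\<in>carrier X. f g * \<rho> (inv g \<otimes> h) $$ (i, j))"
    if h: "h \<in> carrier X" and ij: "i < n" "j < n" for h i j
  proof -
    have "(M * \<rho> h) $$ (i, j) = (\<Sum>k<n. (\<Sum>g\<in>carrier X. f g * \<rho> (inv g) $$ (i, k)) * \<rho> h $$ (k, j))"
      unfolding mult_mat_index[OF M rep_carrier[OF rep h] ij] using ij by (intro sum.cong) (auto simp: M_def)
    also have "\<dots> = (\<Sum>g\<in>carrier X. f g * (\<Sum>k<n. \<rho> (inv g) $$ (i, k) * \<rho> h $$ (k, j)))"
      unfolding sum_distrib_left sum_distrib_right by (subst sum.swap) (simp add: mult.assoc)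
    finally show ?thesis using h ij by (simp add: rep_mult_index[OF rep])
  qed
  have comm: "\<rho> h * M = M * \<rho> h" if h: "h \<in> carrier X" for h
  proof (rule eq_matI)
    note hc = rep_carrier[OF rep h]
    fix i j assume "i < dim_row (M * \<rho> h)" "j < dim_col (M * \<rho> h)"
    then have ij: "i < n" "j < n" using M hc by auto
    have "(\<rho> h * M) $$ (i, j) = (\<Sum>k<n. \<rho> h $$ (i, k) * (\<Sum>g\<in>carrier X. f g * \<rho> (inv g) $$ (k, j)))"
      unfolding mult_mat_index[OF hc M ij] using ij by (intro sum.cong) (auto simp: M_def)
    also have "\<dots> = (\<Sum>g\<in>carrier X. f g * (\<Sum>k<n. \<rho> h $$ (i, k) * \<rho> (inv g) $$ (k, j)))"
      unfolding sum_distrib_left by (subst sum.swap) (simp add: mult_ac)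
    also have "\<dots> = (\<Sum>g\<in>carrier X. f g * \<rho> (h \<otimes> inv g) $$ (i, j))"
      using h ij by (simp add: rep_mult_index[OF rep])
    \<comment> \<open>Conjugating the summation variable by h leaves f unchanged and moves h from
      the left of g^-1 to its right.\<close>
    also have "\<dots> = (\<Sum>g\<in>carrier X. f (inv h \<otimes> (g \<otimes> h)) * \<rho> (h \<otimes> inv (inv h \<otimes> (g \<otimes> h))) $$ (i, j))"
      by (simp only: sum_left_translate[where f = "\<lambda>g. f g * \<rho> (h \<otimes> inv g) $$ (i, j)", OF inv_closed[OF h], symmetric]
         sum_right_translate[where f = "\<lambda>g. f (inv h \<otimes> g) * \<rho> (h \<otimes> inv (inv h \<otimes> g)) $$ (i, j)", OF h])
    also have "\<dots> = (\<Sum>g\<in>carrier X. f g * \<rho> (inv g \<otimes> h) $$ (i, j))"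
    proof (intro sum.cong refl)
      fix g assume g: "g \<in> carrier X"
      have "f (inv h \<otimes> (g \<otimes> h)) = f ((g \<otimes> h) \<otimes> inv h)" using g h by (intro f) auto
      moreover have "(g \<otimes> h) \<otimes> inv h = g" using g h by (simp add: m_assoc)
      moreover have "h \<otimes> inv (inv h \<otimes> (g \<otimes> h)) = inv g \<otimes> h"
        using g h by (simp add: inv_mult_group m_assoc[symmetric])
      ultimately show "f (inv h \<otimes> (g \<otimes> h)) * \<rho> (h \<otimes> inv (inv h \<otimes> (g \<otimes> h))) $$ (i, j)
        = f g * \<rho> (inv g \<otimes> h) $$ (i, j)" by simp
    qed
    finally show "(\<rho> h * M) $$ (i, j) = (M * \<rho> h) $$ (i, j)" using Mr[OF h ij] by simp
  qed (use M rep_carrier[OF rep h] in auto)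
  from schur_scalar[OF \<rho> M comm] obtain c where c: "\<And>i j. i < n \<Longrightarrow> j < n \<Longrightarrow> M $$ (i, j) = (if i = j then c else 0)"
    by metis
  have "conv f (\<lambda>g. mat_trace (\<rho> g)) x = c * mat_trace (\<rho> x)" if x: "x \<in> carrier X" for x
  proof -
    have "conv f (\<lambda>g. mat_trace (\<rho> g)) x = (\<Sum>i<n. (M * \<rho> x) $$ (i, i))"
      unfolding conv_def using x
      by (simp add: mat_trace_index[OF rep_carrier[OF rep]] Mr sum_distrib_left del: index_mult_mat(1)) (rule sum.swap)
    also have "\<dots> = (\<Sum>i<n. \<Sum>k<n. if k = i then c * \<rho> x $$ (k, i) else 0)"
    proof (intro sum.cong refl)
      fix i assume "i \<in> {..<n}"
      then have i: "i < n" by simp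
      show "(M * \<rho> x) $$ (i, i) = (\<Sum>k<n. if k = i then c * \<rho> x $$ (k, i) else 0)"
        unfolding mult_mat_index[OF M rep_carrier[OF rep x] i i]
        by (intro sum.cong refl) (use i c in auto)
    qed
    also have "\<dots> = c * mat_trace (\<rho> x)"
      by (simp add: mat_trace_index[OF rep_carrier[OF rep x]] sum_distrib_left)
    finally show ?thesis .
  qed
  then show ?thesis by blast
qed

end

section \<open>Irreducible characters\<close>

lemma mult_mat_unit_vec:
  assumes "A \<in> carrier_mat n m" "i < n" "j < m" shows "(A *\<^sub>v unit_vec m j) $ i = (A $$ (i, j) :: complex)"
proof -
  have "(A *\<^sub>v unit_vec m j) $ i = (\<Sum>k<m. A $$ (i, k) * unit_vec m j $ k)"
    by (rule mult_mat_vec_index[OF assms(1) _ assms(2)]) simp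
  also have "\<dots> = (\<Sum>k<m. if k = j then A $$ (i, k) else 0)"
    using assms by (intro sum.cong) (auto simp: unit_vec_def)
  finally show ?thesis using assms by simp
qed

text \<open>In a basis adapted to an invariant subspace the matrices are block triangular; both
  diagonal blocks are representations and their traces add up.\<close>

lemma reducible_rep_character:
  fixes X (structure)
  assumes grp: "group X" and \<rho>: "is_rep X n \<rho>" "n > 0" "\<not> is_irr_rep X n \<rho>"
  obtains l \<rho>1 \<rho>2 where "0 < l" "l < n" "is_rep X l \<rho>1" "is_rep X (n - l) \<rho>2"
    "\<And>g. g \<in> carrier X \<Longrightarrow> mat_trace (\<rho> g) = mat_trace (\<rho>1 g) + mat_trace (\<rho>2 g)"
proof -
  interpret group X by fact
  obtain W where W: "is_subspace n W" "W \<noteq> {0\<^sub>v n}" "W \<noteq> carrier_vec n"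
    "\<And>g w. g \<in> carrier X \<Longrightarrow> w \<in> W \<Longrightarrow> \<rho> g *\<^sub>v w \<in> W"
    using \<rho> unfolding is_irr_rep_def by blast
  obtain l C D where CD: "C \<in> carrier_mat n n" "D \<in> carrier_mat n n" "C * D = 1\<^sub>m n" "D * C = 1\<^sub>m n" "l \<le> n"
    and Weq: "W = {C *\<^sub>v v | v. v \<in> carrier_vec n \<and> (\<forall>i<n. l \<le> i \<longrightarrow> v $ i = 0)}"
    by (rule subspace_adapted_basis[OF W(1)])
  have "l \<noteq> 0"
  proof
    assume l0: "l = 0"
    have "v = 0\<^sub>v n" if "v \<in> carrier_vec n" "\<forall>i<n. l \<le> i \<longrightarrow> v $ i = 0" for v
      using that l0 by (intro eq_vecI) auto
    then have "W \<subseteq> {0\<^sub>v n}" using mult_mat_vec_0[OF CD(1)] by (auto simp: Weq)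
    then show False using W(1,2) by (auto simp: is_subspace_def)
  qed
  moreover have "l \<noteq> n"
  proof
    assume ln: "l = n"
    have "w \<in> W" if w: "w \<in> carrier_vec n" for w
    proof -
      have "w = C *\<^sub>v (D *\<^sub>v w)" using assoc_mult_mat_vec[OF CD(1,2) w] CD(3) w by simp
      moreover have "D *\<^sub>v w \<in> carrier_vec n" using CD(2) w by simp
      ultimately show ?thesis unfolding Weq using ln by auto
    qed
    then show False using W(1,3) by (auto simp: is_subspace_def)
  qed
  ultimately have l: "0 < l" "l < n" using CD(5) by auto
  have \<rho>c: "\<rho> g \<in> carrier_mat n n" if "g \<in> carrier X" for g using \<rho> that by (simp add: is_rep_def)
  define \<sigma> where "\<sigma> g = D * (\<rho> g * C)" for g
  have \<sigma>c: "\<sigma> g \<in> carrier_mat n n" if "g \<in> carrier X" for g using \<rho>c[OF that] CD by (auto simp: \<sigma>_def)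
  have \<sigma>m: "\<sigma> (g \<otimes> h) = \<sigma> g * \<sigma> h" if gh: "g \<in> carrier X" "h \<in> carrier X" for g h
  proof -
    note c = \<rho>c[OF gh(1)] \<rho>c[OF gh(2)]
    have hC: "\<rho> h * C \<in> carrier_mat n n" using c CD by auto
    have "\<sigma> g * \<sigma> h = D * (\<rho> g * C * (D * (\<rho> h * C)))"
      unfolding \<sigma>_def using c CD by (intro assoc_mult_mat[of _ n n _ n]) auto
    also have "\<rho> g * C * (D * (\<rho> h * C)) = \<rho> g * (C * (D * (\<rho> h * C)))"
      using c CD by (intro assoc_mult_mat[of _ n n _ n]) auto
    also have "C * (D * (\<rho> h * C)) = C * D * (\<rho> h * C)"
      using c CD by (intro assoc_mult_mat[symmetric, of _ n n _ n]) auto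
    also have "\<dots> = \<rho> h * C" unfolding CD(3) by (rule left_mult_one_mat[OF hC])
    also have "\<rho> g * (\<rho> h * C) = \<rho> (g \<otimes> h) * C"
      using \<rho> gh assoc_mult_mat[OF c CD(1)] by (simp add: is_rep_def)
    finally show ?thesis by (simp add: \<sigma>_def)
  qed
  have \<sigma>1: "\<sigma> \<one> = 1\<^sub>m n" using \<rho>(1) CD by (simp add: \<sigma>_def is_rep_def)
  \<comment> \<open>Column j < l is the image of a basis vector of \<open>W\<close>; this image
    stays in \<open>W\<close> and so has no coordinates from l on.\<close>
  have \<sigma>0: "\<sigma> g $$ (i, j) = 0" if g: "g \<in> carrier X" and ij: "l \<le> i" "i < n" "j < l" for g i j
  proof -
    have jn: "j < n" using ij l by simp
    have "C *\<^sub>v unit_vec n j \<in> W" unfolding Weq using ij by (auto intro!: exI[of _ "unit_vec n j"] simp: unit_vec_def)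
    then have "\<rho> g *\<^sub>v (C *\<^sub>v unit_vec n j) \<in> W" by (rule W(4)[OF g])
    then obtain v where v: "\<rho> g *\<^sub>v (C *\<^sub>v unit_vec n j) = C *\<^sub>v v" "v \<in> carrier_vec n" "\<forall>i<n. l \<le> i \<longrightarrow> v $ i = 0"
      unfolding Weq by blast
    have "\<sigma> g *\<^sub>v unit_vec n j = D *\<^sub>v ((\<rho> g * C) *\<^sub>v unit_vec n j)"
      unfolding \<sigma>_def using \<rho>c[OF g] CD by (intro assoc_mult_mat_vec) auto
    also have "(\<rho> g * C) *\<^sub>v unit_vec n j = \<rho> g *\<^sub>v (C *\<^sub>v unit_vec n j)"
      using \<rho>c[OF g] CD by (intro assoc_mult_mat_vec) auto
    also have "D *\<^sub>v (\<rho> g *\<^sub>v (C *\<^sub>v unit_vec n j)) = v"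
      using assoc_mult_mat_vec[OF CD(2,1) v(2)] CD(4) v(1,2) by simp
    finally show ?thesis using mult_mat_unit_vec[OF \<sigma>c[OF g] ij(2) jn] v(3) ij by simp
  qed
  define \<rho>1 where "\<rho>1 g = mat l l (\<lambda>(i, j). \<sigma> g $$ (i, j))" for g
  define \<rho>2 where "\<rho>2 g = mat (n - l) (n - l) (\<lambda>(i, j). \<sigma> g $$ (i + l, j + l))" for g
  have split: "(\<Sum>k<n. f k) = (\<Sum>k<l. f k) + (\<Sum>k<n - l. f (k + l))" for f :: "nat \<Rightarrow> complex"
  proof -
    have "{..<n} = {..<l} \<union> {l..<n}" using l by auto
    then have "(\<Sum>k<n. f k) = (\<Sum>k<l. f k) + (\<Sum>k\<in>{l..<n}. f k)" by (simp add: sum.union_disjoint ivl_disj_int)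
    also have "(\<Sum>k\<in>{l..<n}. f k) = (\<Sum>k<n - l. f (k + l))"
      by (rule sum.reindex_bij_witness[of _ "\<lambda>k. k + l" "\<lambda>k. k - l"]) auto
    finally show ?thesis .
  qed
  have "is_rep X l \<rho>1"
    unfolding is_rep_def
  proof (intro conjI ballI)
    show "\<rho>1 g \<in> carrier_mat l l" for g by (simp add: \<rho>1_def)
    show "\<rho>1 \<one> = 1\<^sub>m l" unfolding \<rho>1_def \<sigma>1 using l by (intro eq_matI) auto
    fix g h assume gh: "g \<in> carrier X" "h \<in> carrier X"
    show "\<rho>1 (g \<otimes> h) = \<rho>1 g * \<rho>1 h"
    proof (rule eq_matI)
      fix i j assume "i < dim_row (\<rho>1 g * \<rho>1 h)" "j < dim_col (\<rho>1 g * \<rho>1 h)"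
      then have ij: "i < l" "j < l" by (auto simp: \<rho>1_def)
      then have ij': "i < n" "j < n" using l by auto
      have "\<rho>1 (g \<otimes> h) $$ (i, j) = (\<Sum>k<n. \<sigma> g $$ (i, k) * \<sigma> h $$ (k, j))"
        using ij mult_mat_index[OF \<sigma>c[OF gh(1)] \<sigma>c[OF gh(2)] ij'] by (simp add: \<rho>1_def \<sigma>m[OF gh])
      also have "\<dots> = (\<Sum>k<l. \<sigma> g $$ (i, k) * \<sigma> h $$ (k, j))"
        unfolding split using ij \<sigma>0[OF gh(2)] by simp
      also have "\<dots> = (\<Sum>k<l. \<rho>1 g $$ (i, k) * \<rho>1 h $$ (k, j))"
        using ij by (intro sum.cong) (auto simp: \<rho>1_def)
      also have "\<dots> = (\<rho>1 g * \<rho>1 h) $$ (i, j)"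
        using ij by (intro mult_mat_index[of _ l l _ l, symmetric]) (auto simp: \<rho>1_def)
      finally show "\<rho>1 (g \<otimes> h) $$ (i, j) = (\<rho>1 g * \<rho>1 h) $$ (i, j)" .
    qed (auto simp: \<rho>1_def)
  qed
  moreover have "is_rep X (n - l) \<rho>2"
    unfolding is_rep_def
  proof (intro conjI ballI)
    show "\<rho>2 g \<in> carrier_mat (n - l) (n - l)" for g by (simp add: \<rho>2_def)
    show "\<rho>2 \<one> = 1\<^sub>m (n - l)" unfolding \<rho>2_def \<sigma>1 using l by (intro eq_matI) auto
    fix g h assume gh: "g \<in> carrier X" "h \<in> carrier X"
    show "\<rho>2 (g \<otimes> h) = \<rho>2 g * \<rho>2 h"
    proof (rule eq_matI)
      fix i j assume "i < dim_row (\<rho>2 g * \<rho>2 h)" "j < dim_col (\<rho>2 g * \<rho>2 h)"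
      then have ij: "i < n - l" "j < n - l" by (auto simp: \<rho>2_def)
      then have ij': "i + l < n" "j + l < n" using l by auto
      have "\<rho>2 (g \<otimes> h) $$ (i, j) = (\<Sum>k<n. \<sigma> g $$ (i + l, k) * \<sigma> h $$ (k, j + l))"
        using ij mult_mat_index[OF \<sigma>c[OF gh(1)] \<sigma>c[OF gh(2)] ij'] by (simp add: \<rho>2_def \<sigma>m[OF gh])
      also have "\<dots> = (\<Sum>k<n - l. \<sigma> g $$ (i + l, k + l) * \<sigma> h $$ (k + l, j + l))"
        unfolding split using ij' \<sigma>0[OF gh(1)] by simp
      also have "\<dots> = (\<Sum>k<n - l. \<rho>2 g $$ (i, k) * \<rho>2 h $$ (k, j))"
        using ij by (intro sum.cong) (auto simp: \<rho>2_def)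
      also have "\<dots> = (\<rho>2 g * \<rho>2 h) $$ (i, j)"
        using ij by (intro mult_mat_index[of _ "n - l" "n - l" _ "n - l", symmetric]) (auto simp: \<rho>2_def)
      finally show "\<rho>2 (g \<otimes> h) $$ (i, j) = (\<rho>2 g * \<rho>2 h) $$ (i, j)" .
    qed (auto simp: \<rho>2_def)
  qed
  moreover have "mat_trace (\<rho> g) = mat_trace (\<rho>1 g) + mat_trace (\<rho>2 g)" if g: "g \<in> carrier X" for g
  proof -
    have "mat_trace (\<sigma> g) = mat_trace (\<rho> g * C * D)"
      unfolding \<sigma>_def using \<rho>c[OF g] CD by (intro mat_trace_comm[of _ n n]) auto
    also have "\<rho> g * C * D = \<rho> g" using assoc_mult_mat[OF \<rho>c[OF g] CD(1,2)] CD(3) \<rho>c[OF g] by simp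
    finally have "mat_trace (\<rho> g) = (\<Sum>k<n. \<sigma> g $$ (k, k))" using mat_trace_index[OF \<sigma>c[OF g]] by simp
    then show ?thesis unfolding split by (simp add: mat_trace_def \<rho>1_def \<rho>2_def)
  qed
  ultimately show ?thesis using that l by blast
qed

definition restr :: "('a, 'b) monoid_scheme \<Rightarrow> ('a \<Rightarrow> complex) \<Rightarrow> 'a \<Rightarrow> complex" where
  "restr X f = (\<lambda>g. if g \<in> carrier X then f g else 0)"

lemma restr_carrier: "g \<in> carrier X \<Longrightarrow> restr X f g = f g"
  by (simp add: restr_def)

text \<open>In \<^const>\<open>Irr\<close> a character is unconstrained off the carrier; \<open>IR\<close> contains one representative
  of each, so that distinct elements are distinct characters and \<open>IR\<close> is finite.\<close>

definition IR :: "('a, 'b) monoid_scheme \<Rightarrow> ('a \<Rightarrow> complex) set" where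
  "IR X = {restr X (\<lambda>g. mat_trace (\<rho> g)) | n \<rho>. is_irr_rep X n \<rho>}"

lemma Irr_iff_restr: "\<chi> \<in> Irr X \<longleftrightarrow> restr X \<chi> \<in> IR X"
  unfolding Irr_def IR_def restr_def fun_eq_iff by (auto; metis)

lemma restr_IR: "\<chi> \<in> IR X \<Longrightarrow> restr X \<chi> = \<chi>"
  by (auto simp: IR_def restr_def)

lemma IR_subset_Irr: "\<chi> \<in> IR X \<Longrightarrow> \<chi> \<in> Irr X"
  by (simp add: Irr_iff_restr restr_IR)

lemma IR_outside: "\<chi> \<in> IR X \<Longrightarrow> g \<notin> carrier X \<Longrightarrow> \<chi> g = 0"
  by (auto simp: IR_def restr_def)

context fin_group
begin

text \<open>A list and not a set of constituents: repetitions record the multiplicities, later read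
  off by \<open>count_list\<close>.\<close>

lemma rep_character_decomposition:
  assumes "is_rep X n \<rho>"
  shows "\<exists>cs. set cs \<subseteq> IR X \<and> (\<forall>g\<in>carrier X. mat_trace (\<rho> g) = (\<Sum>c\<leftarrow>cs. c g))"
  using assms
proof (induction n arbitrary: \<rho> rule: less_induct)
  case (less n)
  consider "n = 0" | "is_irr_rep X n \<rho>" | "n > 0" "\<not> is_irr_rep X n \<rho>" by blast
  then show ?case
  proof cases
    case 1
    then show ?thesis using less.prems by (intro exI[of _ "[]"]) (auto simp: mat_trace_def is_rep_def)
  next
    case 2
    then have "restr X (\<lambda>g. mat_trace (\<rho> g)) \<in> IR X" by (auto simp: IR_def)
    then show ?thesis by (intro exI[of _ "[restr X (\<lambda>g. mat_trace (\<rho> g))]"]) (auto simp: restr_def)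
  next
    case 3
    obtain l \<rho>1 \<rho>2 where l: "0 < l" "l < n" "is_rep X l \<rho>1" "is_rep X (n - l) \<rho>2"
      "\<And>g. g \<in> carrier X \<Longrightarrow> mat_trace (\<rho> g) = mat_trace (\<rho>1 g) + mat_trace (\<rho>2 g)"
      by (rule reducible_rep_character[OF group_axioms less.prems 3]) blast
    from less.IH[OF l(2,3)] obtain cs where cs: "set cs \<subseteq> IR X" "\<forall>g\<in>carrier X. mat_trace (\<rho>1 g) = (\<Sum>c\<leftarrow>cs. c g)" by blast
    from less.IH[OF _ l(4)] l obtain ds where ds: "set ds \<subseteq> IR X" "\<forall>g\<in>carrier X. mat_trace (\<rho>2 g) = (\<Sum>c\<leftarrow>ds. c g)" by auto
    show ?thesis using cs ds l(5) by (intro exI[of _ "cs @ ds"]) auto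
  qed
qed

lemma conv_restr: "x \<in> carrier X \<Longrightarrow> conv (restr X f) (restr X h) x = conv f h x"
  unfolding conv_def by (intro sum.cong) (auto simp: restr_def)

lemma conv_restr_right: "x \<in> carrier X \<Longrightarrow> conv f (restr X h) x = conv f h x"
  unfolding conv_def by (intro sum.cong) (auto simp: restr_def)

lemma IR_degree:
  assumes "\<chi> \<in> IR X" shows "\<exists>n>0. \<chi> \<one> = of_nat n"
  using assms by (auto simp: IR_def restr_def is_irr_rep_def is_rep_def mat_trace_def)

lemma IR_degree_nonzero: "\<chi> \<in> IR X \<Longrightarrow> \<chi> \<one> \<noteq> 0"
  using IR_degree[of \<chi>] by auto

lemma conv_IR_diff:
  assumes "\<chi> \<in> IR X" "\<psi> \<in> IR X" "\<chi> \<noteq> \<psi>" "x \<in> carrier X" shows "conv \<chi> \<psi> x = 0"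
proof -
  obtain n \<rho> m \<sigma> where \<rho>: "is_irr_rep X n \<rho>" "\<chi> = restr X (\<lambda>g. mat_trace (\<rho> g))"
    and \<sigma>: "is_irr_rep X m \<sigma>" "\<psi> = restr X (\<lambda>g. mat_trace (\<sigma> g))" using assms by (auto simp: IR_def)
  obtain h where h: "h \<in> carrier X" "mat_trace (\<rho> h) \<noteq> mat_trace (\<sigma> h)"
    using assms(3) unfolding \<rho> \<sigma> restr_def by metis
  show ?thesis unfolding \<rho> \<sigma> conv_restr[OF assms(4)] by (rule conv_irr_diff[OF \<rho>(1) \<sigma>(1) h assms(4)])
qed

lemma conv_IR_same:
  assumes "\<chi> \<in> IR X" "x \<in> carrier X" shows "conv \<chi> \<chi> x = of_nat (card (carrier X)) / \<chi> \<one> * \<chi> x"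
proof -
  obtain n \<rho> where \<rho>: "is_irr_rep X n \<rho>" "\<chi> = restr X (\<lambda>g. mat_trace (\<rho> g))"
    using assms by (auto simp: IR_def)
  have "\<chi> \<one> = of_nat n" using \<rho> by (simp add: restr_def is_irr_rep_def is_rep_def mat_trace_def)
  then show ?thesis using conv_irr_same[OF \<rho>(1) assms(2)] assms(2)
    unfolding \<rho>(2) conv_restr[OF assms(2)] by (simp add: restr_def)
qed

definition class_fun :: "('a \<Rightarrow> complex) \<Rightarrow> bool" where
  "class_fun f \<longleftrightarrow> (\<forall>g\<in>carrier X. \<forall>h\<in>carrier X. f (g \<otimes> h) = f (h \<otimes> g))"

lemma class_fun_conj:
  assumes "class_fun f" "g \<in> carrier X" "x \<in> carrier X" shows "f (inv x \<otimes> g \<otimes> x) = f g"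
proof -
  have "f ((inv x \<otimes> g) \<otimes> x) = f (x \<otimes> (inv x \<otimes> g))" using assms unfolding class_fun_def by auto
  then show ?thesis using assms by (simp add: m_assoc[symmetric])
qed

lemma IR_class_fun:
  assumes "\<chi> \<in> IR X" shows "class_fun \<chi>"
proof -
  obtain n \<rho> where \<rho>: "is_irr_rep X n \<rho>" "\<chi> = restr X (\<lambda>g. mat_trace (\<rho> g))"
    using assms by (auto simp: IR_def)
  show ?thesis unfolding class_fun_def \<rho>(2) restr_def
    using \<rho>(1) by (auto simp: is_irr_rep_def is_rep_def intro!: mat_trace_comm[of _ n n])
qed

lemma class_fun_conv_IR:
  assumes f: "class_fun f" and \<chi>: "\<chi> \<in> IR X"
  shows "\<exists>c. \<forall>x\<in>carrier X. conv f \<chi> x = c * \<chi> x"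
proof -
  obtain n \<rho> where \<rho>: "is_irr_rep X n \<rho>" "\<chi> = restr X (\<lambda>g. mat_trace (\<rho> g))"
    using \<chi> by (auto simp: IR_def)
  obtain c where "\<forall>x\<in>carrier X. conv f (\<lambda>g. mat_trace (\<rho> g)) x = c * mat_trace (\<rho> x)"
    using class_function_central[OF \<rho>(1), of f] f by (auto simp: class_fun_def)
  then show ?thesis unfolding \<rho>(2) by (intro exI[of _ c]) (simp add: conv_restr_right restr_carrier)
qed

text \<open>Trace of the permutation matrices of left multiplication. Being |X| times the delta
  function at the identity, it is, up to |X|, a unit for convolution; completeness of the
  irreducible characters rests on this.\<close>

lemma regular_character:
  obtains cs where "set cs \<subseteq> IR X"
    "\<And>g. g \<in> carrier X \<Longrightarrow> (\<Sum>c\<leftarrow>cs. c g) = (if g = \<one> then of_nat (card (carrier X)) else 0)"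
proof -
  define N where "N = card (carrier X)"
  obtain e where e: "bij_betw e {0..<N} (carrier X)" using ex_bij_betw_nat_finite[OF fin] by (auto simp: N_def)
  then have ec: "e i \<in> carrier X" if "i < N" for i using that by (auto simp: bij_betw_def)
  have einj: "e i = e j \<longleftrightarrow> i = j" if "i < N" "j < N" for i j
    using e that by (auto simp: bij_betw_def inj_on_def)
  define R where "R g = mat N N (\<lambda>(i, j). if e i = g \<otimes> e j then 1 else (0 :: complex))" for g
  have R: "is_rep X N R"
    unfolding is_rep_def
  proof (intro conjI ballI)
    show "R g \<in> carrier_mat N N" for g by (simp add: R_def)
    show "R \<one> = 1\<^sub>m N" by (intro eq_matI) (auto simp: R_def ec einj)
    fix g h assume gh: "g \<in> carrier X" "h \<in> carrier X"
    show "R (g \<otimes> h) = R g * R h"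
    proof (rule eq_matI)
      fix i j assume "i < dim_row (R g * R h)" "j < dim_col (R g * R h)"
      then have ij: "i < N" "j < N" by (auto simp: R_def)
      obtain k where k: "k < N" "e k = h \<otimes> e j"
        using e ec[OF ij(2)] gh by (metis atLeastLessThan_iff bij_betw_iff_bijections m_closed)
      have "(R g * R h) $$ (i, j) = (\<Sum>l<N. R g $$ (i, l) * R h $$ (l, j))"
        using ij by (intro mult_mat_index) (auto simp: R_def)
      also have "\<dots> = (\<Sum>l<N. if l = k then R g $$ (i, k) else 0)"
      proof (intro sum.cong refl)
        fix l assume "l \<in> {..<N}"
        then have "l < N" by simp
        then show "R g $$ (i, l) * R h $$ (l, j) = (if l = k then R g $$ (i, k) else 0)"
          using ij k einj[of l k] by (auto simp: R_def)
      qed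
      also have "\<dots> = R (g \<otimes> h) $$ (i, j)"
        using ij k gh ec by (auto simp: R_def m_assoc)
      finally show "R (g \<otimes> h) $$ (i, j) = (R g * R h) $$ (i, j)" by simp
    qed (auto simp: R_def)
  qed
  obtain cs where cs: "set cs \<subseteq> IR X" "\<forall>g\<in>carrier X. mat_trace (R g) = (\<Sum>c\<leftarrow>cs. c g)"
    using rep_character_decomposition[OF R] by blast
  have "mat_trace (R g) = (if g = \<one> then of_nat N else 0)" if g: "g \<in> carrier X" for g
  proof -
    have "e i = g \<otimes> e i \<longleftrightarrow> g = \<one>" if "i < N" for i
      using ec[OF that] g by (metis l_one one_closed right_cancel)
    then show ?thesis by (auto simp: mat_trace_def R_def)
  qed
  then show ?thesis using that[of cs] cs by (simp add: N_def)
qed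

lemma conv_sum_list_right:
  "conv f (\<lambda>g. \<Sum>c\<leftarrow>cs. c g) x = (\<Sum>c\<leftarrow>cs. conv f c x)"
  by (induction cs) (auto simp: conv_def algebra_simps sum.distrib)

lemma conv_delta:
  assumes x: "x \<in> carrier X" and d: "\<And>g. g \<in> carrier X \<Longrightarrow> d g = (if g = \<one> then k else 0)"
  shows "conv f d x = f x * k"
proof -
  have "inv g \<otimes> x = \<one> \<longleftrightarrow> g = x" if "g \<in> carrier X" for g
    using that x by (metis inv_closed inv_equality inv_inv l_inv)
  then have "conv f d x = (\<Sum>g\<in>carrier X. if g = x then f g * k else 0)"
    unfolding conv_def using x d by (intro sum.cong) auto
  also have "\<dots> = f x * k" using x fin by simp
  finally show ?thesis .
qed

text \<open>Convolution with the regular character multiplies by |X|, but it would annihilate an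
  irreducible character that is missing among its finitely many constituents.\<close>

lemma finite_IR: "finite (IR X)"
proof -
  obtain cs where cs: "set cs \<subseteq> IR X"
    "\<And>g. g \<in> carrier X \<Longrightarrow> (\<Sum>c\<leftarrow>cs. c g) = (if g = \<one> then of_nat (card (carrier X)) else 0)"
    by (rule regular_character) blast
  have "IR X \<subseteq> set cs"
  proof (rule ccontr)
    assume "\<not> IR X \<subseteq> set cs"
    then obtain \<chi> where \<chi>: "\<chi> \<in> IR X" "\<chi> \<notin> set cs" by auto
    have "conv \<chi> (\<lambda>g. \<Sum>c\<leftarrow>cs. c g) \<one> = \<chi> \<one> * of_nat (card (carrier X))"
      by (rule conv_delta) (use cs in auto)
    moreover have "conv \<chi> (\<lambda>g. \<Sum>c\<leftarrow>cs. c g) \<one> = (\<Sum>c\<leftarrow>cs. conv \<chi> c \<one>)" by (rule conv_sum_list_right)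
    moreover have "\<dots> = (\<Sum>c\<leftarrow>cs. 0)"
    proof (intro arg_cong[of _ _ sum_list] map_cong refl)
      fix c assume "c \<in> set cs"
      then show "conv \<chi> c \<one> = 0" using \<chi> cs(1) by (intro conv_IR_diff) auto
    qed
    ultimately show False using IR_degree_nonzero[OF \<chi>(1)] card_pos by simp
  qed
  then show ?thesis using finite_subset by blast
qed

section \<open>Inner product and expansion of class functions\<close>

text \<open>\<open>h (inv g)\<close> takes the place of the complex conjugate, with which it agrees
  on characters; the form is bilinear, symmetric and compatible with Galois automorphisms.\<close>

definition ip :: "('a \<Rightarrow> complex) \<Rightarrow> ('a \<Rightarrow> complex) \<Rightarrow> complex" where
  "ip f h = (\<Sum>g\<in>carrier X. f g * h (inv g)) / of_nat (card (carrier X))"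

lemma ip_conv: "ip f h = conv f h \<one> / of_nat (card (carrier X))"
  unfolding ip_def conv_def by (intro arg_cong2[of _ _ _ _ "(/)"] sum.cong) auto

lemma ip_sum_left: "ip (\<lambda>g. \<Sum>i\<in>A. a i * f i g) h = (\<Sum>i\<in>A. a i * ip (f i) h)"
proof -
  define S where "S i = (\<Sum>g\<in>carrier X. f i g * h (inv g))" for i
  have "(\<Sum>g\<in>carrier X. (\<Sum>i\<in>A. a i * f i g) * h (inv g)) = (\<Sum>i\<in>A. a i * S i)"
    unfolding S_def sum_distrib_left sum_distrib_right by (subst sum.swap) (simp add: mult.assoc)
  then show ?thesis by (simp add: ip_def flip: S_def) (simp add: sum_divide_distrib)
qed

lemma ip_sym: "ip f h = ip h f"
proof -
  have "(\<Sum>g\<in>carrier X. f g * h (inv g)) = (\<Sum>g\<in>carrier X. f (inv g) * h (inv (inv g)))"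
    by (rule sum_inverse[symmetric])
  also have "\<dots> = (\<Sum>g\<in>carrier X. h g * f (inv g))" by (intro sum.cong) auto
  finally show ?thesis by (simp add: ip_def)
qed

lemma ip_cong: "(\<And>g. g \<in> carrier X \<Longrightarrow> f g = f' g) \<Longrightarrow> (\<And>g. g \<in> carrier X \<Longrightarrow> h g = h' g) \<Longrightarrow> ip f h = ip f' h'"
  unfolding ip_def by (intro arg_cong2[of _ _ _ _ "(/)"] sum.cong) auto

lemma ip_IR: "\<chi> \<in> IR X \<Longrightarrow> \<psi> \<in> IR X \<Longrightarrow> ip \<chi> \<psi> = (if \<chi> = \<psi> then 1 else 0)"
  using conv_IR_same[of \<chi> \<one>] conv_IR_diff[of \<chi> \<psi> \<one>] card_pos IR_degree_nonzero[of \<chi>]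
  by (cases "\<chi> = \<psi>") (auto simp: ip_conv)

lemma ip_combination:
  assumes "\<chi> \<in> IR X" "\<And>g. g \<in> carrier X \<Longrightarrow> f g = (\<Sum>\<psi>\<in>IR X. a \<psi> * \<psi> g)"
  shows "ip f \<chi> = a \<chi>"
proof -
  have "ip f \<chi> = ip (\<lambda>g. \<Sum>\<psi>\<in>IR X. a \<psi> * \<psi> g) \<chi>" by (rule ip_cong) (use assms in auto)
  also have "\<dots> = (\<Sum>\<psi>\<in>IR X. a \<psi> * ip \<psi> \<chi>)" by (rule ip_sum_left)
  also have "\<dots> = (\<Sum>\<psi>\<in>IR X. if \<psi> = \<chi> then a \<psi> else 0)" by (intro sum.cong) (auto simp: ip_IR assms)
  also have "\<dots> = a \<chi>" using assms finite_IR by simp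
  finally show ?thesis .
qed

lemma sum_list_IR_combination:
  assumes "set cs \<subseteq> IR X"
  shows "(\<Sum>c\<leftarrow>cs. k c * c g) = (\<Sum>\<psi>\<in>IR X. (of_nat (count_list cs \<psi>) * k \<psi>) * (\<psi> g :: complex))"
  using assms
proof (induction cs)
  case (Cons d cs)
  have "(\<Sum>\<psi>\<in>IR X. of_nat (count_list (d # cs) \<psi>) * k \<psi> * \<psi> g) =
    (\<Sum>\<psi>\<in>IR X. of_nat (count_list cs \<psi>) * k \<psi> * \<psi> g + (if \<psi> = d then k \<psi> * \<psi> g else 0))"
    by (intro sum.cong) (auto simp: algebra_simps)
  also have "\<dots> = (\<Sum>\<psi>\<in>IR X. of_nat (count_list cs \<psi>) * k \<psi> * \<psi> g) + k d * d g"
    using Cons.prems finite_IR by (simp add: sum.distrib)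
  finally show ?case using Cons by simp
qed simp

text \<open>Convolving f with the regular character returns |X| f, and convolving it with each
  irreducible constituent returns a multiple of that constituent; so f is a combination of them, and
  orthogonality identifies the coefficients.\<close>

theorem class_fun_expansion:
  assumes f: "class_fun f" and x: "x \<in> carrier X"
  shows "f x = (\<Sum>\<chi>\<in>IR X. ip f \<chi> * \<chi> x)"
proof -
  obtain cs where cs: "set cs \<subseteq> IR X"
    "\<And>g. g \<in> carrier X \<Longrightarrow> (\<Sum>c\<leftarrow>cs. c g) = (if g = \<one> then of_nat (card (carrier X)) else 0)"
    by (rule regular_character) blast
  let ?N = "of_nat (card (carrier X)) :: complex"
  have N: "?N \<noteq> 0" using card_pos by simp
  obtain k where k: "\<And>\<chi> x. \<chi> \<in> IR X \<Longrightarrow> x \<in> carrier X \<Longrightarrow> conv f \<chi> x = k \<chi> * \<chi> x"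
    using class_fun_conv_IR[OF f] by metis
  define a where "a \<chi> = of_nat (count_list cs \<chi>) * k \<chi> / ?N" for \<chi>
  have eq: "f y = (\<Sum>\<chi>\<in>IR X. a \<chi> * \<chi> y)" if y: "y \<in> carrier X" for y
  proof -
    have "f y * ?N = conv f (\<lambda>g. \<Sum>c\<leftarrow>cs. c g) y" by (rule conv_delta[symmetric, OF y]) (use cs in auto)
    also have "\<dots> = (\<Sum>c\<leftarrow>cs. k c * c y)"
      unfolding conv_sum_list_right using cs(1) k[OF _ y] by (intro arg_cong[of _ _ sum_list] map_cong) auto
    also have "\<dots> = (\<Sum>\<chi>\<in>IR X. (a \<chi> * \<chi> y) * ?N)"
      unfolding sum_list_IR_combination[OF cs(1)] using N by (simp add: a_def)
    finally show ?thesis using N by (simp flip: sum_distrib_right)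
  qed
  have "ip f \<chi> = a \<chi>" if "\<chi> \<in> IR X" for \<chi> by (rule ip_combination[OF that eq])
  then show ?thesis using eq[OF x] by simp
qed

lemma rep_character_multiplicity:
  assumes "is_rep X n \<rho>" "\<chi> \<in> IR X"
  shows "\<exists>m::nat. ip (\<lambda>g. mat_trace (\<rho> g)) \<chi> = of_nat m"
proof -
  obtain cs where cs: "set cs \<subseteq> IR X" "\<forall>g\<in>carrier X. mat_trace (\<rho> g) = (\<Sum>c\<leftarrow>cs. c g)"
    using rep_character_decomposition[OF assms(1)] by blast
  have "ip (\<lambda>g. mat_trace (\<rho> g)) \<chi> = of_nat (count_list cs \<chi>)"
    by (rule ip_combination[OF assms(2)]) (use cs sum_list_IR_combination[OF cs(1), of "\<lambda>_. 1"] in auto)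
  then show ?thesis by blast
qed

end

section \<open>The Galois action on irreducible characters\<close>

lemma upper_triangular_mult:
  assumes A: "A \<in> carrier_mat n n" "upper_triangular A" and B: "B \<in> carrier_mat n n" "upper_triangular (B :: complex mat)"
  shows "upper_triangular (A * B)" "i < n \<Longrightarrow> (A * B) $$ (i, i) = A $$ (i, i) * B $$ (i, i)"
proof -
  have A0: "A $$ (i, k) = 0" if "i < n" "k < i" for i k using upper_triangularD[OF A(2) that(2)] A(1) that(1) by simp
  have B0: "B $$ (k, j) = 0" if "k < n" "j < k" for k j using upper_triangularD[OF B(2) that(2)] B(1) that(1) by simp
  show "upper_triangular (A * B)"
  proof (rule upper_triangularI)
    fix i j assume "j < i" "i < dim_row (A * B)"
    then have ij: "j < i" "i < n" "j < n" using A by auto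
    show "(A * B) $$ (i, j) = 0"
      unfolding mult_mat_index[OF A(1) B(1) ij(2,3)]
    proof (rule sum.neutral, rule ballI)
      fix k assume "k \<in> {..<n}"
      then show "A $$ (i, k) * B $$ (k, j) = 0" using A0[of i k] B0[of k j] ij by (cases "k < i") auto
    qed
  qed
  show "(A * B) $$ (i, i) = A $$ (i, i) * B $$ (i, i)" if i: "i < n"
  proof -
    have "(A * B) $$ (i, i) = (\<Sum>k<n. if k = i then A $$ (i, i) * B $$ (i, i) else 0)"
      unfolding mult_mat_index[OF A(1) B(1) i i]
    proof (intro sum.cong refl)
      fix k assume "k \<in> {..<n}"
      then show "A $$ (i, k) * B $$ (k, i) = (if k = i then A $$ (i, i) * B $$ (i, i) else 0)"
        using A0[of i k] B0[of k i] i by (cases k i rule: linorder_cases) auto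
    qed
    then show ?thesis using i by simp
  qed
qed

context fin_group
begin

text \<open>After a change of basis that makes \<rho>(g) triangular, the diagonal of its j-th power
  consists of j-th powers, and of ones for j = N. Hence one choice of exponents \<open>a\<close>
  serves all j at once.\<close>

lemma rep_power_trace:
  assumes \<rho>: "is_rep X n \<rho>" and g: "g \<in> carrier X" and N: "N > 0" "g [^] N = \<one>"
  obtains a where "\<And>j. mat_trace (\<rho> (g [^] (j::nat))) = (\<Sum>i<n. zeta N ^ (a i * j))"
proof -
  have c: "\<rho> h \<in> carrier_mat n n" if "h \<in> carrier X" for h using rep_carrier[OF \<rho> that] .
  obtain es where es: "char_poly (\<rho> g) = (\<Prod>a\<leftarrow>es. [:- a, 1:])" using char_poly_factorized[OF c[OF g]] by blast
  obtain B where B: "B \<in> carrier_mat n n" "upper_triangular B" "similar_mat (\<rho> g) B"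
    using schur_decomposition_exists[OF c[OF g] es] by blast
  obtain P Q where "similar_mat_wit (\<rho> g) B P Q" using B(3) by (auto simp: similar_mat_def)
  note w = similar_mat_witD2[OF c[OF g] this]
  define \<sigma> where "\<sigma> j = Q * (\<rho> (g [^] j) * P)" for j :: nat
  have gc: "g [^] j \<in> carrier X" for j :: nat using g by simp
  have \<sigma>: "\<sigma> j \<in> carrier_mat n n \<and> upper_triangular (\<sigma> j) \<and> (\<forall>i<n. \<sigma> j $$ (i, i) = (B $$ (i, i)) ^ j)" for j
  proof (induction j)
    case 0
    have "\<sigma> 0 = 1\<^sub>m n" using \<rho> w(2,6) by (simp add: \<sigma>_def is_rep_def)
    then show ?case by simp
  next
    case (Suc j)
    note cc = c[OF gc[of j]] c[OF g]
    have "\<sigma> j * B = \<sigma> j * (Q * (P * B * Q) * P)"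
    proof -
      have "Q * (P * B * Q) * P = Q * (P * B * Q * P)"
        using w by (intro assoc_mult_mat[of _ n n _ n]) auto
      also have "P * B * Q * P = P * B * (Q * P)" using w by (intro assoc_mult_mat[of _ n n _ n]) auto
      also have "\<dots> = P * B" using w by simp
      also have "Q * (P * B) = Q * P * B" using w by (intro assoc_mult_mat[symmetric, of _ n n _ n]) auto
      also have "\<dots> = B" using w(2) B(1) by simp
      finally show ?thesis by simp
    qed
    also have "\<dots> = \<sigma> j * (Q * (\<rho> g * P))"
      using w assoc_mult_mat[OF w(7) cc(2) w(6)] by simp
    also have "\<dots> = Q * (\<rho> (g [^] j) * P * (Q * (\<rho> g * P)))"
      unfolding \<sigma>_def using w cc by (intro assoc_mult_mat[of _ n n _ n]) auto
    also have "\<rho> (g [^] j) * P * (Q * (\<rho> g * P)) = \<rho> (g [^] j) * (P * (Q * (\<rho> g * P)))"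
      using w cc by (intro assoc_mult_mat[of _ n n _ n]) auto
    also have "P * (Q * (\<rho> g * P)) = P * Q * (\<rho> g * P)"
      using w cc by (intro assoc_mult_mat[symmetric, of _ n n _ n]) auto
    also have "P * Q * (\<rho> g * P) = \<rho> g * P" unfolding w(1) using w cc by (intro left_mult_one_mat[of _ n n]) auto
    also have "\<rho> (g [^] j) * (\<rho> g * P) = \<rho> (g [^] j) * \<rho> g * P"
      using w cc by (intro assoc_mult_mat[symmetric, of _ n n _ n]) auto
    also have "\<rho> (g [^] j) * \<rho> g = \<rho> (g [^] Suc j)" using \<rho> g gc[of j] by (simp add: is_rep_def)
    finally have eq: "\<sigma> (Suc j) = \<sigma> j * B" by (simp add: \<sigma>_def)
    show ?case unfolding eq using Suc upper_triangular_mult[of "\<sigma> j" n B] B(1,2) by (auto simp: mult.commute)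
  qed
  have tr: "mat_trace (\<rho> (g [^] j)) = (\<Sum>i<n. (B $$ (i, i)) ^ j)" for j
  proof -
    have "mat_trace (\<sigma> j) = mat_trace (\<rho> (g [^] j) * P * Q)"
      unfolding \<sigma>_def using w c[OF gc[of j]] by (intro mat_trace_comm[of _ n n]) auto
    also have "\<rho> (g [^] j) * P * Q = \<rho> (g [^] j)"
      using assoc_mult_mat[OF c[OF gc[of j]] w(6,7)] w(1) c[OF gc[of j]] by simp
    finally show ?thesis using \<sigma>[of j] mat_trace_index[of "\<sigma> j" n] by simp
  qed
  have "\<exists>a. B $$ (i, i) = zeta N ^ a" if i: "i < n" for i
  proof -
    have "\<sigma> N = 1\<^sub>m n" unfolding \<sigma>_def N(2) using \<rho> w(2,6) by (simp add: is_rep_def)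
    then have "(B $$ (i, i)) ^ N = 1" using \<sigma>[of N] i by simp
    then show ?thesis using root_of_unity_zeta_power[OF N(1)] by metis
  qed
  then obtain a where "\<And>i. i < n \<Longrightarrow> B $$ (i, i) = zeta N ^ a i" by metis
  then show ?thesis using that[of a] tr by (simp add: power_mult)
qed

lemma pow_card_multiple:
  assumes "g \<in> carrier X" "card (carrier X) dvd N" shows "g [^] (N::nat) = \<one>"
proof -
  obtain k where "N = card (carrier X) * k" using assms(2) by (elim dvdE)
  then show ?thesis using pow_order_eq_1[OF assms(1)] assms(1) by (simp add: nat_pow_pow[symmetric] Coset.order_def)
qed

lemma pow_cong_exponent:
  assumes "g \<in> carrier X" "card (carrier X) dvd N" "[u = v] (mod N)" shows "g [^] (u::nat) = g [^] v"
proof -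
  have "g [^] w = g [^] (w mod N)" for w :: nat
  proof -
    have "g [^] (N * (w div N) + w mod N) = g [^] (N * (w div N)) \<otimes> g [^] (w mod N)"
      by (rule nat_pow_mult[OF assms(1), symmetric])
    also have "g [^] (N * (w div N)) = (g [^] N) [^] (w div N)" by (rule nat_pow_pow[OF assms(1), symmetric])
    also have "\<dots> = \<one>" unfolding pow_card_multiple[OF assms(1,2)] by simp
    finally have "g [^] (N * (w div N) + w mod N) = g [^] (w mod N)" using assms(1) by simp
    then show ?thesis by simp
  qed
  then show ?thesis using assms(3) by (metis cong_def)
qed

text \<open>\<open>restr\<close> keeps the value 0 off the carrier that elements of
  \<open>IR\<close> have, so that fixed characters satisfy an equation of functions.\<close>

definition twist :: "nat \<Rightarrow> ('a \<Rightarrow> complex) \<Rightarrow> 'a \<Rightarrow> complex" where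
  "twist u \<chi> = restr X (\<lambda>g. \<chi> (g [^] u))"

lemma twist_twist: "twist u (twist v \<chi>) = twist (u * v) \<chi>"
  by (auto simp: twist_def restr_def fun_eq_iff nat_pow_pow)

lemma twist_one: "\<chi> \<in> IR X \<Longrightarrow> twist 1 \<chi> = \<chi>"
  by (auto simp: twist_def restr_def fun_eq_iff IR_outside)

context
  fixes N :: nat assumes N: "N > 0" "card (carrier X) dvd N"
begin

text \<open>The automorphism u raises the eigenvalues of g to the u-th power, exactly as passing
  from g to its u-th power does. The modulus may be any multiple of the group order, so that one
  modulus serves a group and its subgroups.\<close>

lemma IR_power_values:
  assumes \<chi>: "\<chi> \<in> IR X" and g: "g \<in> carrier X"
  shows "\<chi> g \<in> cyc N" "coprime u N \<Longrightarrow> gal N u (\<chi> g) = \<chi> (g [^] u)"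
proof -
  obtain n \<rho> where \<rho>: "is_irr_rep X n \<rho>" "\<chi> = restr X (\<lambda>g. mat_trace (\<rho> g))" using \<chi> by (auto simp: IR_def)
  have rep: "is_rep X n \<rho>" using \<rho>(1) by (simp add: is_irr_rep_def)
  obtain a where a: "\<And>j. mat_trace (\<rho> (g [^] (j::nat))) = (\<Sum>i<n. zeta N ^ (a i * j))"
    by (rule rep_power_trace[OF rep g N(1) pow_card_multiple[OF g N(2)]]) blast
  have \<chi>a: "\<chi> (g [^] j) = (\<Sum>i<n. zeta N ^ (a i * j))" for j :: nat
    using a[of j] g by (simp add: \<rho>(2) restr_carrier)
  have \<chi>g: "\<chi> g = (\<Sum>i<n. zeta N ^ a i)" using \<chi>a[of 1] g by simp
  show "\<chi> g \<in> cyc N" unfolding \<chi>g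
    by (intro csubring_sum csubfield_csubring csubfield_cyc N zeta_power_in_cyc)
  show "gal N u (\<chi> g) = \<chi> (g [^] u)" if u: "coprime u N"
    unfolding \<chi>g \<chi>a using gal_sum[OF N(1) u, of "{..<n}" "\<lambda>i. zeta N ^ a i"]
    by (simp add: zeta_power_in_cyc gal_zeta_power[OF N(1) u] mult.commute)
qed

lemma twist_gal:
  "\<chi> \<in> IR X \<Longrightarrow> g \<in> carrier X \<Longrightarrow> coprime u N \<Longrightarrow> twist u \<chi> g = gal N u (\<chi> g)"
  by (simp add: twist_def restr_carrier IR_power_values)

lemma gal_conv:
  assumes u: "coprime u N" and IR: "\<chi> \<in> IR X" "\<psi> \<in> IR X" and x: "x \<in> carrier X"
  shows "conv (twist u \<chi>) (twist u \<psi>) x = gal N u (conv \<chi> \<psi> x)"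
proof -
  have "conv (twist u \<chi>) (twist u \<psi>) x = (\<Sum>g\<in>carrier X. gal N u (\<chi> g * \<psi> (inv g \<otimes> x)))"
    unfolding conv_def using IR x u
    by (intro sum.cong refl) (simp add: twist_gal gal_mult[OF N(1) u] IR_power_values)
  also have "\<dots> = gal N u (conv \<chi> \<psi> x)"
    unfolding conv_def using IR x by (intro gal_sum[OF N(1) u, symmetric] csubring_mult csubfield_csubring csubfield_cyc N)
      (auto simp: IR_power_values)
  finally show ?thesis .
qed

text \<open>The Galois conjugates of the primitive central idempotents of the group algebra are central
  idempotents that remain pairwise orthogonal, hence sums over disjoint nonempty sets of primitive
  ones; counting shows that all these sets are singletons.\<close>

theorem twist_IR:
  assumes u: "coprime u N" and \<chi>0: "\<chi>0 \<in> IR X"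
  shows "twist u \<chi>0 \<in> IR X"
proof -
  define c where "c \<chi> \<psi> = ip (twist u \<chi>) \<psi>" for \<chi> \<psi>
  let ?G = "of_nat (card (carrier X)) :: complex"
  have G0: "?G \<noteq> 0" using card_pos by simp
  have deg_u: "twist u \<chi> \<one> = \<chi> \<one>" if "\<chi> \<in> IR X" for \<chi> by (simp add: twist_def restr_carrier)
  have ratdeg: "\<chi> \<one> \<in> \<rat>" if "\<chi> \<in> IR X" for \<chi> using IR_degree[OF that] by auto
  have cf: "class_fun (twist u \<chi>)" if \<chi>: "\<chi> \<in> IR X" for \<chi>
    using IR_class_fun[OF \<chi>] \<chi> u by (auto simp: class_fun_def twist_gal)
  have exp: "twist u \<chi> x = (\<Sum>\<psi>\<in>IR X. c \<chi> \<psi> * \<psi> x)" if "\<chi> \<in> IR X" "x \<in> carrier X" for \<chi> x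
    unfolding c_def using class_fun_expansion[OF cf[OF that(1)] that(2)] .
  have cc: "conv (twist u \<chi>) (twist u \<chi>') x = (\<Sum>\<psi>\<in>IR X. (c \<chi> \<psi> * c \<chi>' \<psi> * ?G / \<psi> \<one>) * \<psi> x)"
    if \<chi>: "\<chi> \<in> IR X" "\<chi>' \<in> IR X" and x: "x \<in> carrier X" for \<chi> \<chi>' x
  proof -
    have "conv (twist u \<chi>) (twist u \<chi>') x =
      (\<Sum>g\<in>carrier X. (\<Sum>\<phi>\<in>IR X. c \<chi> \<phi> * \<phi> g) * (\<Sum>\<psi>\<in>IR X. c \<chi>' \<psi> * \<psi> (inv g \<otimes> x)))"
      unfolding conv_def using \<chi> x by (intro sum.cong refl) (simp add: exp)
    also have "\<dots> = (\<Sum>g\<in>carrier X. \<Sum>\<phi>\<in>IR X. \<Sum>\<psi>\<in>IR X. (c \<chi> \<phi> * c \<chi>' \<psi>) * (\<phi> g * \<psi> (inv g \<otimes> x)))"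
      unfolding sum_product by (simp add: mult_ac)
    also have "\<dots> = (\<Sum>\<phi>\<in>IR X. \<Sum>g\<in>carrier X. \<Sum>\<psi>\<in>IR X. (c \<chi> \<phi> * c \<chi>' \<psi>) * (\<phi> g * \<psi> (inv g \<otimes> x)))"
      by (rule sum.swap)
    also have "\<dots> = (\<Sum>\<phi>\<in>IR X. \<Sum>\<psi>\<in>IR X. \<Sum>g\<in>carrier X. (c \<chi> \<phi> * c \<chi>' \<psi>) * (\<phi> g * \<psi> (inv g \<otimes> x)))"
      by (intro sum.cong refl) (rule sum.swap)
    also have "\<dots> = (\<Sum>\<phi>\<in>IR X. \<Sum>\<psi>\<in>IR X. (c \<chi> \<phi> * c \<chi>' \<psi>) * conv \<phi> \<psi> x)"
      by (simp add: conv_def sum_distrib_left)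
    also have "\<dots> = (\<Sum>\<phi>\<in>IR X. \<Sum>\<psi>\<in>IR X. if \<psi> = \<phi> then (c \<chi> \<phi> * c \<chi>' \<phi> * ?G / \<phi> \<one>) * \<phi> x else 0)"
      using x by (intro sum.cong refl) (auto simp: conv_IR_same conv_IR_diff)
    also have "\<dots> = (\<Sum>\<phi>\<in>IR X. (c \<chi> \<phi> * c \<chi>' \<phi> * ?G / \<phi> \<one>) * \<phi> x)" using finite_IR by simp
    finally show ?thesis .
  qed
  \<comment> \<open>Both sides are the coefficient of \<psi> in the convolution square of the
    twisted \<chi>; so each coefficient of the twisted character is 0 or
    \<psi>(1)/\<chi>(1).\<close>
  have same: "c \<chi> \<psi> * c \<chi> \<psi> * ?G / \<psi> \<one> = ?G / \<chi> \<one> * c \<chi> \<psi>" if \<chi>: "\<chi> \<in> IR X" and \<psi>: "\<psi> \<in> IR X" for \<chi> \<psi>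
  proof -
    have k: "?G / \<chi> \<one> \<in> \<rat>" using ratdeg[OF \<chi>] by (intro Rats_divide) auto
    have "conv (twist u \<chi>) (twist u \<chi>) x = (\<Sum>\<phi>\<in>IR X. (?G / \<chi> \<one> * c \<chi> \<phi>) * \<phi> x)" if x: "x \<in> carrier X" for x
    proof -
      have "conv (twist u \<chi>) (twist u \<chi>) x = gal N u (?G / \<chi> \<one> * \<chi> x)"
        using gal_conv[OF u \<chi> \<chi> x] conv_IR_same[OF \<chi> x] by simp
      also have "\<dots> = ?G / \<chi> \<one> * twist u \<chi> x"
        using k csubfield_Rats_subset[OF csubfield_cyc[OF N(1)]] IR_power_values(1)[OF \<chi> x]
        by (subst gal_mult[OF N(1) u]) (auto simp: gal_Rats[OF N(1) u] twist_gal[OF \<chi> x u])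
      finally show ?thesis unfolding exp[OF \<chi> x] by (simp add: sum_distrib_left mult.assoc)
    qed
    then have "ip (conv (twist u \<chi>) (twist u \<chi>)) \<psi> = ?G / \<chi> \<one> * c \<chi> \<psi>"
      by (rule ip_combination[OF \<psi>, where a = "\<lambda>\<phi>. ?G / \<chi> \<one> * c \<chi> \<phi>"])
    moreover have "ip (conv (twist u \<chi>) (twist u \<chi>)) \<psi> = c \<chi> \<psi> * c \<chi> \<psi> * ?G / \<psi> \<one>"
      by (rule ip_combination[OF \<psi>, where a = "\<lambda>\<phi>. c \<chi> \<phi> * c \<chi> \<phi> * ?G / \<phi> \<one>"]) (rule cc[OF \<chi> \<chi>])
    ultimately show ?thesis by simp
  qed
  have diff: "c \<chi> \<psi> * c \<chi>' \<psi> = 0" if \<chi>: "\<chi> \<in> IR X" "\<chi>' \<in> IR X" "\<chi> \<noteq> \<chi>'" and \<psi>: "\<psi> \<in> IR X" for \<chi> \<chi>' \<psi>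
  proof -
    have z: "conv (twist u \<chi>) (twist u \<chi>') x = (\<Sum>\<phi>\<in>IR X. 0 * \<phi> x)" if x: "x \<in> carrier X" for x
      using gal_conv[OF u \<chi>(1,2) x] conv_IR_diff[OF \<chi> x] gal_Rats[OF N(1) u, of 0] by simp
    then have "ip (conv (twist u \<chi>) (twist u \<chi>')) \<psi> = 0"
      by (rule ip_combination[OF \<psi>, where a = "\<lambda>_. 0"])
    moreover have "ip (conv (twist u \<chi>) (twist u \<chi>')) \<psi> = c \<chi> \<psi> * c \<chi>' \<psi> * ?G / \<psi> \<one>"
      by (rule ip_combination[OF \<psi>, where a = "\<lambda>\<phi>. c \<chi> \<phi> * c \<chi>' \<phi> * ?G / \<phi> \<one>"]) (rule cc[OF \<chi>(1,2)])
    ultimately show ?thesis using G0 IR_degree_nonzero[OF \<psi>] by simp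
  qed
  define S where "S \<chi> = {\<psi> \<in> IR X. c \<chi> \<psi> \<noteq> 0}" for \<chi>
  have finS: "finite (S \<chi>)" for \<chi> using finite_IR by (simp add: S_def)
  have S1: "card (S \<chi>) \<ge> 1" if \<chi>: "\<chi> \<in> IR X" for \<chi>
  proof -
    have "S \<chi> \<noteq> {}"
    proof
      assume "S \<chi> = {}"
      then have "twist u \<chi> \<one> = 0" unfolding exp[OF \<chi> one_closed] by (intro sum.neutral) (auto simp: S_def)
      then show False using deg_u[OF \<chi>] IR_degree_nonzero[OF \<chi>] by simp
    qed
    then show ?thesis using finS[of \<chi>] by (simp add: Suc_le_eq card_gt_0_iff)
  qed
  have "(\<Sum>\<chi>\<in>IR X. card (S \<chi>)) = card (\<Union>\<chi>\<in>IR X. S \<chi>)"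
    using diff finS by (intro card_UN_disjoint[symmetric] finite_IR) (auto simp: S_def)
  also have "\<dots> \<le> card (IR X)" by (intro card_mono finite_IR) (auto simp: S_def)
  finally have le: "(\<Sum>\<chi>\<in>IR X. card (S \<chi>)) \<le> card (IR X)" .
  have "card (S \<chi>0) = 1"
  proof (rule ccontr)
    assume "card (S \<chi>0) \<noteq> 1"
    then have "1 < card (S \<chi>0)" using S1[OF \<chi>0] by simp
    then have "(\<Sum>\<chi>\<in>IR X. 1) < (\<Sum>\<chi>\<in>IR X. card (S \<chi>))"
      using S1 \<chi>0 finite_IR by (intro sum_strict_mono_ex1) auto
    then show False using le by simp
  qed
  then obtain \<psi> where S\<psi>: "S \<chi>0 = {\<psi>}" by (auto simp: card_1_singleton_iff)
  then have \<psi>: "\<psi> \<in> IR X" "c \<chi>0 \<psi> \<noteq> 0" by (auto simp: S_def)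
  have tw: "twist u \<chi>0 x = c \<chi>0 \<psi> * \<psi> x" if x: "x \<in> carrier X" for x
  proof -
    have "twist u \<chi>0 x = (\<Sum>\<phi>\<in>IR X. if \<phi> = \<psi> then c \<chi>0 \<psi> * \<psi> x else 0)"
      unfolding exp[OF \<chi>0 x] using S\<psi> by (intro sum.cong refl) (auto simp: S_def)
    then show ?thesis using \<psi>(1) finite_IR by simp
  qed
  obtain a b where ab: "a > 0" "\<chi>0 \<one> = of_nat a" "b > 0" "\<psi> \<one> = of_nat b"
    using IR_degree[OF \<chi>0] IR_degree[OF \<psi>(1)] by blast
  \<comment> \<open>The coefficient is b/a by \<open>same\<close> and a/b by comparing values at the
    identity; so a = b and the coefficient is 1.\<close>
  have cba: "c \<chi>0 \<psi> = of_nat b / of_nat a" using same[OF \<chi>0 \<psi>(1)] \<psi>(2) G0 ab by (simp add: field_simps)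
  have a: "of_nat a = c \<chi>0 \<psi> * of_nat b" using tw[OF one_closed] deg_u[OF \<chi>0] ab by simp
  have b: "c \<chi>0 \<psi> * of_nat a = of_nat b" unfolding cba using ab(1) by simp
  have "of_nat (a * a) = of_nat a * (of_nat a :: complex)" by simp
  also have "\<dots> = of_nat a * (c \<chi>0 \<psi> * of_nat b)" by (rule arg_cong[OF a])
  also have "\<dots> = (c \<chi>0 \<psi> * of_nat a) * of_nat b" by (simp only: mult_ac)
  also have "\<dots> = of_nat (b * b)" unfolding b by simp
  finally have "of_nat (a * a) = (of_nat (b * b) :: complex)" .
  then have "a * a = b * b" by (simp only: of_nat_eq_iff)
  then have "a = b" by (metis power2_eq_square power2_eq_iff_nonneg zero_le)
  then have "c \<chi>0 \<psi> = 1" unfolding cba using ab(1) by simp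
  then have "twist u \<chi>0 = \<psi>" using tw IR_outside[OF \<psi>(1)] by (auto simp: fun_eq_iff twist_def restr_def)
  then show ?thesis using \<psi>(1) by simp
qed

lemma twist_cong: "[u = v] (mod N) \<Longrightarrow> twist u \<chi> = twist v \<chi>"
  using pow_cong_exponent[OF _ N(2), of _ u v] by (auto simp: twist_def restr_def fun_eq_iff)

lemma fixes_pointwise_iff_twist:
  assumes "\<chi> \<in> IR X"
  shows "fixes_pointwise N (\<chi> ` carrier X) u \<longleftrightarrow> coprime u N \<and> twist u \<chi> = \<chi>"
  using assms twist_gal[OF assms, of _ u] IR_outside[OF assms]
  by (auto simp: fixes_pointwise_def fun_eq_iff) (auto simp: twist_def restr_def)

end

end

section \<open>Clifford theory\<close>

locale clifford = fin_group X for X (structure) +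
  fixes N assumes normalN: "N \<lhd> X"
begin

abbreviation Y where "Y \<equiv> X\<lparr>carrier := N\<rparr>"

lemma subgroupN: "subgroup N X"
  using normalN by (simp add: normal_imp_subgroup)

lemma N_carrier: "g \<in> N \<Longrightarrow> g \<in> carrier X"
  using subgroupN by (rule subgroup.mem_carrier)

lemma N_conj: "x \<in> carrier X \<Longrightarrow> g \<in> N \<Longrightarrow> inv x \<otimes> g \<otimes> x \<in> N"
  using normalN by (rule normal.inv_op_closed1)

lemma N_conj_iff: "x \<in> carrier X \<Longrightarrow> g \<in> carrier X \<Longrightarrow> inv x \<otimes> g \<otimes> x \<in> N \<longleftrightarrow> g \<in> N"
proof
  assume x: "x \<in> carrier X" and g: "g \<in> carrier X" and "inv x \<otimes> g \<otimes> x \<in> N"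
  then have "x \<otimes> (inv x \<otimes> g \<otimes> x) \<otimes> inv x \<in> N" using normalN by (intro normal.inv_op_closed2)
  moreover have "x \<otimes> (inv x \<otimes> g \<otimes> x) \<otimes> inv x = g"
    using x g by (simp add: m_assoc) (simp add: m_assoc[symmetric])
  ultimately show "g \<in> N" by simp
qed (rule N_conj)

sublocale Y: fin_group Y
proof -
  interpret Y: group Y by (rule subgroup.subgroup_is_group[OF subgroupN group_axioms])
  show "fin_group Y"
    by unfold_locales (use finite_subset[OF _ fin, of N] N_carrier in auto)
qed

lemma Y_inv: "g \<in> N \<Longrightarrow> inv\<^bsub>Y\<^esub> g = inv g"
  by (rule m_inv_consistent[OF subgroupN])

lemma Y_pow: "g [^]\<^bsub>Y\<^esub> (k :: nat) = g [^] k"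
  by (simp add: nat_pow_def)

lemma card_N_pos: "card N > 0"
  using Y.card_pos by simp

section \<open>Conjugate characters and multiplicities of restrictions\<close>

text \<open>The inverse stands on the left so that this is a left action, see
  \<open>conj_conj\<close>.\<close>

definition conj :: "'a \<Rightarrow> ('a \<Rightarrow> complex) \<Rightarrow> 'a \<Rightarrow> complex" where
  "conj x \<theta> = restr Y (\<lambda>g. \<theta> (inv x \<otimes> g \<otimes> x))"

lemma conj_IR:
  assumes x: "x \<in> carrier X" and \<theta>: "\<theta> \<in> IR Y" shows "conj x \<theta> \<in> IR Y"
proof -
  obtain n \<rho> where \<rho>: "is_irr_rep Y n \<rho>" "\<theta> = restr Y (\<lambda>g. mat_trace (\<rho> g))" using \<theta> by (auto simp: IR_def)
  define \<sigma> where "\<sigma> g = \<rho> (inv x \<otimes> g \<otimes> x)" for g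
  have hom: "inv x \<otimes> (g \<otimes> h) \<otimes> x = (inv x \<otimes> g \<otimes> x) \<otimes> (inv x \<otimes> h \<otimes> x)" if "g \<in> N" "h \<in> N" for g h
  proof -
    have "(inv x \<otimes> g \<otimes> x) \<otimes> (inv x \<otimes> h \<otimes> x) = inv x \<otimes> g \<otimes> (x \<otimes> inv x) \<otimes> h \<otimes> x"
      using that[THEN N_carrier] x by (simp only: m_assoc m_closed inv_closed)
    then show ?thesis using that[THEN N_carrier] x by (simp add: m_assoc)
  qed
  have "is_rep Y n \<sigma>"
    using \<rho>(1) x N_conj[OF x] by (auto simp: is_irr_rep_def is_rep_def \<sigma>_def hom)
  moreover have "\<rho> h = \<sigma> (x \<otimes> h \<otimes> inv x)" "x \<otimes> h \<otimes> inv x \<in> N" if h: "h \<in> N" for h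
  proof -
    show "x \<otimes> h \<otimes> inv x \<in> N" by (rule normal.inv_op_closed2[OF normalN x h])
    have "inv x \<otimes> (x \<otimes> h \<otimes> inv x) \<otimes> x = (inv x \<otimes> x) \<otimes> h \<otimes> (inv x \<otimes> x)"
      using N_carrier[OF h] x by (simp only: m_assoc m_closed inv_closed)
    then show "\<rho> h = \<sigma> (x \<otimes> h \<otimes> inv x)" using N_carrier[OF h] x by (simp add: \<sigma>_def)
  qed
  then have "(\<forall>g\<in>carrier Y. \<forall>w\<in>W. \<sigma> g *\<^sub>v w \<in> W) \<Longrightarrow> (\<forall>g\<in>carrier Y. \<forall>w\<in>W. \<rho> g *\<^sub>v w \<in> W)" for W by simp
  ultimately have "is_irr_rep Y n \<sigma>" using \<rho>(1) unfolding is_irr_rep_def by blast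
  moreover have "conj x \<theta> = restr Y (\<lambda>g. mat_trace (\<sigma> g))"
    using N_conj[OF x] by (auto simp: conj_def \<rho>(2) restr_def \<sigma>_def fun_eq_iff)
  ultimately show ?thesis by (auto simp: IR_def)
qed

lemma conj_conj:
  assumes "x \<in> carrier X" "y \<in> carrier X" shows "conj x (conj y \<theta>) = conj (x \<otimes> y) \<theta>"
proof
  fix g show "conj x (conj y \<theta>) g = conj (x \<otimes> y) \<theta> g"
  proof (cases "g \<in> N")
    case True
    then have "inv y \<otimes> (inv x \<otimes> g \<otimes> x) \<otimes> y = inv (x \<otimes> y) \<otimes> g \<otimes> (x \<otimes> y)"
      using assms N_carrier by (simp add: m_assoc inv_mult_group)
    then show ?thesis using N_conj[OF assms(1) True] True by (simp add: conj_def restr_def)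
  qed (simp add: conj_def restr_def)
qed

lemma conj_one: "\<theta> \<in> IR Y \<Longrightarrow> conj \<one> \<theta> = \<theta>"
  using IR_outside[of \<theta> Y] N_carrier by (auto simp: conj_def restr_def fun_eq_iff)

lemma conj_degree: "x \<in> carrier X \<Longrightarrow> conj x \<theta> \<one> = \<theta> \<one>"
  using Y.one_closed by (simp add: conj_def restr_def)

lemma Y_ip: "Y.ip f h = (\<Sum>g\<in>N. f g * h (inv g)) / of_nat (card N)"
  unfolding Y.ip_def using Y_inv by simp

text \<open>A natural number, since divisibility by p is the point of it; \<open>ip_m\<close> shows
  that for irreducible characters the choice is the inner product itself.\<close>

definition m :: "('a \<Rightarrow> complex) \<Rightarrow> ('a \<Rightarrow> complex) \<Rightarrow> nat" where
  "m \<chi> \<theta> = (SOME k. Y.ip \<chi> \<theta> = of_nat k)"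

lemma ip_m:
  assumes \<chi>: "\<chi> \<in> IR X" and \<theta>: "\<theta> \<in> IR Y" shows "Y.ip \<chi> \<theta> = of_nat (m \<chi> \<theta>)"
proof -
  obtain n \<rho> where \<rho>: "is_irr_rep X n \<rho>" "\<chi> = restr X (\<lambda>g. mat_trace (\<rho> g))" using \<chi> by (auto simp: IR_def)
  have "is_rep Y n \<rho>" using \<rho>(1) N_carrier by (auto simp: is_irr_rep_def is_rep_def)
  from Y.rep_character_multiplicity[OF this \<theta>] obtain k where "Y.ip (\<lambda>g. mat_trace (\<rho> g)) \<theta> = of_nat k" by blast
  moreover have "Y.ip \<chi> \<theta> = Y.ip (\<lambda>g. mat_trace (\<rho> g)) \<theta>"
    by (rule Y.ip_cong) (use N_carrier \<rho>(2) in \<open>auto simp: restr_def\<close>)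
  ultimately have "\<exists>k::nat. Y.ip \<chi> \<theta> = of_nat k" by metis
  then show ?thesis unfolding m_def by (rule someI_ex)
qed

lemma restriction_expansion:
  assumes \<chi>: "\<chi> \<in> IR X" and g: "g \<in> N" shows "\<chi> g = (\<Sum>\<theta>\<in>IR Y. of_nat (m \<chi> \<theta>) * \<theta> g)"
proof -
  have "Y.class_fun \<chi>" using IR_class_fun[OF \<chi>] N_carrier by (simp add: class_fun_def Y.class_fun_def)
  from Y.class_fun_expansion[OF this, of g] g show ?thesis by (simp add: ip_m[OF \<chi>])
qed

lemma conj_ip:
  assumes x: "x \<in> carrier X" and \<chi>: "\<chi> \<in> IR X" shows "Y.ip (conj x \<theta>) \<chi> = Y.ip \<theta> \<chi>"
proof -
  have "(\<Sum>g\<in>N. conj x \<theta> g * \<chi> (inv g)) = (\<Sum>g\<in>N. \<theta> g * \<chi> (inv g))"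
  proof (rule sum.reindex_bij_witness[of _ "\<lambda>g. x \<otimes> g \<otimes> inv x" "\<lambda>g. inv x \<otimes> g \<otimes> x"])
    fix g assume g: "g \<in> N"
    note gc = N_carrier[OF g]
    show "x \<otimes> (inv x \<otimes> g \<otimes> x) \<otimes> inv x = g" using x gc by (simp add: m_assoc) (simp add: m_assoc[symmetric])
    show "inv x \<otimes> (x \<otimes> g \<otimes> inv x) \<otimes> x = g" using x gc by (simp add: m_assoc) (simp add: m_assoc[symmetric])
    show "inv x \<otimes> g \<otimes> x \<in> N" by (rule N_conj[OF x g])
    show "x \<otimes> g \<otimes> inv x \<in> N" by (rule normal.inv_op_closed2[OF normalN x g])
    have "inv (inv x \<otimes> g \<otimes> x) = inv x \<otimes> inv g \<otimes> x" using x gc by (simp add: inv_mult_group m_assoc)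
    then have "\<chi> (inv (inv x \<otimes> g \<otimes> x)) = \<chi> (inv g)"
      using class_fun_conj[OF IR_class_fun[OF \<chi>] inv_closed[OF gc] x] by simp
    then show "\<theta> (inv x \<otimes> g \<otimes> x) * \<chi> (inv (inv x \<otimes> g \<otimes> x)) = conj x \<theta> g * \<chi> (inv g)"
      using g by (simp add: conj_def restr_def)
  qed
  then show ?thesis by (simp add: Y_ip)
qed

lemma m_conj:
  assumes "x \<in> carrier X" "\<chi> \<in> IR X" "\<theta> \<in> IR Y" shows "m \<chi> (conj x \<theta>) = m \<chi> \<theta>"
proof -
  have "of_nat (m \<chi> (conj x \<theta>)) = (of_nat (m \<chi> \<theta>) :: complex)"
    using conj_ip[OF assms(1,2), of \<theta>] assms by (simp add: Y.ip_sym[of _ \<chi>] ip_m conj_IR)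
  then show ?thesis by (simp only: of_nat_eq_iff)
qed

section \<open>Induced characters and Clifford's theorem\<close>

text \<open>The induced character in its usual form, because elements of \<open>IR Y\<close> vanish
  off N; each coset contributes |N| equal summands.\<close>

definition ind :: "('a \<Rightarrow> complex) \<Rightarrow> 'a \<Rightarrow> complex" where
  "ind \<theta> g = (\<Sum>x\<in>carrier X. \<theta> (inv x \<otimes> g \<otimes> x)) / of_nat (card N)"

lemma class_fun_ind: "class_fun (ind \<theta>)"
  unfolding class_fun_def
proof (intro ballI)
  fix g h assume g: "g \<in> carrier X" and h: "h \<in> carrier X"
  have "(\<Sum>x\<in>carrier X. \<theta> (inv x \<otimes> (g \<otimes> h) \<otimes> x)) = (\<Sum>x\<in>carrier X. \<theta> (inv (g \<otimes> x) \<otimes> (g \<otimes> h) \<otimes> (g \<otimes> x)))"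
    by (rule sum_left_translate[OF g, symmetric])
  also have "\<dots> = (\<Sum>x\<in>carrier X. \<theta> (inv x \<otimes> (h \<otimes> g) \<otimes> x))"
  proof (intro sum.cong refl)
    fix x assume x: "x \<in> carrier X"
    have "inv (g \<otimes> x) \<otimes> (g \<otimes> h) \<otimes> (g \<otimes> x) = inv x \<otimes> (inv g \<otimes> g) \<otimes> (h \<otimes> g) \<otimes> x"
      using g h x by (simp only: inv_mult_group m_assoc m_closed inv_closed)
    then show "\<theta> (inv (g \<otimes> x) \<otimes> (g \<otimes> h) \<otimes> (g \<otimes> x)) = \<theta> (inv x \<otimes> (h \<otimes> g) \<otimes> x)"
      using g h x by simp
  qed
  finally show "ind \<theta> (g \<otimes> h) = ind \<theta> (h \<otimes> g)" by (simp add: ind_def)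
qed

lemma frobenius_reciprocity:
  assumes \<theta>: "\<theta> \<in> IR Y" and \<chi>: "\<chi> \<in> IR X" shows "ip (ind \<theta>) \<chi> = Y.ip \<theta> \<chi>"
proof -
  let ?n = "of_nat (card N) :: complex" and ?G = "of_nat (card (carrier X)) :: complex"
  have "(\<Sum>g\<in>carrier X. ind \<theta> g * \<chi> (inv g)) =
     (\<Sum>g\<in>carrier X. \<Sum>x\<in>carrier X. \<theta> (inv x \<otimes> g \<otimes> x) * \<chi> (inv g)) / ?n"
    unfolding ind_def by (simp add: sum_distrib_right sum_divide_distrib)
  also have "(\<Sum>g\<in>carrier X. \<Sum>x\<in>carrier X. \<theta> (inv x \<otimes> g \<otimes> x) * \<chi> (inv g)) =
    (\<Sum>x\<in>carrier X. \<Sum>g\<in>carrier X. \<theta> (inv x \<otimes> g \<otimes> x) * \<chi> (inv g))" by (rule sum.swap)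
  also have "\<dots> = (\<Sum>x\<in>carrier X. ?n * Y.ip \<theta> \<chi>)"
  proof (intro sum.cong refl)
    fix x assume x: "x \<in> carrier X"
    have "(\<Sum>g\<in>carrier X. \<theta> (inv x \<otimes> g \<otimes> x) * \<chi> (inv g)) = (\<Sum>g\<in>N. \<theta> (inv x \<otimes> g \<otimes> x) * \<chi> (inv g))"
    proof (rule sum.mono_neutral_right[OF fin])
      show "N \<subseteq> carrier X" using N_carrier by auto
      show "\<forall>g\<in>carrier X - N. \<theta> (inv x \<otimes> g \<otimes> x) * \<chi> (inv g) = 0"
        using IR_outside[OF \<theta>] N_conj_iff[OF x] by auto
    qed
    also have "\<dots> = (\<Sum>g\<in>N. conj x \<theta> g * \<chi> (inv g))" by (intro sum.cong) (auto simp: conj_def restr_def)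
    also have "\<dots> = ?n * Y.ip (conj x \<theta>) \<chi>" using card_N_pos by (simp add: Y_ip)
    finally show "(\<Sum>g\<in>carrier X. \<theta> (inv x \<otimes> g \<otimes> x) * \<chi> (inv g)) = ?n * Y.ip \<theta> \<chi>"
      by (simp add: conj_ip[OF x \<chi>])
  qed
  finally have "(\<Sum>g\<in>carrier X. ind \<theta> g * \<chi> (inv g)) = ?G * Y.ip \<theta> \<chi>" using card_N_pos by simp
  then show ?thesis unfolding ip_def using card_pos by simp
qed

lemma ind_expansion:
  assumes \<theta>: "\<theta> \<in> IR Y" and g: "g \<in> carrier X" shows "ind \<theta> g = (\<Sum>\<chi>\<in>IR X. of_nat (m \<chi> \<theta>) * \<chi> g)"
  unfolding class_fun_expansion[OF class_fun_ind g]
  by (intro sum.cong refl) (simp add: frobenius_reciprocity[OF \<theta>] Y.ip_sym[of \<theta>] ip_m \<theta>)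

text \<open>The inner product of \<theta>' with the restriction of the character induced from
  \<theta> is computed twice: by Frobenius reciprocity over the characters of X, and from the
  defining sum, which on N is a sum of conjugates of \<theta>.\<close>

theorem clifford_count:
  assumes \<theta>: "\<theta> \<in> IR Y" "\<theta>' \<in> IR Y"
  shows "card N * (\<Sum>\<chi>\<in>IR X. m \<chi> \<theta> * m \<chi> \<theta>') = card {x \<in> carrier X. conj x \<theta> = \<theta>'}"
proof -
  let ?n = "of_nat (card N) :: complex"
  have "Y.ip (ind \<theta>) \<theta>' = Y.ip (\<lambda>g. \<Sum>\<chi>\<in>IR X. of_nat (m \<chi> \<theta>) * \<chi> g) \<theta>'"
    by (rule Y.ip_cong) (use N_carrier ind_expansion[OF \<theta>(1)] in auto)
  also have "\<dots> = (\<Sum>\<chi>\<in>IR X. of_nat (m \<chi> \<theta>) * Y.ip \<chi> \<theta>')" by (rule Y.ip_sum_left)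
  also have "\<dots> = of_nat (\<Sum>\<chi>\<in>IR X. m \<chi> \<theta> * m \<chi> \<theta>')" using ip_m[OF _ \<theta>(2)] by simp
  finally have 1: "Y.ip (ind \<theta>) \<theta>' = of_nat (\<Sum>\<chi>\<in>IR X. m \<chi> \<theta> * m \<chi> \<theta>')" .
  have "Y.ip (ind \<theta>) \<theta>' = Y.ip (\<lambda>g. \<Sum>x\<in>carrier X. (1 / ?n) * conj x \<theta> g) \<theta>'"
    by (rule Y.ip_cong) (auto simp: ind_def conj_def restr_def sum_divide_distrib)
  also have "\<dots> = (\<Sum>x\<in>carrier X. (1 / ?n) * Y.ip (conj x \<theta>) \<theta>')" by (rule Y.ip_sum_left)
  also have "\<dots> = (\<Sum>x\<in>carrier X. (1 / ?n) * (if conj x \<theta> = \<theta>' then 1 else 0))"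
    by (intro sum.cong refl) (simp add: Y.ip_IR conj_IR \<theta>)
  also have "\<dots> = (1 / ?n) * (\<Sum>x\<in>carrier X. if conj x \<theta> = \<theta>' then 1 else 0)" by (rule sum_distrib_left[symmetric])
  also have "(\<Sum>x\<in>carrier X. if conj x \<theta> = \<theta>' then 1 else (0 :: complex)) = of_nat (card {x \<in> carrier X. conj x \<theta> = \<theta>'})"
    using fin by (simp add: sum.If_cases Int_def)
  finally have "?n * Y.ip (ind \<theta>) \<theta>' = of_nat (card {x \<in> carrier X. conj x \<theta> = \<theta>'})" using card_N_pos by simp
  then have "of_nat (card N * (\<Sum>\<chi>\<in>IR X. m \<chi> \<theta> * m \<chi> \<theta>')) = (of_nat (card {x \<in> carrier X. conj x \<theta> = \<theta>'}) :: complex)"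
    unfolding 1 by (simp only: of_nat_mult)
  then show ?thesis by (simp only: of_nat_eq_iff)
qed

definition orbit :: "('a \<Rightarrow> complex) \<Rightarrow> ('a \<Rightarrow> complex) set" where
  "orbit \<theta> = (\<lambda>x. conj x \<theta>) ` carrier X"

text \<open>If both \<theta> and \<theta>' lie below \<chi>, then \<chi> makes a positive
  contribution to \<open>clifford_count\<close>, so some element conjugates \<theta> into
  \<theta>'.\<close>

lemma constituents_orbit:
  assumes \<chi>: "\<chi> \<in> IR X" and \<theta>: "\<theta> \<in> IR Y" and m: "m \<chi> \<theta> \<noteq> 0"
  shows "{\<theta>' \<in> IR Y. m \<chi> \<theta>' \<noteq> 0} = orbit \<theta>"
proof (intro equalityI subsetI)
  fix \<theta>' assume "\<theta>' \<in> {\<theta>' \<in> IR Y. m \<chi> \<theta>' \<noteq> 0}"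
  then have \<theta>': "\<theta>' \<in> IR Y" "m \<chi> \<theta>' \<noteq> 0" by auto
  have "0 < m \<chi> \<theta> * m \<chi> \<theta>'" using m \<theta>' by simp
  also have "\<dots> \<le> (\<Sum>\<chi>\<in>IR X. m \<chi> \<theta> * m \<chi> \<theta>')" using \<chi> finite_IR by (intro member_le_sum) auto
  finally have "card {x \<in> carrier X. conj x \<theta> = \<theta>'} > 0"
    unfolding clifford_count[OF \<theta> \<theta>'(1), symmetric] using card_N_pos by simp
  then show "\<theta>' \<in> orbit \<theta>" by (auto simp: orbit_def card_gt_0_iff)
next
  fix \<theta>' assume "\<theta>' \<in> orbit \<theta>"
  then show "\<theta>' \<in> {\<theta>' \<in> IR Y. m \<chi> \<theta>' \<noteq> 0}" using m_conj[OF _ \<chi> \<theta>] m conj_IR[OF _ \<theta>] by (auto simp: orbit_def)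
qed

lemma finite_orbit: "finite (orbit \<theta>)"
  using fin by (simp add: orbit_def)

text \<open>For \<theta>' = \<theta> the number in \<open>clifford_count\<close> is the order of the
  inertia group; multiplied by the length of the orbit it is the order of X.\<close>

lemma orbit_card:
  assumes \<theta>: "\<theta> \<in> IR Y"
  shows "card (orbit \<theta>) * (\<Sum>\<chi>\<in>IR X. m \<chi> \<theta> * m \<chi> \<theta>) = card (rcosets N)"
proof -
  let ?F = "\<lambda>\<theta>'. {x \<in> carrier X. conj x \<theta> = \<theta>'}"
  have fib: "card (?F \<theta>') = card (?F \<theta>)" if \<theta>': "\<theta>' \<in> orbit \<theta>" for \<theta>'
  proof -
    obtain y where y: "y \<in> carrier X" "\<theta>' = conj y \<theta>" using \<theta>' by (auto simp: orbit_def)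
    have "bij_betw (\<lambda>x. y \<otimes> x) (?F \<theta>) (?F \<theta>')"
    proof (rule bij_betw_byWitness[of _ "\<lambda>x. inv y \<otimes> x"])
      show "\<forall>x\<in>?F \<theta>. inv y \<otimes> (y \<otimes> x) = x" "\<forall>x\<in>?F \<theta>'. y \<otimes> (inv y \<otimes> x) = x"
        using y(1) by (auto simp: m_assoc[symmetric])
      show "(\<lambda>x. y \<otimes> x) ` ?F \<theta> \<subseteq> ?F \<theta>'" using y by (auto simp: conj_conj[symmetric])
      show "(\<lambda>x. inv y \<otimes> x) ` ?F \<theta>' \<subseteq> ?F \<theta>"
      proof safe
        fix x assume x: "x \<in> carrier X" "\<theta>' = conj x \<theta>"
        then show "inv y \<otimes> x \<in> carrier X" using y by simp
        have "conj (inv y \<otimes> x) \<theta> = conj (inv y) (conj y \<theta>)" using x y by (simp add: conj_conj[symmetric])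
        also have "\<dots> = \<theta>" using y \<theta> by (simp add: conj_conj conj_one)
        finally show "conj (inv y \<otimes> x) \<theta> = \<theta>" .
      qed
    qed
    then show ?thesis by (simp add: bij_betw_same_card)
  qed
  have "card (carrier X) = card (\<Union>\<theta>'\<in>orbit \<theta>. ?F \<theta>')"
    by (intro arg_cong[of _ _ card]) (auto simp: orbit_def)
  also have "\<dots> = (\<Sum>\<theta>'\<in>orbit \<theta>. card (?F \<theta>'))"
    using fin by (intro card_UN_disjoint finite_orbit) auto
  also have "\<dots> = card (orbit \<theta>) * card (?F \<theta>)" using fib by simp
  finally have "card (carrier X) = card N * (card (orbit \<theta>) * (\<Sum>\<chi>\<in>IR X. m \<chi> \<theta> * m \<chi> \<theta>))"
    unfolding clifford_count[OF \<theta> \<theta>, symmetric] by (simp add: mult_ac)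
  moreover have "card (carrier X) = card N * card (rcosets N)"
    using lagrange[OF subgroupN] by (simp add: Coset.order_def mult.commute)
  ultimately show ?thesis using card_N_pos by simp
qed

lemma degree_restriction:
  assumes \<chi>: "\<chi> \<in> IR X" and \<theta>: "\<theta> \<in> IR Y" and m: "m \<chi> \<theta> \<noteq> 0"
  shows "\<chi> \<one> = of_nat (m \<chi> \<theta> * card (orbit \<theta>)) * \<theta> \<one>"
proof -
  have "\<chi> \<one> = (\<Sum>\<theta>'\<in>IR Y. of_nat (m \<chi> \<theta>') * \<theta>' \<one>)"
    using restriction_expansion[OF \<chi>, of \<one>] Y.one_closed by simp
  also have "\<dots> = (\<Sum>\<theta>'\<in>orbit \<theta>. of_nat (m \<chi> \<theta>') * \<theta>' \<one>)"
    unfolding constituents_orbit[OF \<chi> \<theta> m, symmetric] using Y.finite_IR by (intro sum.mono_neutral_right) auto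
  also have "\<dots> = (\<Sum>\<theta>'\<in>orbit \<theta>. of_nat (m \<chi> \<theta>) * \<theta> \<one>)"
    by (intro sum.cong refl) (auto simp: orbit_def m_conj[OF _ \<chi> \<theta>] conj_degree)
  finally show ?thesis by simp
qed

lemma exists_below:
  assumes \<chi>: "\<chi> \<in> IR X" shows "\<exists>\<theta>\<in>IR Y. m \<chi> \<theta> \<noteq> 0"
proof (rule ccontr)
  assume "\<not> ?thesis"
  then have "\<chi> \<one> = 0" using restriction_expansion[OF \<chi>, of \<one>] Y.one_closed by simp
  then show False using IR_degree_nonzero[OF \<chi>] by simp
qed

lemma conj_pow:
  assumes "x \<in> carrier X" "g \<in> carrier X" shows "(inv x \<otimes> g \<otimes> x) [^] (k::nat) = inv x \<otimes> g [^] k \<otimes> x"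
proof (induction k)
  case (Suc k)
  have "inv x \<otimes> g [^] k \<otimes> x \<otimes> (inv x \<otimes> g \<otimes> x) = inv x \<otimes> g [^] k \<otimes> (x \<otimes> inv x) \<otimes> g \<otimes> x"
    using assms by (simp only: m_assoc m_closed inv_closed nat_pow_closed)
  then show ?case using Suc assms by (simp add: m_assoc)
qed (use assms in simp)

lemma conj_twist:
  assumes "x \<in> carrier X" shows "conj x (Y.twist u \<theta>) = Y.twist u (conj x \<theta>)"
proof
  fix g show "conj x (Y.twist u \<theta>) g = Y.twist u (conj x \<theta>) g"
  proof (cases "g \<in> N")
    case True
    have "g [^] u \<in> N" using Y.nat_pow_closed[of g u] True by (simp add: Y_pow)
    then show ?thesis using True N_conj[OF assms True] conj_pow[OF assms N_carrier[OF True], of u]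
      by (simp add: conj_def Y.twist_def restr_def Y_pow)
  qed (simp add: conj_def Y.twist_def restr_def)
qed

section \<open>Multiplicities under the Galois action\<close>

context
  fixes M :: nat assumes M: "M > 0" "card (carrier X) dvd M"
begin

lemma card_N_dvd: "card (carrier Y) dvd M"
proof -
  have "card N dvd card (carrier X)"
    using lagrange[OF subgroupN] by (metis Coset.order_def dvd_triv_right)
  then show ?thesis using M(2) dvd_trans by auto
qed

text \<open>Twisting both characters applies the automorphism to the whole inner product, which is a
  natural number and therefore fixed.\<close>

lemma m_twist:
  assumes u: "coprime u M" and \<chi>: "\<chi> \<in> IR X" and \<theta>: "\<theta> \<in> IR Y"
  shows "m (twist u \<chi>) (Y.twist u \<theta>) = m \<chi> \<theta>"
proof -
  note C = csubfield_csubring[OF csubfield_cyc[OF M(1)]]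
  note Yv = Y.IR_power_values[OF M(1) card_N_dvd \<theta>]
  note Xv = IR_power_values[OF M \<chi>]
  have inN: "inv g \<in> N" if "g \<in> N" for g using Y.inv_closed[of g] Y_inv[OF that] that by simp
  have "(\<Sum>g\<in>N. twist u \<chi> g * Y.twist u \<theta> (inv g)) = (\<Sum>g\<in>N. gal M u (\<chi> g * \<theta> (inv g)))"
  proof (intro sum.cong refl)
    fix g assume g: "g \<in> N"
    show "twist u \<chi> g * Y.twist u \<theta> (inv g) = gal M u (\<chi> g * \<theta> (inv g))"
      using g inN[OF g] N_carrier[OF g] u Yv Xv
      by (simp add: gal_mult[OF M(1) u] twist_gal[OF M \<chi>] Y.twist_gal[OF M(1) card_N_dvd \<theta>])
  qed
  also have "\<dots> = gal M u (\<Sum>g\<in>N. \<chi> g * \<theta> (inv g))"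
    using N_carrier inN Xv Yv by (intro gal_sum[OF M(1) u, symmetric] csubring_mult[OF C]) auto
  also have "(\<Sum>g\<in>N. \<chi> g * \<theta> (inv g)) = of_nat (card N * m \<chi> \<theta>)"
    using ip_m[OF \<chi> \<theta>] card_N_pos by (simp add: Y_ip field_simps)
  also have "gal M u \<dots> = of_nat (card N * m \<chi> \<theta>)" by (rule gal_Rats[OF M(1) u]) simp
  finally have "Y.ip (twist u \<chi>) (Y.twist u \<theta>) = of_nat (m \<chi> \<theta>)" using card_N_pos by (simp add: Y_ip)
  moreover have "Y.ip (twist u \<chi>) (Y.twist u \<theta>) = of_nat (m (twist u \<chi>) (Y.twist u \<theta>))"
    by (rule ip_m[OF twist_IR[OF M u \<chi>] Y.twist_IR[OF M(1) card_N_dvd u \<theta>]])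
  ultimately show ?thesis by simp
qed

end

end

section \<open>Fixed points of commuting maps of prime power order\<close>

lemma funpow_fix_mult: "(f ^^ d) s = s \<Longrightarrow> (f ^^ (d * a)) s = s"
  by (induction a) (simp_all add: funpow_add)

lemma funpow_fix_coprime:
  assumes p: "coprime d p" "d > 0" and fd: "(f ^^ d) s = s" and fp: "(f ^^ p) s = s"
  shows "f s = s"
proof -
  obtain a b where ab: "d * a = p * b + 1" using bezout_nat[of d p] p by auto
  have "s = (f ^^ (d * a)) s" using funpow_fix_mult[OF fd] by simp
  also have "\<dots> = f ((f ^^ (p * b)) s)" unfolding ab by simp
  finally show ?thesis using funpow_fix_mult[OF fp, of b] by simp
qed

text \<open>Every orbit of h has exactly p points, since a shorter period, being prime to p, would
  give a fixed point. The induction removes one orbit, on which w is constant.\<close>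

lemma free_prime_period_sum:
  fixes w :: "'b \<Rightarrow> nat"
  assumes p: "prime p" and T: "finite T" and hT: "\<And>t. t \<in> T \<Longrightarrow> h t \<in> T"
    and hp: "\<And>t. t \<in> T \<Longrightarrow> (h ^^ p) t = t" and nofix: "\<And>t. t \<in> T \<Longrightarrow> h t \<noteq> t"
    and w: "\<And>t. t \<in> T \<Longrightarrow> w (h t) = w t"
  shows "p dvd sum w T"
  using T hT hp nofix w
proof (induction T rule: finite_psubset_induct)
  case (psubset T)
  show ?case
  proof (cases "T = {}")
    case False
    then obtain s where s: "s \<in> T" by auto
    have p0: "p > 0" using p prime_gt_0_nat by blast
    have hs: "(h ^^ i) s \<in> T" for i by (induction i) (auto simp: s psubset.prems(1))
    have ws: "w ((h ^^ i) s) = w s" for i by (induction i) (auto simp: hs psubset.prems(4))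
    define Orb where "Orb = (\<lambda>i. (h ^^ i) s) ` {..<p}"
    have neq: "(h ^^ i) s \<noteq> (h ^^ j) s" if ij: "i < j" "j < p" for i j
    proof
      assume eq: "(h ^^ i) s = (h ^^ j) s"
      have "(h ^^ p) s = (h ^^ (p - i + i)) s" using ij by simp
      also have "\<dots> = (h ^^ (p - i)) ((h ^^ i) s)" by (simp only: funpow_add comp_apply)
      also have "\<dots> = (h ^^ (p - i)) ((h ^^ j) s)" by (simp only: eq)
      also have "\<dots> = (h ^^ (p - i + j)) s" by (simp only: funpow_add comp_apply)
      also have "p - i + j = (j - i) + p" using ij by simp
      also have "(h ^^ ((j - i) + p)) s = (h ^^ (j - i)) ((h ^^ p) s)" by (simp only: funpow_add comp_apply)
      finally have "s = (h ^^ (j - i)) s" unfolding psubset.prems(2)[OF s] .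
      moreover have "coprime (j - i) p" 
      proof -
        have "\<not> p dvd j - i" using ij by (auto dest!: dvd_imp_le)
        then show ?thesis using prime_imp_coprime[OF p] coprime_commute by blast
      qed
      ultimately have "h s = s" using funpow_fix_coprime[of "j - i" p h s] ij psubset.prems(2)[OF s] by simp
      then show False using psubset.prems(3)[OF s] by simp
    qed
    have inj: "inj_on (\<lambda>i. (h ^^ i) s) {..<p}"
      
    proof (rule inj_onI)
      fix i j assume "i \<in> {..<p}" "j \<in> {..<p}" "(h ^^ i) s = (h ^^ j) s"
      then show "i = j" using neq[of i j] neq[of j i] by (cases i j rule: linorder_cases) auto
    qed
    have sumO: "sum w Orb = p * w s" unfolding Orb_def by (subst sum.reindex[OF inj]) (simp add: ws)
    have OT: "Orb \<subseteq> T" using hs by (auto simp: Orb_def)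
    have "s \<in> Orb" unfolding Orb_def using p0 by (intro image_eqI[of _ _ 0]) auto
    \<comment> \<open>Points outside the orbit must not be mapped into it: on \<open>T\<close> the
      map h is inverted by its (p - 1)-st power.\<close>
    have bk: "t \<in> Orb" if t: "t \<in> T" "h t \<in> Orb" for t
    proof -
      obtain i where i: "h t = (h ^^ i) s" using t(2) by (auto simp: Orb_def)
      have "t = (h ^^ Suc (p - 1)) t" using psubset.prems(2)[OF t(1)] p0 by simp
      also have "\<dots> = (h ^^ (p - 1)) (h t)" by (simp only: funpow_Suc_right comp_apply)
      also have "\<dots> = (h ^^ (p - 1 + i)) s" unfolding i by (simp only: funpow_add comp_apply)
      also have "\<dots> = (h ^^ ((p - 1 + i) mod p)) s"
        by (rule funpow_mod_eq[symmetric]) (rule psubset.prems(2)[OF s])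
      finally show ?thesis unfolding Orb_def using p0 by auto
    qed
    have "p dvd sum w (T - Orb)"
    proof (rule psubset.IH)
      show "T - Orb \<subset> T" using \<open>s \<in> Orb\<close> s by auto
    qed (use psubset.prems bk in auto)
    moreover have "sum w T = sum w (T - Orb) + sum w Orb"
      using sum.subset_diff[OF OT psubset.hyps] .
    ultimately show ?thesis using sumO by simp
  qed simp
qed

text \<open>Filter by the sets of points whose period divides p^j. Between consecutive sets of this
  filtration the p^j-th iterate has period p and no fixed points, so each step changes the sum by a
  multiple of p.\<close>

lemma prime_power_period_fixed_sum:
  fixes w :: "'b \<Rightarrow> nat"
  assumes p: "prime p" and S: "finite S" and fS: "\<And>s. s \<in> S \<Longrightarrow> f s \<in> S"
    and fk: "\<And>s. s \<in> S \<Longrightarrow> (f ^^ (p ^ k)) s = s" and w: "\<And>s. s \<in> S \<Longrightarrow> w (f s) = w s"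
  shows "[sum w S = sum w {s \<in> S. f s = s}] (mod p)"
proof -
  define F where "F j = {s \<in> S. (f ^^ (p ^ j)) s = s}" for j
  have iterS: "(f ^^ i) s \<in> S" if "s \<in> S" for i s using that by (induction i) (auto simp: fS)
  have iterw: "w ((f ^^ i) s) = w s" if "s \<in> S" for i s using that by (induction i) (auto simp: w iterS)
  have step: "[sum w (F (Suc j)) = sum w (F j)] (mod p)" for j
  proof -
    define h where "h = f ^^ (p ^ j)"
    have sub: "F j \<subseteq> F (Suc j)" using funpow_fix_mult[of "p ^ j" f _ p] by (auto simp: F_def mult.commute)
    have hp: "(h ^^ p) s = s" if "s \<in> F (Suc j)" for s
      using that by (simp add: F_def h_def funpow_mult mult.commute)
    have hF: "h s \<in> F (Suc j)" if "s \<in> F (Suc j)" for s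
    proof -
      have "(f ^^ (p ^ Suc j)) (h s) = (f ^^ (p ^ Suc j + p ^ j)) s" by (simp add: h_def funpow_add)
      also have "\<dots> = h ((f ^^ (p ^ Suc j)) s)" by (subst add.commute) (simp add: h_def funpow_add)
      finally show ?thesis using that iterS by (auto simp: F_def h_def)
    qed
    have "p dvd sum w (F (Suc j) - F j)"
    proof (rule free_prime_period_sum[OF p, of _ h])
      show "finite (F (Suc j) - F j)" using S by (auto simp: F_def)
      fix t assume t: "t \<in> F (Suc j) - F j"
      show "(h ^^ p) t = t" using hp t by auto
      show ht: "h t \<noteq> t" using t by (auto simp: F_def h_def)
      show "w (h t) = w t" using t iterw by (auto simp: F_def h_def)
      have "h t \<notin> F j"
      proof
        assume "h t \<in> F j"
        then have "h (h t) = h t" by (simp add: F_def h_def)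
        then have fixh: "(h ^^ i) (h t) = h t" for i by (induction i) auto
        have "p = Suc (p - 1)" using p prime_gt_0_nat by simp
        then have "(h ^^ p) t = (h ^^ (p - 1)) (h t)" by (metis comp_apply funpow_Suc_right)
        then show False using hp t fixh ht by auto
      qed
      then show "h t \<in> F (Suc j) - F j" using hF t by auto
    qed
    moreover have "sum w (F (Suc j)) = sum w (F (Suc j) - F j) + sum w (F j)"
      by (rule sum.subset_diff[OF sub]) (use S in \<open>auto simp: F_def\<close>)
    ultimately show ?thesis by (auto simp: cong_def)
  qed
  have "[sum w (F k) = sum w (F 0)] (mod p)"
    by (induction k) (auto intro: cong_trans[OF step])
  moreover have "F k = S" using fk by (auto simp: F_def)
  ultimately show ?thesis by (simp add: F_def)
qed

text \<open>Commuting maps preserve each other's fixed points, so they can be treated one after the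
  other.\<close>

lemma commuting_prime_power_fixed_sum:
  fixes w :: "'b \<Rightarrow> nat" and f :: "'u \<Rightarrow> 'b \<Rightarrow> 'b"
  assumes p: "prime p" and S: "finite S" and U: "finite U"
    and fS: "\<And>u s. u \<in> U \<Longrightarrow> s \<in> S \<Longrightarrow> f u s \<in> S"
    and comm: "\<And>u v s. u \<in> U \<Longrightarrow> v \<in> U \<Longrightarrow> s \<in> S \<Longrightarrow> f u (f v s) = f v (f u s)"
    and fk: "\<And>u. u \<in> U \<Longrightarrow> \<exists>k. \<forall>s\<in>S. (f u ^^ (p ^ k)) s = s"
    and w: "\<And>u s. u \<in> U \<Longrightarrow> s \<in> S \<Longrightarrow> w (f u s) = w s"
  shows "[sum w S = sum w {s \<in> S. \<forall>u\<in>U. f u s = s}] (mod p)"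
  using U fS comm fk w
proof (induction U)
  case (insert v U)
  define S' where "S' = {s \<in> S. \<forall>u\<in>U. f u s = s}"
  have "[sum w S = sum w S'] (mod p)" unfolding S'_def using insert.prems by (intro insert.IH) auto
  moreover obtain k where k: "\<forall>s\<in>S. (f v ^^ (p ^ k)) s = s" using insert.prems(3)[of v] by auto
  have "[sum w S' = sum w {s \<in> S'. f v s = s}] (mod p)"
  proof (rule prime_power_period_fixed_sum[OF p])
    show "finite S'" using S by (simp add: S'_def)
    show "f v s \<in> S'" if "s \<in> S'" for s
      using that insert.prems(1)[of v s] insert.prems(2)[of _ v s] by (auto simp: S'_def)
    show "(f v ^^ (p ^ k)) s = s" if "s \<in> S'" for s using that k by (auto simp: S'_def)
    show "w (f v s) = w s" if "s \<in> S'" for s using that insert.prems(4) by (auto simp: S'_def)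
  qed
  moreover have "{s \<in> S'. f v s = s} = {s \<in> S. \<forall>u\<in>insert v U. f u s = s}" by (auto simp: S'_def)
  ultimately show ?case by (metis cong_trans)
qed simp

definition prime_power_order :: "nat \<Rightarrow> nat \<Rightarrow> nat \<Rightarrow> bool" where
  "prime_power_order p M u \<longleftrightarrow> coprime u M \<and> (\<exists>k. [u ^ (p ^ k) = 1] (mod M))"

context fin_group
begin

lemma twist_funpow: "\<chi> \<in> IR X \<Longrightarrow> (twist u ^^ k) \<chi> = twist (u ^ k) \<chi>"
  by (induction k) (auto simp: twist_one[unfolded One_nat_def] twist_twist)

lemma twist_prime_power_period:
  assumes M: "M > 0" "card (carrier X) dvd M" and u: "prime_power_order p M u"
  shows "\<exists>k. \<forall>\<chi>\<in>IR X. (twist u ^^ (p ^ k)) \<chi> = \<chi>"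
proof -
  obtain k where k: "[u ^ (p ^ k) = 1] (mod M)" using u by (auto simp: prime_power_order_def)
  have "(twist u ^^ (p ^ k)) \<chi> = \<chi>" if "\<chi> \<in> IR X" for \<chi>
    unfolding twist_funpow[OF that] twist_cong[OF M k] by (rule twist_one[OF that])
  then show ?thesis by blast
qed

lemma twist_commute: "twist u (twist v \<chi>) = twist v (twist u \<chi>)"
  by (simp add: twist_twist mult.commute)

end

context clifford
begin

context
  fixes M p :: nat and U :: "nat set"
  assumes M: "M > 0" "card (carrier X) dvd M" and p: "prime p" "\<not> p dvd card (rcosets N)"
    and U: "finite U" "\<And>u. u \<in> U \<Longrightarrow> prime_power_order p M u"
begin

text \<open>The weights, squared multiplicities of \<theta>, add up to a divisor of the index and so
  to a number prime to p; they are invariant because U fixes \<theta>. Hence some fixed character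
  carries a weight prime to p.\<close>

lemma fixed_character_above:
  assumes \<theta>: "\<theta> \<in> IR Y" "\<And>u. u \<in> U \<Longrightarrow> Y.twist u \<theta> = \<theta>"
  shows "\<exists>\<chi>\<in>IR X. \<not> p dvd m \<chi> \<theta> \<and> (\<forall>u\<in>U. twist u \<chi> = \<chi>)"
proof -
  let ?w = "\<lambda>\<chi>. m \<chi> \<theta> * m \<chi> \<theta>"
  have c: "coprime u M" if "u \<in> U" for u using U(2)[OF that] by (simp add: prime_power_order_def)
  have "[sum ?w (IR X) = sum ?w {\<chi> \<in> IR X. \<forall>u\<in>U. twist u \<chi> = \<chi>}] (mod p)"
  proof (rule commuting_prime_power_fixed_sum[OF p(1) finite_IR U(1)])
    fix u \<chi> assume u: "u \<in> U" and \<chi>: "\<chi> \<in> IR X"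
    show "twist u \<chi> \<in> IR X" by (rule twist_IR[OF M c[OF u] \<chi>])
    show "m (twist u \<chi>) \<theta> * m (twist u \<chi>) \<theta> = m \<chi> \<theta> * m \<chi> \<theta>"
      using m_twist[OF M c[OF u] \<chi> \<theta>(1)] \<theta>(2)[OF u] by simp
  qed (use twist_commute twist_prime_power_period[OF M U(2)] in auto)
  moreover have "\<not> p dvd sum ?w (IR X)" using orbit_card[OF \<theta>(1)] p(2) dvd_mult[of p "sum ?w (IR X)" "card (orbit \<theta>)"] by auto
  ultimately have "\<not> p dvd sum ?w {\<chi> \<in> IR X. \<forall>u\<in>U. twist u \<chi> = \<chi>}"
    using cong_dvd_iff by blast
  then have "\<exists>\<chi>\<in>{\<chi> \<in> IR X. \<forall>u\<in>U. twist u \<chi> = \<chi>}. \<not> p dvd ?w \<chi>"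
    using dvd_sum[of "{\<chi> \<in> IR X. \<forall>u\<in>U. twist u \<chi> = \<chi>}" p ?w] by blast
  then obtain \<chi> where "\<chi> \<in> IR X" "\<forall>u\<in>U. twist u \<chi> = \<chi>" "\<not> p dvd m \<chi> \<theta> * m \<chi> \<theta>" by blast
  then show ?thesis using dvd_mult[of p "m \<chi> \<theta>" "m \<chi> \<theta>"] by blast
qed

text \<open>U permutes the constituents of the restriction, whose number divides the index and is
  prime to p; so it fixes some conjugate of \<theta>. Twisting commutes with conjugation, which
  carries the conclusion back to \<theta>.\<close>

lemma constituents_fixed:
  assumes \<chi>: "\<chi> \<in> IR X" "\<And>u. u \<in> U \<Longrightarrow> twist u \<chi> = \<chi>" and \<theta>: "\<theta> \<in> IR Y" "m \<chi> \<theta> \<noteq> 0" and u: "u \<in> U"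
  shows "Y.twist u \<theta> = \<theta>"
proof -
  have c: "coprime v M" if "v \<in> U" for v using U(2)[OF that] by (simp add: prime_power_order_def)
  note orb = constituents_orbit[OF \<chi>(1) \<theta>]
  note MY = M(1) card_N_dvd[OF M]
  have "[sum (\<lambda>_. 1::nat) (orbit \<theta>) = sum (\<lambda>_. 1) {s \<in> orbit \<theta>. \<forall>v\<in>U. Y.twist v s = s}] (mod p)"
  proof (rule commuting_prime_power_fixed_sum[OF p(1) finite_orbit U(1)])
    fix v s assume v: "v \<in> U" and s: "s \<in> orbit \<theta>"
    have s': "s \<in> IR Y" "m \<chi> s \<noteq> 0" using s orb by auto
    have "m \<chi> (Y.twist v s) \<noteq> 0" using m_twist[OF M c[OF v] \<chi>(1) s'(1)] \<chi>(2)[OF v] s'(2) by simp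
    then show "Y.twist v s \<in> orbit \<theta>" using Y.twist_IR[OF MY c[OF v] s'(1)] orb by auto
  next
    fix v assume v: "v \<in> U"
    show "\<exists>k. \<forall>s\<in>orbit \<theta>. (Y.twist v ^^ (p ^ k)) s = s"
      using Y.twist_prime_power_period[OF MY U(2)[OF v]] orb by blast
  qed (use Y.twist_commute in auto)
  moreover have "card (orbit \<theta>) dvd card (rcosets N)" using orbit_card[OF \<theta>(1)] by (metis dvd_triv_left)
  then have "\<not> p dvd card (orbit \<theta>)" using p(2) dvd_trans by blast
  ultimately have "\<not> p dvd card {s \<in> orbit \<theta>. \<forall>v\<in>U. Y.twist v s = s}"
    by (simp add: cong_dvd_iff)
  then have "{s \<in> orbit \<theta>. \<forall>v\<in>U. Y.twist v s = s} \<noteq> {}" by (metis card.empty dvd_0_right)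
  then obtain x where x: "x \<in> carrier X" "Y.twist u (conj x \<theta>) = conj x \<theta>"
    using u by (auto simp: orbit_def)
  have bk: "conj (inv x) (conj x \<theta>) = \<theta>" using x(1) \<theta>(1) by (simp add: conj_conj conj_one)
  have "Y.twist u \<theta> = Y.twist u (conj (inv x) (conj x \<theta>))" unfolding bk ..
  also have "\<dots> = conj (inv x) (Y.twist u (conj x \<theta>))" using x(1) by (simp add: conj_twist)
  finally show ?thesis unfolding x(2) bk .
qed

end

end

section \<open>Extensions with cyclic quotient\<close>

locale cyclic_clifford = clifford +
  fixes g
  assumes g: "g \<in> carrier X" and gen: "\<And>h. h \<in> carrier X \<Longrightarrow> \<exists>i::nat. h \<otimes> inv (g [^] i) \<in> N"
begin

text \<open>The order of the image of g in the quotient by N, which it generates.\<close>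

definition r :: nat where "r = (LEAST k. k > 0 \<and> g [^] k \<in> N)"

lemma pow_card_rcosets: "h \<in> carrier X \<Longrightarrow> h [^] card (rcosets N) \<in> N"
proof -
  assume h: "h \<in> carrier X"
  interpret n: normal N X by (rule normalN)
  interpret Q: group "X Mod N" by (rule n.factorgroup_is_group)
  interpret hom: group_hom X "X Mod N" "\<lambda>a. N #> a"
    by unfold_locales (use n.r_coset_hom_Mod in auto)
  have "N #> (h [^] card (rcosets N)) = (N #> h) [^]\<^bsub>X Mod N\<^esub> card (rcosets N)"
    by (rule hom.hom_nat_pow[OF h])
  also have "\<dots> = \<one>\<^bsub>X Mod N\<^esub>"
    using Q.pow_order_eq_1[OF hom.hom_closed[OF h]] by (simp add: Coset.order_def FactGroup_def)
  finally have "N #> (h [^] card (rcosets N)) = N" by (simp add: FactGroup_def)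
  then show ?thesis using h by (intro coset_join1[OF _ _ subgroupN]) auto
qed

lemma card_rcosets_pos: "card (rcosets N) > 0"
  using lagrange[OF subgroupN] card_pos by (auto simp: Coset.order_def intro!: Nat.gr0I)

lemma r_props: "r > 0" "g [^] r \<in> N"
  using LeastI[of "\<lambda>k. k > 0 \<and> g [^] k \<in> N" "card (rcosets N)"] pow_card_rcosets[OF g] card_rcosets_pos
  unfolding r_def by auto

lemma r_mult_in_N: "g [^] (r * k) \<in> N"
  using Y.nat_pow_closed[of "g [^] r" k] r_props(2) g by (simp add: Y_pow nat_pow_pow)

lemma r_dvd_iff: "g [^] i \<in> N \<longleftrightarrow> r dvd i"
proof
  assume i: "g [^] i \<in> N"
  have e: "g [^] i = g [^] (r * (i div r)) \<otimes> g [^] (i mod r)"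
    using nat_pow_mult[OF g, of "r * (i div r)" "i mod r"] by simp
  have "g [^] (i mod r) = inv (g [^] (r * (i div r))) \<otimes> g [^] i" unfolding e using g by (simp add: m_assoc[symmetric])
  then have "g [^] (i mod r) \<in> N"
    using subgroupN i r_mult_in_N[of "i div r"] by (simp add: subgroup.m_closed subgroup.m_inv_closed)
  then have "\<not> 0 < i mod r"
    using not_less_Least[of "i mod r" "\<lambda>k. k > 0 \<and> g [^] k \<in> N"] r_props(1) unfolding r_def[symmetric] by auto
  then show "r dvd i" by auto
qed (auto simp: r_mult_in_N)

lemma r_dvd_rcosets: "r dvd card (rcosets N)"
  using pow_card_rcosets[OF g] by (simp add: r_dvd_iff)

lemma coset_exponent_unique:
  assumes h: "h \<in> carrier X" "h \<otimes> inv (g [^] i) \<in> N" "h \<otimes> inv (g [^] (j::nat)) \<in> N"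
  shows "[i = j] (mod r)"
proof -
  have aux: "r dvd j' - i'" if le: "i' \<le> j'" and ij: "h \<otimes> inv (g [^] i') \<in> N" "h \<otimes> inv (g [^] j') \<in> N" for i' j' :: nat
  proof -
    have "inv (h \<otimes> inv (g [^] j')) \<otimes> (h \<otimes> inv (g [^] i')) \<in> N"
      using ij subgroupN by (simp add: subgroup.m_closed subgroup.m_inv_closed)
    also have "inv (h \<otimes> inv (g [^] j')) \<otimes> (h \<otimes> inv (g [^] i')) = g [^] j' \<otimes> (inv h \<otimes> h) \<otimes> inv (g [^] i')"
      by (simp only: inv_mult_group m_assoc m_closed inv_closed inv_inv nat_pow_closed h(1) g)
    also have "\<dots> = g [^] j' \<otimes> inv (g [^] i')" using h g by simp
    also have "g [^] j' = g [^] (j' - i') \<otimes> g [^] i'" using g le by (simp add: nat_pow_mult)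
    also have "g [^] (j' - i') \<otimes> g [^] i' \<otimes> inv (g [^] i') = g [^] (j' - i')" using g by (simp add: m_assoc)
    finally show ?thesis by (simp add: r_dvd_iff)
  qed
  show ?thesis
  proof (cases "i \<le> j")
    case True
    then show ?thesis using aux[OF True h(2,3)] by (simp add: cong_altdef_nat cong_sym)
  next
    case False
    then show ?thesis using aux[of j i] h by (simp add: cong_altdef_nat)
  qed
qed

text \<open>The discrete logarithm of the coset of h to base g. The chosen exponent is meaningful
  only modulo \<open>r\<close>, see \<open>coset_exponent_unique\<close>.\<close>

definition e :: "'a \<Rightarrow> nat" where
  "e h = (SOME i. h \<otimes> inv (g [^] i) \<in> N)"

lemma e_prop: "h \<in> carrier X \<Longrightarrow> h \<otimes> inv (g [^] e h) \<in> N"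
  unfolding e_def by (rule someI_ex) (rule gen)

lemma e_mult:
  assumes "h \<in> carrier X" "k \<in> carrier X" shows "[e (h \<otimes> k) = e h + e k] (mod r)"
proof (rule coset_exponent_unique[of "h \<otimes> k"])
  show "h \<otimes> k \<in> carrier X" using assms by simp
  show "h \<otimes> k \<otimes> inv (g [^] e (h \<otimes> k)) \<in> N" using assms by (intro e_prop) simp
  let ?a = "g [^] e h" and ?b = "g [^] e k"
  have ab: "?a \<in> carrier X" "?b \<in> carrier X" using g by auto
  have "?a \<otimes> (k \<otimes> inv ?b) \<otimes> inv ?a \<in> N"
    by (rule normal.inv_op_closed2[OF normalN ab(1) e_prop[OF assms(2)]])
  then have "(h \<otimes> inv ?a) \<otimes> (?a \<otimes> (k \<otimes> inv ?b) \<otimes> inv ?a) \<in> N"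
    using e_prop[OF assms(1)] subgroupN by (simp add: subgroup.m_closed)
  also have "(h \<otimes> inv ?a) \<otimes> (?a \<otimes> (k \<otimes> inv ?b) \<otimes> inv ?a) = h \<otimes> (inv ?a \<otimes> ?a) \<otimes> k \<otimes> (inv ?b \<otimes> inv ?a)"
    using assms ab by (simp only: m_assoc m_closed inv_closed)
  also have "\<dots> = h \<otimes> k \<otimes> inv (?a \<otimes> ?b)" using assms ab by (simp add: inv_mult_group)
  also have "?a \<otimes> ?b = g [^] (e h + e k)" using g by (simp add: nat_pow_mult)
  finally show "h \<otimes> k \<otimes> inv (g [^] (e h + e k)) \<in> N" .
qed

lemma e_N: "h \<in> carrier X \<Longrightarrow> r dvd e h \<longleftrightarrow> h \<in> N"
proof
  assume h: "h \<in> carrier X" and "r dvd e h"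
  then have "g [^] e h \<in> N" by (simp add: r_dvd_iff)
  then have "h \<otimes> inv (g [^] e h) \<otimes> g [^] e h \<in> N" using e_prop[OF h] subgroupN by (simp add: subgroup.m_closed)
  then show "h \<in> N" using h g by (simp add: m_assoc)
next
  assume h: "h \<in> carrier X" and "h \<in> N"
  then have "h \<otimes> inv (g [^] (0::nat)) \<in> N" by simp
  then have "[e h = 0] (mod r)" using coset_exponent_unique[OF h e_prop[OF h]] by blast
  then show "r dvd e h" by (simp add: cong_0_iff)
qed

text \<open>The linear characters of the cyclic quotient, lifted to the whole group.\<close>

definition lam :: "nat \<Rightarrow> 'a \<Rightarrow> complex" where
  "lam j h = zeta r ^ (j * e h)"

lemma lam_mult: "h \<in> carrier X \<Longrightarrow> k \<in> carrier X \<Longrightarrow> lam j (h \<otimes> k) = lam j h * lam j k"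
proof -
  assume "h \<in> carrier X" "k \<in> carrier X"
  then have "[j * e (h \<otimes> k) = j * (e h + e k)] (mod r)" by (intro cong_scalar_left e_mult)
  then have "zeta r ^ (j * e (h \<otimes> k)) = zeta r ^ (j * (e h + e k))"
    using zeta_power_eq_iff[OF r_props(1)] by blast
  then show ?thesis by (simp add: lam_def distrib_left power_add)
qed

lemma lam_one: "lam j \<one> = 1"
  using e_N[of \<one>] Y.one_closed zeta_power_eq_1_iff[OF r_props(1), of "j * e \<one>"] by (simp add: lam_def)

lemma lam_nonzero: "lam j h \<noteq> 0" by (simp add: lam_def zeta_nonzero)

lemma lam_pow: "h \<in> carrier X \<Longrightarrow> lam j (h [^] (k::nat)) = lam j h ^ k"
  by (induction k) (simp_all add: lam_one lam_mult)

lemma lam_sum: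
  assumes h: "h \<in> carrier X"
  shows "(\<Sum>j<r. lam j h) = (if h \<in> N then of_nat r else 0)"
proof -
  have l: "lam j h = (zeta r ^ e h) ^ j" for j by (simp add: lam_def power_mult[symmetric] mult.commute)
  show ?thesis
  proof (cases "h \<in> N")
    case True
    then have "zeta r ^ e h = 1" using e_N[OF h] zeta_power_eq_1_iff[OF r_props(1)] by simp
    then show ?thesis using True by (simp add: l)
  next
    case False
    then have "zeta r ^ e h \<noteq> 1" using e_N[OF h] zeta_power_eq_1_iff[OF r_props(1)] by simp
    moreover have "(zeta r ^ e h) ^ r = 1"
      using zeta_power_self[OF r_props(1)] by (simp add: power_mult[symmetric] mult.commute) (simp add: power_mult)
    ultimately show ?thesis using False unfolding l by (subst geometric_sum) auto
  qed
qed

definition lmul :: "nat \<Rightarrow> ('a \<Rightarrow> complex) \<Rightarrow> 'a \<Rightarrow> complex" where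
  "lmul j \<psi> = restr X (\<lambda>h. lam j h * \<psi> h)"

text \<open>Multiplying each matrix by a nonzero scalar leaves the invariant subspaces unchanged,
  and \<open>lam\<close> is multiplicative.\<close>

lemma lmul_IR:
  assumes "\<psi> \<in> IR X" shows "lmul j \<psi> \<in> IR X"
proof -
  obtain n \<rho> where \<rho>: "is_irr_rep X n \<rho>" "\<psi> = restr X (\<lambda>h. mat_trace (\<rho> h))" using assms by (auto simp: IR_def)
  have \<rho>c: "\<rho> h \<in> carrier_mat n n" if "h \<in> carrier X" for h using \<rho>(1) that by (simp add: is_irr_rep_def is_rep_def)
  define \<sigma> where "\<sigma> h = lam j h \<cdot>\<^sub>m \<rho> h" for h
  have "is_rep X n \<sigma>"
    unfolding is_rep_def
  proof (intro conjI ballI)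
    show "\<sigma> h \<in> carrier_mat n n" if "h \<in> carrier X" for h using \<rho>c[OF that] by (simp add: \<sigma>_def)
    show "\<sigma> \<one> = 1\<^sub>m n" using \<rho>(1) by (simp add: \<sigma>_def lam_one is_irr_rep_def is_rep_def) (auto intro!: eq_matI)
    fix h k assume hk: "h \<in> carrier X" "k \<in> carrier X"
    have "\<sigma> h * \<sigma> k = lam j h \<cdot>\<^sub>m (\<rho> h * (lam j k \<cdot>\<^sub>m \<rho> k))"
      unfolding \<sigma>_def by (rule mult_smult_assoc_mat[of _ n n _ n]) (use \<rho>c[OF hk(1)] \<rho>c[OF hk(2)] in auto)
    also have "\<rho> h * (lam j k \<cdot>\<^sub>m \<rho> k) = lam j k \<cdot>\<^sub>m (\<rho> h * \<rho> k)"
      by (rule mult_smult_distrib[OF \<rho>c[OF hk(1)] \<rho>c[OF hk(2)]])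
    also have "\<rho> h * \<rho> k = \<rho> (h \<otimes> k)" using \<rho>(1) hk by (simp add: is_irr_rep_def is_rep_def)
    also have "lam j h \<cdot>\<^sub>m (lam j k \<cdot>\<^sub>m \<rho> (h \<otimes> k)) = \<sigma> (h \<otimes> k)"
      unfolding \<sigma>_def lam_mult[OF hk] by (auto intro!: eq_matI simp: mult.assoc)
    finally show "\<sigma> (h \<otimes> k) = \<sigma> h * \<sigma> k" by simp
  qed
  moreover have "\<forall>h\<in>carrier X. \<forall>w\<in>W. \<rho> h *\<^sub>v w \<in> W" if W: "is_subspace n W" "\<forall>h\<in>carrier X. \<forall>w\<in>W. \<sigma> h *\<^sub>v w \<in> W" for W
  proof (intro ballI)
    fix h w assume h: "h \<in> carrier X" and w: "w \<in> W"
    have wc: "w \<in> carrier_vec n" using w W(1) by (auto simp: is_subspace_def)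
    have "inverse (lam j h) \<cdot>\<^sub>v (\<sigma> h *\<^sub>v w) \<in> W" using W h w by (simp add: is_subspace_def)
    moreover have "inverse (lam j h) \<cdot>\<^sub>v (\<sigma> h *\<^sub>v w) = \<rho> h *\<^sub>v w"
    proof (rule eq_vecI)
      fix i assume "i < dim_vec (\<rho> h *\<^sub>v w)"
      then have i: "i < n" using \<rho>c[OF h] by simp
      have \<sigma>c: "\<sigma> h \<in> carrier_mat n n" using \<rho>c[OF h] by (simp add: \<sigma>_def)
      have "(\<sigma> h *\<^sub>v w) $ i = lam j h * (\<rho> h *\<^sub>v w) $ i"
        unfolding mult_mat_vec_index[OF \<sigma>c wc i] mult_mat_vec_index[OF \<rho>c[OF h] wc i] sum_distrib_left
        using \<rho>c[OF h] i by (intro sum.cong) (auto simp: \<sigma>_def)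
      then show "(inverse (lam j h) \<cdot>\<^sub>v (\<sigma> h *\<^sub>v w)) $ i = (\<rho> h *\<^sub>v w) $ i"
        using lam_nonzero[of j h] i \<sigma>c by (simp del: index_mult_mat_vec)
    qed (use \<rho>c[OF h] in \<open>auto simp: \<sigma>_def\<close>)
    ultimately show "\<rho> h *\<^sub>v w \<in> W" by simp
  qed
  ultimately have "is_irr_rep X n \<sigma>" using \<rho>(1) unfolding is_irr_rep_def by blast
  moreover have "mat_trace (\<sigma> h) = lam j h * mat_trace (\<rho> h)" if "h \<in> carrier X" for h
    using \<rho>c[OF that] by (simp add: mat_trace_def \<sigma>_def sum_distrib_left)
  then have "lmul j \<psi> = restr X (\<lambda>h. mat_trace (\<sigma> h))"
    by (auto simp: lmul_def \<rho>(2) restr_def fun_eq_iff)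
  ultimately show ?thesis by (auto simp: IR_def)
qed

text \<open>The sum of all \<open>lam j\<close> is r times the indicator function of N. Summing the
  inner products of \<psi> with all \<open>lmul j \<psi>0\<close> therefore gives a positive
  multiple of the inner product of the two restrictions, which is nonzero because they share
  \<theta>.\<close>

lemma lmul_transitive:
  assumes \<psi>: "\<psi>0 \<in> IR X" "\<psi> \<in> IR X" and \<theta>: "\<theta> \<in> IR Y" "m \<psi>0 \<theta> \<noteq> 0" "m \<psi> \<theta> \<noteq> 0"
  shows "\<exists>j. \<psi> = lmul j \<psi>0"
proof (rule ccontr)
  assume H: "\<not> ?thesis"
  have "(\<Sum>j<r. ip (lmul j \<psi>0) \<psi>) = 0" using H by (intro sum.neutral) (auto simp: ip_IR[OF lmul_IR[OF \<psi>(1)] \<psi>(2)])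
  then have "0 = (\<Sum>j<r. \<Sum>h\<in>carrier X. lam j h * (\<psi>0 h * \<psi> (inv h)))"
    using card_pos by (simp add: ip_def lmul_def restr_carrier mult.assoc flip: sum_divide_distrib)
  also have "\<dots> = (\<Sum>h\<in>carrier X. (\<Sum>j<r. lam j h) * (\<psi>0 h * \<psi> (inv h)))"
    unfolding sum_distrib_right by (rule sum.swap)
  also have "\<dots> = (\<Sum>h\<in>carrier X. if h \<in> N then of_nat r * (\<psi>0 h * \<psi> (inv h)) else 0)"
    by (intro sum.cong refl) (simp add: lam_sum)
  also have "\<dots> = (\<Sum>h\<in>N. of_nat r * (\<psi>0 h * \<psi> (inv h)))"
  proof -
    have "carrier X \<inter> {h. h \<in> N} = N" using N_carrier by auto
    then show ?thesis using fin by (simp add: sum.If_cases)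
  qed
  also have "\<dots> = of_nat r * of_nat (card N) * Y.ip \<psi>0 \<psi>"
    using card_N_pos by (simp add: Y_ip flip: sum_distrib_left)
  finally have 0: "Y.ip \<psi>0 \<psi> = 0" using r_props(1) card_N_pos by simp
  have "Y.ip \<psi>0 \<psi> = Y.ip (\<lambda>h. \<Sum>\<theta>\<in>IR Y. of_nat (m \<psi>0 \<theta>) * \<theta> h) \<psi>"
    by (rule Y.ip_cong) (use restriction_expansion[OF \<psi>(1)] in auto)
  also have "\<dots> = (\<Sum>\<theta>\<in>IR Y. of_nat (m \<psi>0 \<theta>) * Y.ip \<theta> \<psi>)" by (rule Y.ip_sum_left)
  also have "\<dots> = of_nat (\<Sum>\<theta>\<in>IR Y. m \<psi>0 \<theta> * m \<psi> \<theta>)" by (simp add: Y.ip_sym[of _ \<psi>] ip_m[OF \<psi>(2)])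
  finally have "(\<Sum>\<theta>\<in>IR Y. m \<psi>0 \<theta> * m \<psi> \<theta>) = 0" unfolding 0 using of_nat_eq_0_iff by metis
  then have "m \<psi>0 \<theta> * m \<psi> \<theta> = 0" using Y.finite_IR \<theta>(1) by simp
  then show False using \<theta> by simp
qed

text \<open>Some character above \<theta> is fixed by u, and \<psi> differs from it by a linear
  character of order dividing r. The latter does not change under h \<mapsto> h^u because r divides
  the index and u is 1 modulo it.\<close>

lemma twist_fixed_cyclic:
  assumes M: "M > 0" "card (carrier X) dvd M" and p: "prime p" "\<not> p dvd card (rcosets N)"
    and u: "prime_power_order p M u" "[u = 1] (mod card (rcosets N))"
    and \<psi>: "\<psi> \<in> IR X" and \<theta>: "\<theta> \<in> IR Y" "m \<psi> \<theta> \<noteq> 0" "Y.twist u \<theta> = \<theta>"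
  shows "twist u \<psi> = \<psi>"
proof -
  have U: "finite {u}" "\<And>v. v \<in> {u} \<Longrightarrow> prime_power_order p M v" using u by auto
  from fixed_character_above[OF M p U \<theta>(1)] \<theta>(3)
  obtain \<psi>0 where \<psi>0: "\<psi>0 \<in> IR X" "\<not> p dvd m \<psi>0 \<theta>" "twist u \<psi>0 = \<psi>0" by auto
  then have "m \<psi>0 \<theta> \<noteq> 0" by (metis dvd_0_right)
  then obtain j where j: "\<psi> = lmul j \<psi>0" using lmul_transitive[OF \<psi>0(1) \<psi> \<theta>(1)] \<theta>(2) by blast
  have ur: "[u = 1] (mod r)" using u(2) r_dvd_rcosets by (rule cong_dvd_modulus_nat)
  have lamu: "lam j (h [^] u) = lam j h" if "h \<in> carrier X" for h
  proof -
    have "[j * e h * u = j * e h * 1] (mod r)" using ur by (rule cong_scalar_left)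
    then show ?thesis using zeta_power_eq_iff[OF r_props(1), of "j * e h * u" "j * e h"]
      by (simp add: lam_pow[OF that]) (simp add: lam_def power_mult)
  qed
  have "twist u \<psi> h = \<psi> h" for h
    using lamu[of h] fun_cong[OF \<psi>0(3), of h] unfolding j by (auto simp: lmul_def twist_def restr_def)
  then show ?thesis by blast
qed

end

context clifford
begin

text \<open>Whether \<chi> takes the same value at g and at g^u can be decided on the subgroup
  \<open>H\<close> generated by N and g. There \<chi> is a sum of irreducible characters lying above
  constituents of its restriction to N, and the cyclic case applies to each of them.\<close>

lemma twist_fixed_of_constituents:
  assumes M: "M > 0" "card (carrier X) dvd M" and p: "prime p" "\<not> p dvd card (rcosets N)"
    and u: "prime_power_order p M u" "[u = 1] (mod card (rcosets N))"
    and \<chi>: "\<chi> \<in> IR X" and fixed: "\<And>\<theta>. \<theta> \<in> IR Y \<Longrightarrow> m \<chi> \<theta> \<noteq> 0 \<Longrightarrow> Y.twist u \<theta> = \<theta>"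
  shows "twist u \<chi> = \<chi>"
proof
  fix g
  show "twist u \<chi> g = \<chi> g"
  proof (cases "g \<in> carrier X")
    case g: True
    define H where "H = {h \<in> carrier X. \<exists>i::nat. h \<otimes> inv (g [^] i) \<in> N}"
    have gi: "g [^] i \<in> H" for i :: nat
      using g Y.one_closed by (auto simp: H_def intro!: exI[of _ i])
    have NH: "N \<subseteq> H" using N_carrier by (auto simp: H_def intro!: exI[of _ 0])
    have mult: "h \<otimes> k \<in> H" if hk: "h \<in> H" "k \<in> H" for h k
    proof -
      obtain i j where ij: "h \<otimes> inv (g [^] (i::nat)) \<in> N" "k \<otimes> inv (g [^] (j::nat)) \<in> N" "h \<in> carrier X" "k \<in> carrier X"
        using hk by (auto simp: H_def)
      let ?a = "g [^] i" and ?b = "g [^] j"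
      have ab: "?a \<in> carrier X" "?b \<in> carrier X" using g by auto
      have "?a \<otimes> (k \<otimes> inv ?b) \<otimes> inv ?a \<in> N" by (rule normal.inv_op_closed2[OF normalN ab(1) ij(2)])
      then have "(h \<otimes> inv ?a) \<otimes> (?a \<otimes> (k \<otimes> inv ?b) \<otimes> inv ?a) \<in> N"
        using ij(1) subgroupN by (simp add: subgroup.m_closed)
      also have "(h \<otimes> inv ?a) \<otimes> (?a \<otimes> (k \<otimes> inv ?b) \<otimes> inv ?a) = h \<otimes> (inv ?a \<otimes> ?a) \<otimes> k \<otimes> (inv ?b \<otimes> inv ?a)"
        using ij ab by (simp only: m_assoc m_closed inv_closed)
      also have "\<dots> = h \<otimes> k \<otimes> inv (?a \<otimes> ?b)" using ij ab by (simp add: inv_mult_group)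
      also have "?a \<otimes> ?b = g [^] (i + j)" using g by (simp add: nat_pow_mult)
      finally show ?thesis using ij by (auto simp: H_def)
    qed
    have one: "\<one> \<in> H" using NH Y.one_closed by auto
    have sub: "subgroup H X"
    proof (rule subgroupI)
      show "H \<subseteq> carrier X" by (auto simp: H_def)
      show "H \<noteq> {}" using one by auto
      show "h \<otimes> k \<in> H" if "h \<in> H" "k \<in> H" for h k using that by (rule mult)
      show "inv h \<in> H" if h: "h \<in> H" for h
      proof -
        have hc: "h \<in> carrier X" using h by (simp add: H_def)
        have "h [^] (k::nat) \<in> H" for k by (induction k) (auto simp: one h mult)
        moreover have "h [^] (card (carrier X) - 1) \<otimes> h = h [^] Suc (card (carrier X) - 1)" by simp
        then have "h [^] (card (carrier X) - 1) \<otimes> h = \<one>" using pow_card_multiple[OF hc dvd_refl] card_pos by simp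
        then have "inv h = h [^] (card (carrier X) - 1)" using hc by (intro inv_equality) auto
        ultimately show ?thesis by simp
      qed
    qed
    interpret Hg: group "X\<lparr>carrier := H\<rparr>" by (rule subgroup.subgroup_is_group[OF sub group_axioms])
    have nH: "N \<lhd> X\<lparr>carrier := H\<rparr>"
      by (rule normal_restrict_supergroup[OF sub normalN NH])
    interpret H: cyclic_clifford "X\<lparr>carrier := H\<rparr>" N g
    proof (intro cyclic_clifford.intro clifford.intro fin_group.intro fin_group_axioms.intro clifford_axioms.intro
        cyclic_clifford_axioms.intro)
      show "group (X\<lparr>carrier := H\<rparr>)" by (rule Hg.group_axioms)
      show "finite (carrier (X\<lparr>carrier := H\<rparr>))" using fin by (simp add: H_def)
      show "N \<lhd> X\<lparr>carrier := H\<rparr>" by (rule nH)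
      show "g \<in> carrier (X\<lparr>carrier := H\<rparr>)" using gi[of 1] g by simp
      fix h assume h: "h \<in> carrier (X\<lparr>carrier := H\<rparr>)"
      have pw: "g [^]\<^bsub>X\<lparr>carrier := H\<rparr>\<^esub> i = g [^] i" for i :: nat by (simp add: nat_pow_def)
      have "h \<in> H" using h by simp
      then obtain i :: nat where "h \<otimes> inv (g [^] i) \<in> N" unfolding H_def by blast
      then show "\<exists>i::nat. h \<otimes>\<^bsub>X\<lparr>carrier := H\<rparr>\<^esub> inv\<^bsub>X\<lparr>carrier := H\<rparr>\<^esub> (g [^]\<^bsub>X\<lparr>carrier := H\<rparr>\<^esub> i) \<in> N"
        unfolding pw m_inv_consistent[OF sub gi] by auto
    qed
    have Hc: "h \<in> carrier X" if "h \<in> H" for h using that by (auto simp: H_def)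
    have cH: "card H dvd card (carrier X)" using lagrange[OF sub] by (metis Coset.order_def dvd_triv_right)
    have MH: "card (carrier (X\<lparr>carrier := H\<rparr>)) dvd M" using cH M(2) dvd_trans by auto
    have rH: "card (rcosets\<^bsub>X\<lparr>carrier := H\<rparr>\<^esub> N) dvd card (rcosets N)"
    proof -
      have "card (rcosets\<^bsub>X\<lparr>carrier := H\<rparr>\<^esub> N) * card N = card H"
        using Hg.lagrange[OF H.subgroupN] by (simp add: Coset.order_def)
      moreover have "card (rcosets N) * card N = card (carrier X)"
        using lagrange[OF subgroupN] by (simp add: Coset.order_def)
      ultimately have "card (rcosets\<^bsub>X\<lparr>carrier := H\<rparr>\<^esub> N) * card N dvd card (rcosets N) * card N" using cH by simp
      then show ?thesis using card_N_pos by simp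
    qed
    have pH: "\<not> p dvd card (rcosets\<^bsub>X\<lparr>carrier := H\<rparr>\<^esub> N)" using p(2) rH dvd_trans by blast
    have uH: "[u = 1] (mod card (rcosets\<^bsub>X\<lparr>carrier := H\<rparr>\<^esub> N))" using u(2) rH by (rule cong_dvd_modulus_nat)
    obtain n \<rho> where \<rho>: "is_irr_rep X n \<rho>" "\<chi> = restr X (\<lambda>g. mat_trace (\<rho> g))" using \<chi> by (auto simp: IR_def)
    have "is_rep (X\<lparr>carrier := H\<rparr>) n \<rho>" using \<rho>(1) Hc by (auto simp: is_irr_rep_def is_rep_def)
    then obtain cs where cs: "set cs \<subseteq> IR (X\<lparr>carrier := H\<rparr>)" "\<forall>h\<in>H. mat_trace (\<rho> h) = (\<Sum>c\<leftarrow>cs. c h)"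
      using H.rep_character_decomposition by fastforce
    have \<chi>cs: "\<chi> h = (\<Sum>c\<leftarrow>cs. c h)" if "h \<in> H" for h using cs(2) that Hc[OF that] by (simp add: \<rho>(2) restr_def)
    have Yeq: "X\<lparr>carrier := H\<rparr>\<lparr>carrier := N\<rparr> = Y" by simp
    have cfix: "c (g [^] u) = c g" if c: "c \<in> set cs" for c
    proof -
      have cI: "c \<in> IR (X\<lparr>carrier := H\<rparr>)" using c cs(1) by blast
      obtain \<theta> where \<theta>: "\<theta> \<in> IR Y" "H.m c \<theta> \<noteq> 0" using H.exists_below[OF cI] unfolding Yeq by blast
      \<comment> \<open>Multiplicities of \<theta> add up over the constituents on \<open>H\<close>;
        as they are nonnegative, a \<theta> below one constituent also lies below \<chi> and is
        fixed by assumption.\<close>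
      have ip_list: "Y.ip (\<lambda>h. \<Sum>c\<leftarrow>ds. c h) \<theta> = (\<Sum>c\<leftarrow>ds. of_nat (H.m c \<theta>))" if "set ds \<subseteq> set cs" for ds
        using that
      proof (induction ds)
        case Nil then show ?case by (simp add: Y_ip)
      next
        case (Cons d ds)
        have "d \<in> IR (X\<lparr>carrier := H\<rparr>)" using Cons.prems cs(1) by auto
        then have "Y.ip d \<theta> = of_nat (H.m d \<theta>)" using H.ip_m[of d \<theta>] \<theta>(1) unfolding Yeq by simp
        moreover have "Y.ip (\<lambda>h. \<Sum>c\<leftarrow>d # ds. c h) \<theta> = Y.ip d \<theta> + Y.ip (\<lambda>h. \<Sum>c\<leftarrow>ds. c h) \<theta>"
          by (simp add: Y_ip add_divide_distrib distrib_right sum.distrib)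
        ultimately show ?case using Cons by simp
      qed
      have "of_nat (m \<chi> \<theta>) = Y.ip (\<lambda>h. \<Sum>c\<leftarrow>cs. c h) \<theta>"
        unfolding ip_m[OF \<chi> \<theta>(1), symmetric] by (rule Y.ip_cong) (use \<chi>cs NH in auto)
      also have "\<dots> = of_nat (\<Sum>c\<leftarrow>cs. H.m c \<theta>)" unfolding ip_list[OF order_refl] by (simp add: o_def flip: sum_list_of_nat)
      finally have "m \<chi> \<theta> = (\<Sum>c\<leftarrow>cs. H.m c \<theta>)" by (simp only: of_nat_eq_iff)
      then have "m \<chi> \<theta> \<noteq> 0" using c \<theta>(2) by (auto simp: sum_list_eq_0_iff)
      then have "Y.twist u \<theta> = \<theta>" using fixed \<theta>(1) by blast
      then have "H.twist u c = c"
        using H.twist_fixed_cyclic[OF M(1) MH p(1) pH u(1) uH cI] \<theta> unfolding Yeq by blast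
      then have "H.twist u c g = c g" by simp
      moreover have "g [^]\<^bsub>X\<lparr>carrier := H\<rparr>\<^esub> u = g [^] u" by (simp add: nat_pow_def)
      ultimately show ?thesis using gi[of 1] g by (simp add: H.twist_def restr_def)
    qed
    have "\<chi> (g [^] u) = (\<Sum>c\<leftarrow>cs. c (g [^] u))" by (rule \<chi>cs[OF gi])
    also have "\<dots> = (\<Sum>c\<leftarrow>cs. c g)" using cfix by (intro arg_cong[of _ _ sum_list] map_cong) auto
    also have "\<dots> = \<chi> g" using \<chi>cs[of g] gi[of 1] g by simp
    finally show ?thesis using g by (simp add: twist_def restr_def)
  qed (use IR_outside[OF \<chi>] in \<open>simp add: twist_def restr_def\<close>)
qed

end

section \<open>Arithmetic of the units congruent to 1 modulo \<open>p\<close>\<close>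

text \<open>In x^p - 1 = (x - 1)(1 + x + ... + x^(p-1)) the second factor has p summands that are 1
  modulo p, so it contributes one more factor p.\<close>

lemma power_prime_cong_1:
  fixes x :: nat
  assumes "[x = 1] (mod p ^ k)" "k \<ge> 1" shows "[x ^ p = 1] (mod p ^ Suc k)"
proof -
  have d: "int (p ^ k) dvd int x - 1" using assms(1) by (metis cong_iff_dvd_diff cong_int_iff of_nat_1)
  have "int p dvd int (p ^ k)" using assms(2) by (simp add: dvd_power)
  then have p: "int p dvd int x - 1" using d dvd_trans by blast
  have "int p dvd (\<Sum>i<p. int x ^ i - 1)"
    by (intro dvd_sum) (use p in \<open>auto simp: power_diff_1_eq\<close>)
  then have "int p dvd (\<Sum>i<p. int x ^ i)"
    by (simp add: sum_subtractf) (metis dvd_add_right_iff dvd_refl diff_add_cancel dvd_add)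
  then have "int (p ^ k) * int p dvd (int x - 1) * (\<Sum>i<p. int x ^ i)" using d by (rule mult_dvd_mono[rotated])
  then have "int (p ^ Suc k) dvd int (x ^ p) - int 1" by (simp add: power_diff_1_eq mult.commute)
  then show ?thesis by (metis cong_iff_dvd_diff cong_int_iff)
qed

lemma power_prime_power_cong_1:
  fixes x :: nat
  assumes "[x = 1] (mod p)" shows "[x ^ (p ^ j) = 1] (mod p ^ Suc j)"
proof (induction j)
  case (Suc j)
  have "[(x ^ (p ^ j)) ^ p = 1] (mod p ^ Suc (Suc j))" using Suc by (intro power_prime_cong_1) auto
  then show ?case by (simp add: power_mult[symmetric] mult.commute)
qed (use assms in simp)

lemma card_units_1_mod_prime:
  assumes "prime p" "a \<ge> 1" shows "card {u. u < p ^ a \<and> [u = 1] (mod p)} = p ^ (a - 1)"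
proof -
  have p: "p > 1" using assms(1) prime_gt_1_nat by blast
  have pa: "p ^ a = p * p ^ (a - 1)" using assms(2) by (metis power_eq_if not_one_le_zero)
  have "bij_betw (\<lambda>i. 1 + p * i) {..<p ^ (a - 1)} {u. u < p ^ a \<and> [u = 1] (mod p)}"
  proof (rule bij_betw_byWitness[of _ "\<lambda>u. u div p"])
    have "(1 + p * i) div p = i" for i using p by (subst div_mult_self2) auto
    then show "\<forall>i\<in>{..<p ^ (a - 1)}. (1 + p * i) div p = i" by blast
    have "1 + p * (u div p) = u" if "[u = 1] (mod p)" for u
      using that p div_mult_mod_eq[of u p] by (simp add: cong_def mult.commute)
    then show "\<forall>u\<in>{u. u < p ^ a \<and> [u = 1] (mod p)}. 1 + p * (u div p) = u" by blast
    show "(\<lambda>i. 1 + p * i) ` {..<p ^ (a - 1)} \<subseteq> {u. u < p ^ a \<and> [u = 1] (mod p)}"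
    proof safe
      fix i assume "i < p ^ (a - 1)"
      then have "p * Suc i \<le> p * p ^ (a - 1)" by (intro mult_le_mono2) simp
      then show "1 + p * i < p ^ a" using p pa by simp
      have "[1 + p * i = 1 + 0] (mod p)" by (intro cong_add cong_refl) (simp add: cong_0_iff)
      then show "[1 + p * i = 1] (mod p)" by simp
    qed
    show "(\<lambda>u. u div p) ` {u. u < p ^ a \<and> [u = 1] (mod p)} \<subseteq> {..<p ^ (a - 1)}"
      using p pa by (auto simp: less_mult_imp_div_less mult.commute)
  qed
  then show ?thesis by (metis bij_betw_same_card card_lessThan)
qed

text \<open>\<open>U\<close> sits in the group of residues that are 1 modulo p, of order p^(a-1).
  Closure under inverses follows from closure under products, since an inverse is the power with
  exponent p^(a-1) - 1; Lagrange's theorem then gives the claim.\<close>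

lemma card_unit_subgroup_prime_power:
  assumes p: "prime p" and a: "a \<ge> 1" and U: "U \<subseteq> {u. u < p ^ a \<and> [u = 1] (mod p)}"
    and one: "1 \<in> U" and mult: "\<And>u v. u \<in> U \<Longrightarrow> v \<in> U \<Longrightarrow> u * v mod p ^ a \<in> U"
  shows "\<exists>k. card U = p ^ k"
proof -
  let ?q = "p ^ a"
  define G where "G = \<lparr>carrier = {u. u < ?q \<and> [u = 1] (mod p)}, monoid.mult = (\<lambda>u v. u * v mod ?q), one = (1::nat)\<rparr>"
  have p1: "p > 1" using p prime_gt_1_nat by blast
  have pq: "p dvd ?q" using a by (simp add: dvd_power)
  have q1: "1 < ?q" using p1 a by (intro one_less_power) auto
  have inv: "(u ^ (p ^ (a - 1) - 1) mod ?q) * u mod ?q = 1" if "[u = 1] (mod p)" for u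
  proof -
    have "u ^ (p ^ (a - 1) - 1) * u = u ^ (p ^ (a - 1))" using p1 by (intro power_minus_mult) simp
    moreover have "[u ^ (p ^ (a - 1)) = 1] (mod ?q)" using power_prime_power_cong_1[OF that, of "a - 1"] a by simp
    ultimately show ?thesis using q1 p1 a by (simp add: mod_mult_left_eq cong_def)
  qed
  have modq: "w mod ?q < ?q" for w using q1 by (intro mod_less_divisor) linarith
  have cl: "[u * v mod ?q = 1] (mod p)" if "[u = 1] (mod p)" "[v = 1] (mod p)" for u v
    using cong_mult[OF that] pq by (simp add: cong_def mod_mod_cancel)
  have pw: "[u ^ k mod ?q = 1] (mod p)" if "[u = 1] (mod p)" for u k
    using cong_pow[OF that, of k] pq by (simp add: cong_def mod_mod_cancel)
  interpret G: group G
  proof (rule groupI)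
    fix x assume x: "x \<in> carrier G"
    then show "\<exists>y\<in>carrier G. y \<otimes>\<^bsub>G\<^esub> x = \<one>\<^bsub>G\<^esub>"
      using inv[of x] pw[of x] q1 modq by (intro bexI[of _ "x ^ (p ^ (a - 1) - 1) mod ?q"]) (auto simp: G_def)
    show "\<one>\<^bsub>G\<^esub> \<otimes>\<^bsub>G\<^esub> x = x" using x by (simp add: G_def)
    fix y z assume "y \<in> carrier G" "z \<in> carrier G"
    show "x \<otimes>\<^bsub>G\<^esub> y \<otimes>\<^bsub>G\<^esub> z = x \<otimes>\<^bsub>G\<^esub> (y \<otimes>\<^bsub>G\<^esub> z)"
      by (simp add: G_def mod_mult_left_eq mod_mult_right_eq mult.assoc)
  next
    fix x y assume "x \<in> carrier G" "y \<in> carrier G"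
    then show "x \<otimes>\<^bsub>G\<^esub> y \<in> carrier G" using cl[of x y] modq by (auto simp: G_def)
  qed (use q1 in \<open>auto simp: G_def\<close>)
  have Upow: "u ^ k mod ?q \<in> U" if u: "u \<in> U" for u k
  proof (induction k)
    case 0
    show ?case unfolding power_0 mod_less[OF q1] by (rule one)
  next
    case (Suc k)
    have "u * (u ^ k mod ?q) mod ?q \<in> U" by (rule mult[OF u Suc])
    then show ?case by (simp add: mod_mult_right_eq)
  qed
  have sub: "subgroup U G"
  proof (rule G.subgroupI)
    show "U \<subseteq> carrier G" using U by (simp add: G_def)
    show "U \<noteq> {}" using one by auto
    show "u \<otimes>\<^bsub>G\<^esub> v \<in> U" if "u \<in> U" "v \<in> U" for u v using mult[OF that] by (simp add: G_def)
    show "inv\<^bsub>G\<^esub> u \<in> U" if u: "u \<in> U" for u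
    proof -
      have c: "[u = 1] (mod p)" "u < ?q" using u U by auto
      have "inv\<^bsub>G\<^esub> u = u ^ (p ^ (a - 1) - 1) mod ?q"
        using inv[OF c(1)] pw[OF c(1)] c modq by (intro G.inv_equality) (auto simp: G_def)
      then show ?thesis using Upow[OF u] by simp
    qed
  qed
  have "card (carrier G) = p ^ (a - 1)" using card_units_1_mod_prime[OF p a] by (simp add: G_def)
  then have "card U dvd p ^ (a - 1)" using G.lagrange[OF sub] by (metis Coset.order_def dvd_triv_right)
  then show ?thesis using divides_primepow_nat[OF p] by blast
qed

text \<open>The power with exponent p^B is 1 modulo p^B because u is 1 modulo p, and 1 modulo m'
  because u is. The condition k \<ge> 1 provides the former; it is the origin of the lower bounds on
  exponents further down.\<close>

lemma prime_power_orderI: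
  assumes p: "prime p" "\<not> p dvd m'" and M: "M = p ^ B * m'" and k: "k \<ge> 1"
    and u: "coprime u M" "[u = 1] (mod p ^ k * m')"
  shows "prime_power_order p M u" "[u = 1] (mod p)"
proof -
  have "p dvd p ^ k * m'" using k by (simp add: dvd_power)
  with u(2) show pu: "[u = 1] (mod p)" by (rule cong_dvd_modulus_nat)
  have m': "[u = 1] (mod m')" using u(2) by (rule cong_dvd_modulus_nat) simp
  have "[u ^ (p ^ B) = 1] (mod p ^ B)"
    using power_prime_power_cong_1[OF pu, of B] by (rule cong_dvd_modulus_nat) (simp add: le_imp_power_dvd)
  moreover have "[u ^ (p ^ B) = 1] (mod m')" using cong_pow[OF m', of "p ^ B"] by simp
  moreover have "coprime (p ^ B) m'" using p by (simp add: prime_imp_coprime)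
  ultimately have "[u ^ (p ^ B) = 1] (mod p ^ B * m')" by (rule coprime_cong_mult_nat)
  then show "prime_power_order p M u" using u(1) M by (auto simp: prime_power_order_def)
qed

text \<open>The factor m' absorbs the whole prime-to-p part of c, so only the power of p is
  compared.\<close>

lemma multiplicity_le_iff_dvd:
  fixes c :: nat
  assumes p: "prime p" and m': "\<not> p dvd m'" and c: "c dvd p ^ B * m'"
  shows "c dvd p ^ k * m' \<longleftrightarrow> multiplicity p c \<le> k"
proof -
  have m0: "m' \<noteq> 0" using m' by (metis dvd_0_right)
  have p0: "p > 1" using p prime_gt_1_nat by blast
  have c0: "c \<noteq> 0"
  proof
    assume "c = 0"
    then have "p ^ B * m' = 0" using c by simp
    then show False using p0 m0 by simp
  qed
  have mult: "multiplicity p (p ^ k * m') = k"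
    using p m' m0 p0 by (simp add: prime_elem_multiplicity_mult_distrib not_dvd_imp_multiplicity_0)
  obtain c' where c': "c = p ^ multiplicity p c * c'" "\<not> p dvd c'"
    using multiplicity_decompose'[of c p] c0 p0 by auto
  show ?thesis
  proof
    assume "c dvd p ^ k * m'"
    then have "multiplicity p c \<le> multiplicity p (p ^ k * m')"
      using m0 p0 by (intro dvd_imp_multiplicity_le) auto
    then show "multiplicity p c \<le> k" using mult by simp
  next
    assume le: "multiplicity p c \<le> k"
    have "c' dvd p ^ B * m'" using c c' by (metis dvd_mult_right)
    moreover have "coprime c' (p ^ B)" using prime_imp_coprime[OF p c'(2)] by (simp add: coprime_commute)
    ultimately have "c' dvd m'" by (simp add: coprime_dvd_mult_right_iff)
    then have "p ^ multiplicity p c * c' dvd p ^ k * m'" using le by (intro mult_dvd_mono le_imp_power_dvd)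
    then show "c dvd p ^ k * m'" using c'(1) by simp
  qed
qed

text \<open>Write the totient of M as p^s t with t prime to p and take for e a multiple of t that is
  1 modulo p^B: raising to the power e removes the part of u of order prime to p.\<close>

lemma prime_part_exponent:
  assumes p: "prime p" and M: "M > 0"
  obtains e where "[e = 1] (mod p ^ B)" "\<And>u. coprime u M \<Longrightarrow> prime_power_order p M (u ^ e)"
proof -
  have p1: "p > 1" using p prime_gt_1_nat by blast
  obtain t where t: "totient M = p ^ multiplicity p (totient M) * t" "\<not> p dvd t"
    using multiplicity_decompose'[of "totient M" p] M p1 by auto
  define s where "s = multiplicity p (totient M)"
  have "coprime t (p ^ B)" using prime_imp_coprime[OF p t(2)] by (simp add: coprime_commute)
  moreover have "t \<noteq> 0" using t(2) by (metis dvd_0_right)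
  ultimately obtain x y where xy: "t * x = p ^ B * y + 1" using bezout_nat[of t "p ^ B"] by auto
  have "[t * x = 0 + 1] (mod p ^ B)" unfolding xy by (intro cong_add cong_refl) (simp add: cong_0_iff)
  then have "[t * x = 1] (mod p ^ B)" by simp
  moreover have "prime_power_order p M (u ^ (t * x))" if u: "coprime u M" for u
  proof -
    have "(u ^ (t * x)) ^ (p ^ s) = (u ^ totient M) ^ x"
      unfolding t(1)[folded s_def] by (simp add: power_mult[symmetric] mult_ac)
    also have "[\<dots> = 1 ^ x] (mod M)" by (intro cong_pow euler_theorem u)
    finally show ?thesis using u by (auto simp: prime_power_order_def)
  qed
  ultimately show ?thesis using that by blast
qed

section \<open>Conductors and field degrees of irreducible characters\<close>

lemma field_of_values_restr: "field_of_values X (restr X \<chi>) = field_of_values X \<chi>"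
  unfolding field_of_values_def by (intro arg_cong2[of _ _ _ _ generate_field] image_cong) (auto simp: restr_carrier)

context fin_group
begin

text \<open>When p divides M, these are the exponents of the automorphisms of the M-th cyclotomic
  field over the field generated by the p-th roots of unity and the values of \<chi>.\<close>

definition fixers :: "nat \<Rightarrow> nat \<Rightarrow> ('a \<Rightarrow> complex) \<Rightarrow> nat set" where
  "fixers p M \<chi> = {u. coprime u M \<and> [u = 1] (mod p) \<and> twist u \<chi> = \<chi>}"

text \<open>The stabilizer called P in the overview; reducing modulo M makes it a finite set, as the
  fixed point counts require.\<close>

definition p_fixers :: "nat \<Rightarrow> nat \<Rightarrow> ('a \<Rightarrow> complex) \<Rightarrow> nat set" where
  "p_fixers p M \<chi> = {u \<in> fixers p M \<chi>. u < M \<and> prime_power_order p M u}"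

definition p_conductor :: "nat \<Rightarrow> ('a \<Rightarrow> complex) \<Rightarrow> nat" where
  "p_conductor p \<chi> = multiplicity p (conductor X \<chi>)"

lemma finite_p_fixers: "finite (p_fixers p M \<chi>)"
  by (rule finite_subset[of _ "{..<M}"]) (auto simp: p_fixers_def)

context
  fixes p M B m' :: nat
  assumes p: "prime p" "\<not> p dvd m'" and M: "M = p ^ B * m'" and cM: "card (carrier X) dvd M"
begin

lemma M_pos: "M > 0"
  using p M prime_gt_0_nat[OF p(1)] by (auto intro!: Nat.gr0I)

lemma field_of_values_cyc:
  assumes \<chi>: "\<chi> \<in> IR X" and c: "c > 0"
  shows "field_of_values X \<chi> \<subseteq> cyc c \<longleftrightarrow> \<chi> ` carrier X \<subseteq> cyc c"
  unfolding field_of_values_def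
  using generate_field_minimal[OF csubfield_cyc[OF c]] generate_field_superset[of "\<chi> ` carrier X"] by blast

lemma values_in_cyc: "\<chi> \<in> IR X \<Longrightarrow> \<chi> ` carrier X \<subseteq> cyc M"
  using IR_power_values(1)[OF M_pos cM] by auto

text \<open>The conductor divides M. Testing at level p^k m', which contains the full prime-to-p
  part of M, leaves only the p-part of the conductor to be decided.\<close>

lemma p_conductor_le_iff:
  assumes \<chi>: "\<chi> \<in> IR X" and k: "k \<le> B"
  shows "p_conductor p \<chi> \<le> k \<longleftrightarrow> (\<forall>u. coprime u M \<longrightarrow> [u = 1] (mod p ^ k * m') \<longrightarrow> twist u \<chi> = \<chi>)"
proof -
  have dvd: "p ^ k * m' dvd M" unfolding M using k by (intro mult_dvd_mono le_imp_power_dvd) auto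
  then have pos: "p ^ k * m' > 0" using M_pos by (auto intro!: Nat.gr0I)
  have fv: "field_of_values X \<chi> \<subseteq> cyc M" using values_in_cyc[OF \<chi>] field_of_values_cyc[OF \<chi> M_pos] by simp
  have cdvd: "conductor X \<chi> dvd p ^ B * m'" using conductor_dvd_iff[OF M_pos fv M_pos] fv M by simp
  have "p_conductor p \<chi> \<le> k \<longleftrightarrow> conductor X \<chi> dvd p ^ k * m'"
    unfolding p_conductor_def by (rule multiplicity_le_iff_dvd[OF p cdvd, symmetric])
  also have "\<dots> \<longleftrightarrow> field_of_values X \<chi> \<subseteq> cyc (p ^ k * m')"
    by (rule conductor_dvd_iff[OF pos fv M_pos, symmetric])
  also have "\<dots> \<longleftrightarrow> \<chi> ` carrier X \<subseteq> cyc (p ^ k * m')" by (rule field_of_values_cyc[OF \<chi> pos])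
  also have "\<dots> \<longleftrightarrow> (\<forall>u. coprime u M \<longrightarrow> [u = 1] (mod p ^ k * m') \<longrightarrow> fixes_pointwise M (\<chi> ` carrier X) u)"
    by (rule subset_cyc_iff[OF M_pos dvd values_in_cyc[OF \<chi>]])
  finally show ?thesis unfolding fixes_pointwise_iff_twist[OF M_pos cM \<chi>] by blast
qed

lemma p_conductor_le: "\<chi> \<in> IR X \<Longrightarrow> p_conductor p \<chi> \<le> B"
  using p_conductor_le_iff[of \<chi> B] twist_cong[OF M_pos cM] twist_one M by fastforce

text \<open>For k \<ge> 1 the units tested at level p^k m' have p-power order and are 1 modulo p, so
  this stabilizer sees all of them.\<close>

lemma p_conductor_le_iff_p_fixers:
  assumes \<chi>: "\<chi> \<in> IR X" and k: "1 \<le> k" "k \<le> B"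
  shows "p_conductor p \<chi> \<le> k \<longleftrightarrow>
    {u. u < M \<and> coprime u M \<and> [u = 1] (mod p ^ k * m')} \<subseteq> p_fixers p M \<chi>"
proof
  assume "p_conductor p \<chi> \<le> k"
  then show "{u. u < M \<and> coprime u M \<and> [u = 1] (mod p ^ k * m')} \<subseteq> p_fixers p M \<chi>"
    using p_conductor_le_iff[OF \<chi> k(2)] prime_power_orderI[OF p M k(1)]
    by (auto simp: p_fixers_def fixers_def)
next
  assume H: "{u. u < M \<and> coprime u M \<and> [u = 1] (mod p ^ k * m')} \<subseteq> p_fixers p M \<chi>"
  have "twist u \<chi> = \<chi>" if u: "coprime u M" "[u = 1] (mod p ^ k * m')" for u
  proof -
    have dvd: "p ^ k * m' dvd M" unfolding M using k by (intro mult_dvd_mono le_imp_power_dvd) auto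
    have c: "[u mod M = u] (mod M)" by (simp add: cong_def)
    have "coprime (u mod M) M" using u(1) M_pos by simp
    moreover have "[u mod M = 1] (mod p ^ k * m')"
      using cong_dvd_modulus_nat[OF c dvd] u(2) cong_trans by blast
    ultimately have "u mod M \<in> p_fixers p M \<chi>" using H M_pos by auto
    then show ?thesis using twist_cong[OF M_pos cM c] by (simp add: p_fixers_def fixers_def)
  qed
  then show "p_conductor p \<chi> \<le> k" using p_conductor_le_iff[OF \<chi> k(2)] by blast
qed

lemma degree_dvd_field_of_values_iff:
  assumes \<chi>: "\<chi> \<in> IR X" and a: "1 \<le> a" "a \<le> B"
  shows "degree_dvd (compositum (cyclo_field (p ^ a)) (field_of_values X \<chi>))
      (compositum (cyclo_field p) (field_of_values X \<chi>)) d \<longleftrightarrow> card ((\<lambda>u. u mod p ^ a) ` fixers p M \<chi>) dvd d"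
proof -
  have q: "p ^ a dvd M" "p dvd p ^ a" unfolding M using a by (auto intro!: dvd_mult2 le_imp_power_dvd dvd_power)
  have "{u. fixes_pointwise M (\<chi> ` carrier X) u \<and> [u = 1] (mod p)} = fixers p M \<chi>"
    by (auto simp: fixers_def fixes_pointwise_iff_twist[OF M_pos cM \<chi>])
  then show ?thesis
    unfolding field_of_values_def by (simp add: degree_dvd_compositum_iff[OF M_pos q values_in_cyc[OF \<chi>]])
qed

lemma twist_power_fixed: "\<chi> \<in> IR X \<Longrightarrow> twist u \<chi> = \<chi> \<Longrightarrow> twist (u ^ k) \<chi> = \<chi>"
  by (induction k) (auto simp: twist_one[unfolded One_nat_def] simp flip: twist_twist)

text \<open>Replace u by u^e with e from \<open>prime_part_exponent\<close>. It has p-power order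
  and still fixes \<chi>; and it has the same residue modulo p^a, as e is 1 modulo p^a and u^(p^a)
  is 1 modulo p^a.\<close>

lemma fixers_residues:
  assumes \<chi>: "\<chi> \<in> IR X" and a: "1 \<le> a" "a \<le> B"
  shows "(\<lambda>u. u mod p ^ a) ` fixers p M \<chi> = (\<lambda>u. u mod p ^ a) ` p_fixers p M \<chi>"
proof (intro equalityI subsetI)
  fix v assume "v \<in> (\<lambda>u. u mod p ^ a) ` fixers p M \<chi>"
  then obtain u where u: "coprime u M" "[u = 1] (mod p)" "twist u \<chi> = \<chi>" "v = u mod p ^ a" by (auto simp: fixers_def)
  obtain e where e: "[e = 1] (mod p ^ a)" "\<And>u. coprime u M \<Longrightarrow> prime_power_order p M (u ^ e)"
    by (rule prime_part_exponent[OF p(1) M_pos, of a]) blast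
  define w where "w = u ^ e mod M"
  have wM: "[w = u ^ e] (mod M)" by (simp add: w_def cong_def)
  have paM: "p ^ a dvd M" unfolding M using a by (intro dvd_mult2 le_imp_power_dvd)
  have "p dvd p ^ a" using a by (simp add: dvd_power)
  then have pM: "p dvd M" using paM by (rule dvd_trans)
  have ord: "prime_power_order p M (u ^ e)" by (rule e(2)[OF u(1)])
  have wc: "coprime w M" using u(1) wM by (metis cong_imp_coprime cong_sym coprime_power_left_iff)
  have "prime_power_order p M w"
  proof -
    obtain k where "[(u ^ e) ^ (p ^ k) = 1] (mod M)" using ord by (auto simp: prime_power_order_def)
    then have "[w ^ (p ^ k) = 1] (mod M)" using cong_pow[OF wM] cong_trans by blast
    then show ?thesis using wc by (auto simp: prime_power_order_def)
  qed
  moreover have "twist w \<chi> = \<chi>" unfolding twist_cong[OF M_pos cM wM] by (rule twist_power_fixed[OF \<chi> u(3)])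
  moreover have "[w = 1] (mod p)"
    using cong_dvd_modulus_nat[OF wM pM] cong_pow[OF u(2), of e] cong_trans by (metis power_one)
  ultimately have "w \<in> p_fixers p M \<chi>" using wc M_pos by (auto simp: p_fixers_def fixers_def w_def)
  moreover have "w mod p ^ a = v"
  proof -
    have e0: "e \<noteq> 0"
    proof
      assume "e = 0"
      then have "p ^ a dvd 1" using e(1) by (simp add: cong_def)
      then show False using a prime_gt_1_nat[OF p(1)] by simp
    qed
    have "p ^ a dvd e - 1" using e(1) e0 by (simp add: cong_altdef_nat)
    then obtain y where y: "e = 1 + p ^ a * y" using e0 by (metis dvdE le_add_diff_inverse less_one not_le)
    have "[u ^ (p ^ a) = 1] (mod p ^ a)"
      using power_prime_power_cong_1[OF u(2), of a] by (rule cong_dvd_modulus_nat) (simp add: le_imp_power_dvd)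
    then have "[u * (u ^ (p ^ a)) ^ y = u * 1 ^ y] (mod p ^ a)" by (intro cong_mult cong_pow cong_refl)
    then have "[u ^ e = u] (mod p ^ a)" unfolding y by (simp add: power_add power_mult)
    then show ?thesis using cong_dvd_modulus_nat[OF wM paM] u(4) by (simp add: cong_def)
  qed
  ultimately show "v \<in> (\<lambda>u. u mod p ^ a) ` p_fixers p M \<chi>" by blast
qed (auto simp: p_fixers_def)

lemma card_fixers_residues_prime_power:
  assumes \<chi>: "\<chi> \<in> IR X" and a: "1 \<le> a" "a \<le> B"
  shows "\<exists>k. card ((\<lambda>u. u mod p ^ a) ` fixers p M \<chi>) = p ^ k"
proof (rule card_unit_subgroup_prime_power[OF p(1) a(1)])
  let ?D = "(\<lambda>u. u mod p ^ a) ` fixers p M \<chi>"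
  have pp: "p dvd p ^ a" using a by (simp add: dvd_power)
  have p1: "1 < p ^ a" using prime_gt_1_nat[OF p(1)] a by (intro one_less_power) auto
  have "u mod p ^ a < p ^ a" for u using p1 by (intro mod_less_divisor) linarith
  then show "?D \<subseteq> {u. u < p ^ a \<and> [u = 1] (mod p)}"
    using pp by (auto simp: fixers_def cong_def mod_mod_cancel)
  show "1 \<in> ?D" using p1 a \<chi> by (intro image_eqI[of _ _ 1]) (auto simp: fixers_def twist_one[unfolded One_nat_def])
  fix u v assume "u \<in> ?D" "v \<in> ?D"
  then obtain u' v' where uv: "u' \<in> fixers p M \<chi>" "v' \<in> fixers p M \<chi>" "u = u' mod p ^ a" "v = v' mod p ^ a" by blast
  have "u' * v' \<in> fixers p M \<chi>"
    using uv(1,2) cong_mult[of u' 1 p v' 1] by (auto simp: fixers_def simp flip: twist_twist)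
  moreover have "u * v mod p ^ a = (u' * v') mod p ^ a" unfolding uv by (rule mod_mult_eq)
  ultimately show "u * v mod p ^ a \<in> ?D" by blast
qed

text \<open>Passing from \<open>Irr\<close> to \<open>IR\<close> is possible because degree,
  conductor and field of values depend only on the values on the carrier.\<close>

lemma star_p_iff:
  "star_p p X \<longleftrightarrow> (\<forall>\<chi>\<in>IR X. p_conductor p \<chi> \<ge> 1 \<longrightarrow>
     (\<exists>d. \<chi> \<one> = of_nat d \<and> card ((\<lambda>u. u mod p ^ p_conductor p \<chi>) ` fixers p M \<chi>) dvd d))"
proof -
  define P where "P \<chi> \<longleftrightarrow> (p_conductor p \<chi> \<ge> 1 \<longrightarrow> (\<exists>d. \<chi> \<one> = of_nat d \<and>
    degree_dvd (compositum (cyclo_field (p ^ p_conductor p \<chi>)) (field_of_values X \<chi>))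
      (compositum (cyclo_field p) (field_of_values X \<chi>)) d))" for \<chi>
  have P_restr: "P (restr X \<chi>) \<longleftrightarrow> P \<chi>" for \<chi>
    by (simp add: P_def p_conductor_def conductor_def field_of_values_restr restr_carrier)
  have "star_p p X \<longleftrightarrow> (\<forall>\<chi>\<in>Irr X. P \<chi>)" by (simp add: star_p_def P_def p_conductor_def Let_def)
  also have "\<dots> \<longleftrightarrow> (\<forall>\<chi>\<in>IR X. P \<chi>)"
    using Irr_iff_restr[of _ X] P_restr IR_subset_Irr[of _ X] by blast
  also have "\<dots> \<longleftrightarrow> (\<forall>\<chi>\<in>IR X. p_conductor p \<chi> \<ge> 1 \<longrightarrow>
     (\<exists>d. \<chi> \<one> = of_nat d \<and> card ((\<lambda>u. u mod p ^ p_conductor p \<chi>) ` fixers p M \<chi>) dvd d))"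
    unfolding P_def using degree_dvd_field_of_values_iff p_conductor_le by (intro ball_cong refl) auto
  finally show ?thesis .
qed

lemma card_fixers_residues_1:
  assumes "\<chi> \<in> IR X" "B \<ge> 1" shows "card ((\<lambda>u. u mod p ^ 1) ` fixers p M \<chi>) = 1"
proof -
  have "(\<lambda>u. u mod p ^ 1) ` fixers p M \<chi> = {1}"
    using prime_gt_1_nat[OF p(1)] assms(1)
    by (auto simp: fixers_def cong_def twist_one[unfolded One_nat_def] intro!: image_eqI[of _ _ 1])
  then show ?thesis by simp
qed

end

end

section \<open>Transfer between a group and a normal subgroup of index prime to \<open>p\<close>\<close>

context clifford
begin

context
  fixes p M B m' :: nat
  assumes p: "prime p" "\<not> p dvd m'" and M: "M = p ^ B * m'" and cM: "card (carrier X) dvd M"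
    and idx: "\<not> p dvd card (rcosets N)"
begin

lemma exponent_pos: "M > 0" by (rule M_pos[OF p M cM])

lemma card_N_dvd_exponent: "card (carrier Y) dvd M" by (rule card_N_dvd[OF exponent_pos cM])

text \<open>Thereby a unit that is 1 modulo m' is 1 modulo the index, as required for
  \<open>twist_fixed_of_constituents\<close>.\<close>

lemma card_rcosets_dvd_prime_to_p_part: "card (rcosets N) dvd m'"
proof -
  have "card (rcosets N) dvd card (carrier X)"
    using lagrange[OF subgroupN] by (metis Coset.order_def dvd_triv_left)
  then have "card (rcosets N) dvd p ^ B * m'" using cM M dvd_trans by blast
  moreover have "coprime (card (rcosets N)) (p ^ B)"
    using prime_imp_coprime[OF p(1) idx] by (simp add: coprime_commute)
  ultimately show ?thesis by (simp add: coprime_dvd_mult_right_iff)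
qed

lemma p_fixers_above_subset:
  assumes \<chi>: "\<chi> \<in> IR X" and \<theta>: "\<theta> \<in> IR Y" "m \<chi> \<theta> \<noteq> 0"
  shows "p_fixers p M \<chi> \<subseteq> Y.p_fixers p M \<theta>"
proof
  fix u assume u: "u \<in> p_fixers p M \<chi>"
  have "Y.twist u \<theta> = \<theta>"
    by (rule constituents_fixed[OF exponent_pos cM p(1) idx finite_p_fixers[of p M \<chi>] _ \<chi> _ \<theta> u])
      (auto simp: p_fixers_def fixers_def)
  then show "u \<in> Y.p_fixers p M \<theta>" using u by (simp add: p_fixers_def fixers_def Y.p_fixers_def Y.fixers_def)
qed

text \<open>One inequality follows from the inclusion of the stabilizers; the other one from units
  that fix \<theta>, hence all its conjugates, and therefore \<chi> by way of cyclic
  quotients.\<close>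

lemma p_conductor_above:
  assumes \<chi>: "\<chi> \<in> IR X" and \<theta>: "\<theta> \<in> IR Y" "m \<chi> \<theta> \<noteq> 0" and a: "p_conductor p \<chi> \<ge> 2"
  shows "Y.p_conductor p \<theta> = p_conductor p \<chi>"
proof -
  define a b where "a = p_conductor p \<chi>" and "b = Y.p_conductor p \<theta>"
  have aB: "a \<le> B" unfolding a_def by (rule p_conductor_le[OF p M cM \<chi>])
  have bB: "b \<le> B" unfolding b_def by (rule Y.p_conductor_le[OF p M card_N_dvd_exponent \<theta>(1)])
  have a2: "a \<ge> 2" using a by (simp add: a_def)
  have "b \<le> a"
    using p_conductor_le_iff_p_fixers[OF p M cM \<chi>, of a] Y.p_conductor_le_iff_p_fixers[OF p M card_N_dvd_exponent \<theta>(1), of a]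
      p_fixers_above_subset[OF \<chi> \<theta>] a2 aB by (auto simp: a_def b_def)
  \<comment> \<open>Level at least 1 is needed for the units to have p-power order; since a \<ge> 2,
    the maximum must be b.\<close>
  moreover have "a \<le> max b 1"
  proof -
    define k where "k = max b 1"
    have k: "1 \<le> k" "k \<le> B" "b \<le> k" using a2 aB bB by (auto simp: k_def)
    have "twist u \<chi> = \<chi>" if u: "coprime u M" "[u = 1] (mod p ^ k * m')" for u
    proof (rule twist_fixed_of_constituents[OF exponent_pos cM p(1) idx])
      show "prime_power_order p M u" by (rule prime_power_orderI(1)[OF p M k(1) u])
      show "[u = 1] (mod card (rcosets N))"
        using u(2) by (rule cong_dvd_modulus_nat) (use card_rcosets_dvd_prime_to_p_part in simp)
      show "\<chi> \<in> IR X" by (rule \<chi>)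
      have fix\<theta>: "Y.twist u \<theta> = \<theta>"
        using Y.p_conductor_le_iff[OF p M card_N_dvd_exponent \<theta>(1) k(2)] k(3) u by (simp add: b_def)
      fix \<theta>' assume "\<theta>' \<in> IR Y" "m \<chi> \<theta>' \<noteq> 0"
      then obtain x where "x \<in> carrier X" "\<theta>' = conj x \<theta>"
        using constituents_orbit[OF \<chi> \<theta>] by (auto simp: orbit_def)
      then show "Y.twist u \<theta>' = \<theta>'" using conj_twist[of x u \<theta>] fix\<theta> by simp
    qed
    then have "a \<le> k" unfolding a_def using p_conductor_le_iff[OF p M cM \<chi> k(2)] by blast
    then show ?thesis by (simp add: k_def)
  qed
  ultimately show ?thesis using a2 by (simp add: a_def b_def)
qed

theorem star_p_of_normal:
  assumes "star_p p Y" shows "star_p p X"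
  unfolding star_p_iff[OF p M cM]
proof (intro ballI impI)
  fix \<chi> assume \<chi>: "\<chi> \<in> IR X" and a1: "p_conductor p \<chi> \<ge> 1"
  define a where "a = p_conductor p \<chi>"
  have aB: "a \<le> B" unfolding a_def by (rule p_conductor_le[OF p M cM \<chi>])
  obtain d where d: "\<chi> \<one> = of_nat d" using IR_degree[OF \<chi>] by blast
  have "card ((\<lambda>u. u mod p ^ a) ` fixers p M \<chi>) dvd d"
  proof (cases "a = 1")
    case True
    then show ?thesis using card_fixers_residues_1[OF p M cM \<chi>] aB by simp
  next
    case False
    then have a2: "p_conductor p \<chi> \<ge> 2" "1 \<le> a" using a1 by (auto simp: a_def)
    obtain \<theta> where \<theta>: "\<theta> \<in> IR Y" "m \<chi> \<theta> \<noteq> 0" using exists_below[OF \<chi>] by blast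
    have b: "Y.p_conductor p \<theta> = a" using p_conductor_above[OF \<chi> \<theta> a2(1)] by (simp add: a_def)
    obtain t where t: "\<theta> \<one> = of_nat t" "card ((\<lambda>u. u mod p ^ a) ` Y.fixers p M \<theta>) dvd t"
      using assms \<theta>(1) a2(2) unfolding Y.star_p_iff[OF p M card_N_dvd_exponent] by (force simp: b)
    note DX = fixers_residues[OF p M cM \<chi> a2(2) aB] and DY = Y.fixers_residues[OF p M card_N_dvd_exponent \<theta>(1) a2(2) aB]
    obtain i j where ij: "card ((\<lambda>u. u mod p ^ a) ` fixers p M \<chi>) = p ^ i" "card ((\<lambda>u. u mod p ^ a) ` Y.fixers p M \<theta>) = p ^ j"
      using card_fixers_residues_prime_power[OF p M cM \<chi> a2(2) aB] Y.card_fixers_residues_prime_power[OF p M card_N_dvd_exponent \<theta>(1) a2(2) aB] by blast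
    \<comment> \<open>The inclusion of stabilizers yields only an inequality of cardinalities;
      between powers of p this is divisibility.\<close>
    have "p ^ i \<le> p ^ j" unfolding ij[symmetric] DX DY
      by (intro card_mono image_mono p_fixers_above_subset[OF \<chi> \<theta>] finite_imageI Y.finite_p_fixers)
    then have "i \<le> j" using prime_gt_1_nat[OF p(1)] by simp
    then have "p ^ i dvd t" using t(2) unfolding ij by (meson dvd_trans le_imp_power_dvd)
    moreover have "t dvd d"
    proof -
      have "of_nat d = (of_nat (m \<chi> \<theta> * card (orbit \<theta>) * t) :: complex)"
        using degree_restriction[OF \<chi> \<theta>] d t(1) by simp
      then have "d = m \<chi> \<theta> * card (orbit \<theta>) * t" by (simp only: of_nat_eq_iff)
      then show ?thesis by simp
    qed
    ultimately show ?thesis unfolding ij using dvd_trans by blast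
  qed
  then show "\<exists>d. \<chi> \<one> = of_nat d \<and> card ((\<lambda>u. u mod p ^ p_conductor p \<chi>) ` fixers p M \<chi>) dvd d"
    using d by (auto simp: a_def)
qed

text \<open>Here \<chi> may be chosen: with one that is fixed by the whole p-part of the stabilizer
  of \<theta> both p-parts coincide, and with them the conductors and the field degrees.\<close>

theorem star_p_normal:
  assumes "star_p p X" shows "star_p p Y"
  unfolding Y.star_p_iff[OF p M card_N_dvd_exponent]
proof (intro ballI impI)
  fix \<theta> assume \<theta>: "\<theta> \<in> IR Y" and b1: "Y.p_conductor p \<theta> \<ge> 1"
  define b where "b = Y.p_conductor p \<theta>"
  have bB: "b \<le> B" unfolding b_def by (rule Y.p_conductor_le[OF p M card_N_dvd_exponent \<theta>])
  obtain t where t: "\<theta> \<one> = of_nat t" using Y.IR_degree[OF \<theta>] by auto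
  have "card ((\<lambda>u. u mod p ^ b) ` Y.fixers p M \<theta>) dvd t"
  proof (cases "b = 1")
    case True
    then show ?thesis using Y.card_fixers_residues_1[OF p M card_N_dvd_exponent \<theta>] bB by simp
  next
    case False
    then have b2: "b \<ge> 2" "1 \<le> b" using b1 by (auto simp: b_def)
    have PU: "\<And>u. u \<in> Y.p_fixers p M \<theta> \<Longrightarrow> prime_power_order p M u" "\<And>u. u \<in> Y.p_fixers p M \<theta> \<Longrightarrow> Y.twist u \<theta> = \<theta>"
      by (auto simp: Y.p_fixers_def Y.fixers_def)
    from fixed_character_above[OF exponent_pos cM p(1) idx Y.finite_p_fixers PU(1) \<theta> PU(2)]
    obtain \<chi> where \<chi>: "\<chi> \<in> IR X" "\<not> p dvd m \<chi> \<theta>" "\<forall>u\<in>Y.p_fixers p M \<theta>. twist u \<chi> = \<chi>" by blast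
    have m0: "m \<chi> \<theta> \<noteq> 0" using \<chi>(2) by (metis dvd_0_right)
    have PP: "p_fixers p M \<chi> = Y.p_fixers p M \<theta>"
      using p_fixers_above_subset[OF \<chi>(1) \<theta> m0] \<chi>(3) by (auto simp: p_fixers_def fixers_def Y.p_fixers_def Y.fixers_def)
    have le_iff: "p_conductor p \<chi> \<le> k \<longleftrightarrow> b \<le> k" if "1 \<le> k" "k \<le> B" for k
      unfolding b_def p_conductor_le_iff_p_fixers[OF p M cM \<chi>(1) that] Y.p_conductor_le_iff_p_fixers[OF p M card_N_dvd_exponent \<theta> that] PP ..
    \<comment> \<open>Since b \<ge> 2, the comparison is available at both b and b - 1, and these
      two pin the value down.\<close>
    have a: "p_conductor p \<chi> = b"
      using le_iff[of b] le_iff[of "b - 1"] b2 bB by (simp add: le_antisym) linarith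
    obtain d where d: "\<chi> \<one> = of_nat d" "card ((\<lambda>u. u mod p ^ b) ` fixers p M \<chi>) dvd d"
      using assms \<chi>(1) b2(2) unfolding star_p_iff[OF p M cM] by (force simp: a)
    have D: "(\<lambda>u. u mod p ^ b) ` Y.fixers p M \<theta> = (\<lambda>u. u mod p ^ b) ` fixers p M \<chi>"
      unfolding fixers_residues[OF p M cM \<chi>(1) b2(2) bB] Y.fixers_residues[OF p M card_N_dvd_exponent \<theta> b2(2) bB] PP ..
    obtain i where i: "card ((\<lambda>u. u mod p ^ b) ` Y.fixers p M \<theta>) = p ^ i"
      using Y.card_fixers_residues_prime_power[OF p M card_N_dvd_exponent \<theta> b2(2) bB] by blast
    have "of_nat d = (of_nat (m \<chi> \<theta> * card (orbit \<theta>) * t) :: complex)"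
      using degree_restriction[OF \<chi>(1) \<theta> m0] d(1) t by simp
    then have dt: "d = m \<chi> \<theta> * card (orbit \<theta>) * t" by (simp only: of_nat_eq_iff)
    \<comment> \<open>Both factors by which the degrees of \<chi> and \<theta> differ are prime to
      p, so the power of p passes to the degree of \<theta>.\<close>
    have "card (orbit \<theta>) dvd card (rcosets N)" using orbit_card[OF \<theta>] by (metis dvd_triv_left)
    then have "\<not> p dvd card (orbit \<theta>)" using idx dvd_trans by blast
    then have "\<not> p dvd m \<chi> \<theta> * card (orbit \<theta>)" using \<chi>(2) p(1) by (simp add: prime_dvd_mult_iff)
    then have "coprime (p ^ i) (m \<chi> \<theta> * card (orbit \<theta>))" using prime_imp_coprime[OF p(1)] by (simp only: coprime_power_left_iff) blast
    moreover have "p ^ i dvd m \<chi> \<theta> * card (orbit \<theta>) * t" using d(2) unfolding D[symmetric] i dt .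
    ultimately show ?thesis unfolding i by (simp only: coprime_dvd_mult_right_iff)
  qed
  then show "\<exists>d. \<theta> \<one>\<^bsub>Y\<^esub> = of_nat d \<and> card ((\<lambda>u. u mod p ^ Y.p_conductor p \<theta>) ` Y.fixers p M \<theta>) dvd d"
    using t by (auto simp: b_def)
qed

end

end

theorem theorem3p8:
  fixes p :: nat and G :: "('a, 'b) monoid_scheme" and N :: "'a set"
  assumes "prime p"
    and "group G" and "finite (carrier G)"
    and "N \<lhd> G"
    and "\<not> p dvd card (rcosets\<^bsub>G\<^esub> N)"
  shows "(star_p p (G\<lparr>carrier := N\<rparr>) \<longrightarrow> star_p p G)
       \<and> (solvable (G Mod N) \<and> star_p p G \<longrightarrow> star_p p (G\<lparr>carrier := N\<rparr>))"
proof -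
  interpret clifford G N
    using assms(2-4) by (intro clifford.intro fin_group.intro fin_group_axioms.intro clifford_axioms.intro)
  have "p > 1" using assms(1) by (rule prime_gt_1_nat)
  \<comment> \<open>The modulus M is the order of G itself, with exponent B the multiplicity of p in
    it.\<close>
  then obtain m' where m': "card (carrier G) = p ^ multiplicity p (card (carrier G)) * m'" "\<not> p dvd m'"
    using multiplicity_decompose'[of "card (carrier G)" p] card_pos by auto
  have "star_p p (G\<lparr>carrier := N\<rparr>) \<Longrightarrow> star_p p G"
    by (rule star_p_of_normal[OF assms(1) m'(2,1) dvd_refl assms(5)])
  moreover have "star_p p G \<Longrightarrow> star_p p (G\<lparr>carrier := N\<rparr>)"
    by (rule star_p_normal[OF assms(1) m'(2,1) dvd_refl assms(5)])
  ultimately show ?thesis by blast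
qed

end
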